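(* Assume that $t$ is a $t$-structure on a triangulated category $\mathcal{C}$ and there are enough projectives in its heart $\underline{Ht}$. I. Assume that for any projective object $P$ of $\underline{Ht}$ there exists $P'\in P_t$ along with an $\underline{Ht}$-epimorphism $H_0^t(P')\to P$. 1. Then the full subcategory $\mathcal{C}_+$ of $\mathcal{C}$ whose object class equals $\bigcup_{i\in\mathbb{Z}}\mathcal{C}_{t\ge i}$ is triangulated. Moreover, there exists a weight structure $w_+$ on $\mathcal{C}_+$ such that $(\mathcal{C}_+)_{w_+\ge 0}=\mathcal{C}_{t\ge 0}$, and $t$ is $-$-orthogonal to $w_+$. 2. Furthermore, one can extend the weight structure $w_+$ on $\mathcal{C}_+$ satisfying $(\mathcal{C}_+)_{w_+\ge 0}=\mathcal{C}_{t\ge 0}$ to a weight structure $w$ on $\mathcal{C}$ that is (left) adjacent to $t$ whenever any of the following additional assumptions is fulfilled: a. $t$ is bounded below, i.e. $\bigcup_{i\in\mathbb{Z}}\mathcal{C}_{t\ge i}=\mathrm{Obj}\,\mathcal{C}$. b. There exists an integer $n$ such that $\mathcal{C}_{t\le 0}\perp\mathcal{C}_{t\ge n}$. 3. Assume that $\mathcal{C}$ is smashing. Then there also exists a smashing weight structure $\tilde w$ on the localizing subcategory $\tilde{\mathcal{C}}$ of $\mathcal{C}$ generated by $\mathcal{C}_{t\ge 0}$ such that $\tilde{\mathcal{C}}_{\tilde w\ge 0}=\mathcal{C}_{t\ge 0}$, and its heart $\underline{H\tilde w}$ is equivalent to the subcategory of projective objects of $\underline{Ht}$. II. Assume (in addition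 to the assumption that $\underline{Ht}$ has enough projectives) that $\mathcal{C}$ satisfies the dual Brown representability property and $t$ is cosmashing. Then the category $\mathcal{C}$ is smashing and for any projective object $P$ of $\underline{Ht}$ there exists $P'\in P_t$ such that $H_0^t(P')\cong P$. Consequently, there exists a smashing weight structure $\tilde w$ on the localizing subcategory $\tilde{\mathcal{C}}$ of $\mathcal{C}$ generated by $\mathcal{C}_{t\ge 0}$ such that $\tilde{\mathcal{C}}_{\tilde w\ge 0}=\mathcal{C}_{t\ge 0}$, and $\underline{H\tilde w}$ is equivalent to the subcategory of projective objects of $\underline{Ht}$.
   Context: Conventions: all products and coproducts are small; subcategories are strictly full; $X\perp Y$ means $\mathcal{C}(X,Y)=0$, for classes $D\perp E$ means $X\perp Y$ for all $X\in D$, $Y\in E$; $D^{\perp}=\{Y:\ X\perp Y\ \forall X\in D\}$, ${}^{\perp}D=\{Y:\ Y\perp X\ \forall X\in D\}$. A triangulated category is (co)smashing if it has all small coproducts (resp. products). The localizing subcategory generated by a class $\mathcal{P}$ is the smallest triangulated subcategory containing $\mathcal{P}$ and closed under $\mathcal{C}$-coproducts. $\mathcal{C}$ satisfies the dual Brown representability property if it is cosmashing and any homological functor $\mathcal{C}\to\mathrm{Ab}$ that respects products is corepresentable. A $t$-structure $t=(\mathcal{C}_{t\le 0},\mathcal{C}_{t\ge 0})$ on $\mathcal{C}$ (homological convention) is a pair of classes of objects closed under isomorphism such that $\mathcal{C}_{t\le 0}\subset \mathcal{C}_{t\le 0}[1]$, $\mathcal{C}_{t\ge 0}[1]\subset \mathcal{C}_{t\ge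 0}$, $\mathcal{C}_{t\ge 0}[1]\perp \mathcal{C}_{t\le 0}$, and every object $M$ fits into a distinguished triangle $L_tM\to M\to R_tM\to L_tM[1]$ with $L_tM\in \mathcal{C}_{t\ge 0}$, $R_tM\in\mathcal{C}_{t\le 0}[-1]$ (functorial in $M$). $\mathcal{C}_{t\le i}=\mathcal{C}_{t\le 0}[i]$, $\mathcal{C}_{t\ge i}=\mathcal{C}_{t\ge 0}[i]$; the heart $\underline{Ht}$ is the full (abelian) subcategory with objects $\mathcal{C}_{t\le 0}\cap \mathcal{C}_{t\ge 0}$. $t_{\ge 0}=L_t$, $t_{\le 0}=[1]\circ R_t\circ[-1]$, and $H_0^t=t_{\le 0}\circ t_{\ge 0}:\mathcal{C}\to\underline{Ht}$ is the corresponding homological functor. $t$ is cosmashing if $\mathcal{C}$ is and $\mathcal{C}_{t\ge 0}$ is closed under products. $P_t={}^{\perp}(\mathcal{C}_{t\le -1}\cup\mathcal{C}_{t\ge 1})$. A weight structure $w=(\mathcal{E}_{w\le 0},\mathcal{E}_{w\ge 0})$ on a triangulated category $\mathcal{E}$ is a pair of classes of objects closed under retracts such that $\mathcal{E}_{w\le 0}\subset \mathcal{E}_{w\le 0}[1]$, $\mathcal{E}_{w\ge 0}[1]\subset \mathcal{E}_{w\ge 0}$, $\mathcal{E}_{w\le 0}\perp \mathcal{E}_{w\ge 0}[1]$, and every object $M$ fits into a distinguished triangle $L\to M\to R\to L[1]$ with $L\in \mathcal{E}_{w\le 0}$, $R\in\mathcal{E}_{w\ge 0}[1]$. Its heart is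 the full subcategory with objects $\mathcal{E}_{w\le 0}\cap \mathcal{E}_{w\ge 0}$. $w$ is smashing if $\mathcal{E}$ is and $\mathcal{E}_{w\ge 0}$ is closed under coproducts. A weight structure $w$ on $\mathcal{C}$ extends $w_+$ if the classes of $w_+$ are the intersections of those of $w$ with $\mathrm{Obj}\,\mathcal{C}_+$. A weight structure $w$ on $\mathcal{C}$ is left adjacent to $t$ if $\mathcal{C}_{w\ge 0}=\mathcal{C}_{t\ge 0}$. For a weight structure $w$ on a triangulated subcategory $\mathcal{C}'\subset\mathcal{C}$, $t$ is $-$-orthogonal to $w$ if $\mathcal{C}_{t\le -1}=(\mathcal{C}'_{w\ge 0})^{\perp}$. *)

theory Defs
  imports "HOL-Algebra.Coset" "HOL-Library.Equipollence"
begin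

record ('o, 'm) cat_data =
  Obj :: "'o set"
  Arr :: "'m set"
  Dom :: "'m \<Rightarrow> 'o"
  Cod :: "'m \<Rightarrow> 'o"
  Ident :: "'o \<Rightarrow> 'm"
  Comp :: "'m \<Rightarrow> 'm \<Rightarrow> 'm"  (infixl \<open>\<cdot>\<index>\<close> 70)

definition Hom :: "('o, 'm, 'z) cat_data_scheme \<Rightarrow> 'o \<Rightarrow> 'o \<Rightarrow> 'm set"
  where "Hom C X Y = {f \<in> Arr C. Dom C f = X \<and> Cod C f = Y}"

locale category =
  fixes C :: "('o, 'm, 'z) cat_data_scheme" (structure)
  assumes dom_in: "f \<in> Arr C \<Longrightarrow> Dom C f \<in> Obj C"
    and cod_in: "f \<in> Arr C \<Longrightarrow> Cod C f \<in> Obj C"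
    and ident_in: "X \<in> Obj C \<Longrightarrow> Ident C X \<in> Hom C X X"
    and comp_in: "\<lbrakk>f \<in> Hom C X Y; g \<in> Hom C Y Z\<rbrakk> \<Longrightarrow> g \<cdot> f \<in> Hom C X Z"
    and comp_ident_right: "f \<in> Hom C X Y \<Longrightarrow> f \<cdot> Ident C X = f"
    and comp_ident_left: "f \<in> Hom C X Y \<Longrightarrow> Ident C Y \<cdot> f = f"
    and comp_assoc: "\<lbrakk>f \<in> Hom C X Y; g \<in> Hom C Y Z; h \<in> Hom C Z W\<rbrakk>
      \<Longrightarrow> (h \<cdot> g) \<cdot> f = h \<cdot> (g \<cdot> f)"

definition is_iso :: "('o, 'm, 'z) cat_data_scheme \<Rightarrow> 'o \<Rightarrow> 'o \<Rightarrow> 'm \<Rightarrow> bool"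
  where "is_iso C X Y f \<longleftrightarrow> X \<in> Obj C \<and> Y \<in> Obj C \<and> f \<in> Hom C X Y \<and>
    (\<exists>g \<in> Hom C Y X. g \<cdot>\<^bsub>C\<^esub> f = Ident C X \<and> f \<cdot>\<^bsub>C\<^esub> g = Ident C Y)"

definition isomorphic :: "('o, 'm, 'z) cat_data_scheme \<Rightarrow> 'o \<Rightarrow> 'o \<Rightarrow> bool"
  where "isomorphic C X Y \<longleftrightarrow> (\<exists>f. is_iso C X Y f)"

definition iso_closed :: "('o, 'm, 'z) cat_data_scheme \<Rightarrow> 'o set \<Rightarrow> bool"
  where "iso_closed C D \<longleftrightarrow> (\<forall>X \<in> D. \<forall>Y. isomorphic C X Y \<longrightarrow> Y \<in> D)"

definition retract_of_object :: "('o, 'm, 'z) cat_data_scheme \<Rightarrow> 'o \<Rightarrow> 'o \<Rightarrow> bool"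
  where "retract_of_object C X Y \<longleftrightarrow> X \<in> Obj C \<and> Y \<in> Obj C \<and>
    (\<exists>i \<in> Hom C X Y. \<exists>p \<in> Hom C Y X. p \<cdot>\<^bsub>C\<^esub> i = Ident C X)"

definition retract_closed :: "('o, 'm, 'z) cat_data_scheme \<Rightarrow> 'o set \<Rightarrow> bool"
  where "retract_closed C D \<longleftrightarrow> (\<forall>Y \<in> D. \<forall>X. retract_of_object C X Y \<longrightarrow> X \<in> D)"

definition epimorphism :: "('o, 'm, 'z) cat_data_scheme \<Rightarrow> 'm \<Rightarrow> bool"
  where "epimorphism C e \<longleftrightarrow> e \<in> Arr C \<and>
    (\<forall>Z. \<forall>f \<in> Hom C (Cod C e) Z. \<forall>g \<in> Hom C (Cod C e) Z. f \<cdot>\<^bsub>C\<^esub> e = g \<cdot>\<^bsub>C\<^esub> e \<longrightarrow> f = g)"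

definition projective :: "('o, 'm, 'z) cat_data_scheme \<Rightarrow> 'o \<Rightarrow> bool"
  where "projective C P \<longleftrightarrow> P \<in> Obj C \<and>
    (\<forall>A B. \<forall>e \<in> Hom C A B. epimorphism C e \<longrightarrow>
      (\<forall>f \<in> Hom C P B. \<exists>g \<in> Hom C P A. e \<cdot>\<^bsub>C\<^esub> g = f))"

definition enough_projectives :: "('o, 'm, 'z) cat_data_scheme \<Rightarrow> bool"
  where "enough_projectives C \<longleftrightarrow>
    (\<forall>X \<in> Obj C. \<exists>P. projective C P \<and> (\<exists>e \<in> Hom C P X. epimorphism C e))"

text \<open>All further fields of the record (addition, shift, distinguished triangles) are inherited;
  they are only ever consulted on the remaining objects and arrows.\<close>

definition full_subcat :: "('o, 'm, 'z) cat_data_scheme \<Rightarrow> 'o set \<Rightarrow> ('o, 'm, 'z) cat_data_scheme"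
  where "full_subcat C D = C\<lparr>Obj := Obj C \<inter> D,
    Arr := {f \<in> Arr C. Dom C f \<in> D \<and> Cod C f \<in> D}\<rparr>"

definition is_functor ::
  "('o, 'm, 'z) cat_data_scheme \<Rightarrow> ('p, 'n, 'y) cat_data_scheme \<Rightarrow> ('o \<Rightarrow> 'p) \<Rightarrow> ('m \<Rightarrow> 'n) \<Rightarrow> bool"
  where "is_functor A B FO FM \<longleftrightarrow>
    (\<forall>X \<in> Obj A. FO X \<in> Obj B \<and> FM (Ident A X) = Ident B (FO X)) \<and>
    (\<forall>X Y. \<forall>f \<in> Hom A X Y. FM f \<in> Hom B (FO X) (FO Y)) \<and>
    (\<forall>X Y Z. \<forall>f \<in> Hom A X Y. \<forall>g \<in> Hom A Y Z. FM (g \<cdot>\<^bsub>A\<^esub> f) = FM g \<cdot>\<^bsub>B\<^esub> FM f)"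

definition naturally_isomorphic ::
  "('o, 'm, 'z) cat_data_scheme \<Rightarrow> ('p, 'n, 'y) cat_data_scheme \<Rightarrow>
    ('o \<Rightarrow> 'p) \<Rightarrow> ('m \<Rightarrow> 'n) \<Rightarrow> ('o \<Rightarrow> 'p) \<Rightarrow> ('m \<Rightarrow> 'n) \<Rightarrow> bool"
  where "naturally_isomorphic A B FO FM GO GM \<longleftrightarrow>
    (\<exists>\<eta>. (\<forall>X \<in> Obj A. is_iso B (FO X) (GO X) (\<eta> X)) \<and>
      (\<forall>X Y. \<forall>f \<in> Hom A X Y. \<eta> Y \<cdot>\<^bsub>B\<^esub> FM f = GM f \<cdot>\<^bsub>B\<^esub> \<eta> X))"

definition equivalent_categories ::
  "('o, 'm, 'z) cat_data_scheme \<Rightarrow> ('p, 'n, 'y) cat_data_scheme \<Rightarrow> bool"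
  where "equivalent_categories A B \<longleftrightarrow>
    (\<exists>FO FM GO GM. is_functor A B FO FM \<and> is_functor B A GO GM \<and>
      naturally_isomorphic A A (GO \<circ> FO) (GM \<circ> FM) id id \<and>
      naturally_isomorphic B B (FO \<circ> GO) (FM \<circ> GM) id id)"

text \<open>Size is measured by a type \<open>'u\<close> playing the role of the class of all sets: a set is small
  if it is strictly smaller than the universe of \<open>'u\<close>. If the cardinality of \<open>'u\<close> is
  inaccessible, this is smallness with respect to a Grothendieck universe. Every small set is
  equipollent to a subset of \<open>'u\<close>, so it is enough to consider families indexed by sets of
  elements of \<open>'u\<close>.\<close>

definition small :: "'u itself \<Rightarrow> 'a set \<Rightarrow> bool"
  where "small U A \<longleftrightarrow> A \<prec> (UNIV :: 'u set)"

definition locally_small :: "'u itself \<Rightarrow> ('o, 'm, 'z) cat_data_scheme \<Rightarrow> bool"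
  where "locally_small U C \<longleftrightarrow> (\<forall>X \<in> Obj C. \<forall>Y \<in> Obj C. small U (Hom C X Y))"

definition is_coproduct ::
  "('o, 'm, 'z) cat_data_scheme \<Rightarrow> 'i set \<Rightarrow> ('i \<Rightarrow> 'o) \<Rightarrow> 'o \<Rightarrow> ('i \<Rightarrow> 'm) \<Rightarrow> bool"
  where "is_coproduct C I X S \<iota> \<longleftrightarrow> S \<in> Obj C \<and> (\<forall>i \<in> I. \<iota> i \<in> Hom C (X i) S) \<and>
    (\<forall>Y \<in> Obj C. \<forall>f. (\<forall>i \<in> I. f i \<in> Hom C (X i) Y) \<longrightarrow>
      (\<exists>!g. g \<in> Hom C S Y \<and> (\<forall>i \<in> I. g \<cdot>\<^bsub>C\<^esub> \<iota> i = f i)))"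

definition is_product ::
  "('o, 'm, 'z) cat_data_scheme \<Rightarrow> 'i set \<Rightarrow> ('i \<Rightarrow> 'o) \<Rightarrow> 'o \<Rightarrow> ('i \<Rightarrow> 'm) \<Rightarrow> bool"
  where "is_product C I X S \<pi> \<longleftrightarrow> S \<in> Obj C \<and> (\<forall>i \<in> I. \<pi> i \<in> Hom C S (X i)) \<and>
    (\<forall>Y \<in> Obj C. \<forall>f. (\<forall>i \<in> I. f i \<in> Hom C Y (X i)) \<longrightarrow>
      (\<exists>!g. g \<in> Hom C Y S \<and> (\<forall>i \<in> I. \<pi> i \<cdot>\<^bsub>C\<^esub> g = f i)))"

definition smashing :: "'u itself \<Rightarrow> ('o, 'm, 'z) cat_data_scheme \<Rightarrow> bool"
  where "smashing U C \<longleftrightarrow>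
    (\<forall>(I :: 'u set) X. small U I \<longrightarrow> (\<forall>i \<in> I. X i \<in> Obj C) \<longrightarrow> (\<exists>S \<iota>. is_coproduct C I X S \<iota>))"

definition cosmashing :: "'u itself \<Rightarrow> ('o, 'm, 'z) cat_data_scheme \<Rightarrow> bool"
  where "cosmashing U C \<longleftrightarrow>
    (\<forall>(I :: 'u set) X. small U I \<longrightarrow> (\<forall>i \<in> I. X i \<in> Obj C) \<longrightarrow> (\<exists>S \<pi>. is_product C I X S \<pi>))"

definition coproduct_closed :: "'u itself \<Rightarrow> ('o, 'm, 'z) cat_data_scheme \<Rightarrow> 'o set \<Rightarrow> bool"
  where "coproduct_closed U C D \<longleftrightarrow>
    (\<forall>(I :: 'u set) X S \<iota>. small U I \<longrightarrow> (\<forall>i \<in> I. X i \<in> D) \<longrightarrow> is_coproduct C I X S \<iota> \<longrightarrow> S \<in> D)"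

definition product_closed :: "'u itself \<Rightarrow> ('o, 'm, 'z) cat_data_scheme \<Rightarrow> 'o set \<Rightarrow> bool"
  where "product_closed U C D \<longleftrightarrow>
    (\<forall>(I :: 'u set) X S \<pi>. small U I \<longrightarrow> (\<forall>i \<in> I. X i \<in> D) \<longrightarrow> is_product C I X S \<pi> \<longrightarrow> S \<in> D)"

record ('o, 'm) preadd_data = "('o, 'm) cat_data" +
  Add :: "'m \<Rightarrow> 'm \<Rightarrow> 'm"
  Zero :: "'o \<Rightarrow> 'o \<Rightarrow> 'm"

definition hom_group :: "('o, 'm, 'z) preadd_data_scheme \<Rightarrow> 'o \<Rightarrow> 'o \<Rightarrow> 'm monoid"
  where "hom_group C X Y = \<lparr>carrier = Hom C X Y, monoid.mult = Add C, one = Zero C X Y\<rparr>"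

definition Neg :: "('o, 'm, 'z) preadd_data_scheme \<Rightarrow> 'm \<Rightarrow> 'm"
  where "Neg C f = inv\<^bsub>hom_group C (Dom C f) (Cod C f)\<^esub> f"

definition zero_object :: "('o, 'm, 'z) preadd_data_scheme \<Rightarrow> 'o \<Rightarrow> bool"
  where "zero_object C N \<longleftrightarrow> N \<in> Obj C \<and>
    (\<forall>X \<in> Obj C. Hom C N X = {Zero C N X} \<and> Hom C X N = {Zero C X N})"

locale preadditive_category = category C
  for C :: "('o, 'm, 'z) preadd_data_scheme" (structure) +
  assumes hom_comm_group: "\<lbrakk>X \<in> Obj C; Y \<in> Obj C\<rbrakk> \<Longrightarrow> comm_group (hom_group C X Y)"
    and comp_add_left: "\<lbrakk>f \<in> Hom C X Y; g \<in> Hom C Y Z; g' \<in> Hom C Y Z\<rbrakk>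
      \<Longrightarrow> Add C g g' \<cdot> f = Add C (g \<cdot> f) (g' \<cdot> f)"
    and comp_add_right: "\<lbrakk>f \<in> Hom C X Y; f' \<in> Hom C X Y; g \<in> Hom C Y Z\<rbrakk>
      \<Longrightarrow> g \<cdot> Add C f f' = Add C (g \<cdot> f) (g \<cdot> f')"

locale additive_category = preadditive_category C
  for C :: "('o, 'm, 'z) preadd_data_scheme" (structure) +
  assumes zero_object_exists: "\<exists>N. zero_object C N"
    and biproduct_exists: "\<lbrakk>X \<in> Obj C; Y \<in> Obj C\<rbrakk> \<Longrightarrow>
      \<exists>S \<in> Obj C. \<exists>i \<in> Hom C X S. \<exists>j \<in> Hom C Y S. \<exists>p \<in> Hom C S X. \<exists>q \<in> Hom C S Y.
        p \<cdot> i = Ident C X \<and> q \<cdot> j = Ident C Y \<and> p \<cdot> j = Zero C Y X \<and> q \<cdot> i = Zero C X Y \<and>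
        Add C (i \<cdot> p) (j \<cdot> q) = Ident C S"

definition perp :: "('o, 'm, 'z) preadd_data_scheme \<Rightarrow> 'o \<Rightarrow> 'o \<Rightarrow> bool"
  where "perp C X Y \<longleftrightarrow> Hom C X Y = {Zero C X Y}"

definition class_perp :: "('o, 'm, 'z) preadd_data_scheme \<Rightarrow> 'o set \<Rightarrow> 'o set \<Rightarrow> bool"
  where "class_perp C D E \<longleftrightarrow> (\<forall>X \<in> D. \<forall>Y \<in> E. perp C X Y)"

definition right_perp :: "('o, 'm, 'z) preadd_data_scheme \<Rightarrow> 'o set \<Rightarrow> 'o set"
  where "right_perp C D = {Y \<in> Obj C. \<forall>X \<in> D. perp C X Y}"

definition left_perp :: "('o, 'm, 'z) preadd_data_scheme \<Rightarrow> 'o set \<Rightarrow> 'o set"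
  where "left_perp C D = {Y \<in> Obj C. \<forall>X \<in> D. perp C Y X}"

text \<open>The translation automorphism is recorded together with all of its integral powers:
  \<open>ShO C n X\<close> and \<open>ShM C n f\<close> are \<open>X[n]\<close> and \<open>f[n]\<close>.\<close>

record ('o, 'm) tri_data = "('o, 'm) preadd_data" +
  ShO :: "int \<Rightarrow> 'o \<Rightarrow> 'o"
  ShM :: "int \<Rightarrow> 'm \<Rightarrow> 'm"
  Dist :: "('m \<times> 'm \<times> 'm) set"

definition distinguished ::
  "('o, 'm, 'z) tri_data_scheme \<Rightarrow> 'o \<Rightarrow> 'o \<Rightarrow> 'o \<Rightarrow> 'm \<Rightarrow> 'm \<Rightarrow> 'm \<Rightarrow> bool"
  where "distinguished C X Y Z f g h \<longleftrightarrow>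
    f \<in> Hom C X Y \<and> g \<in> Hom C Y Z \<and> h \<in> Hom C Z (ShO C 1 X) \<and> (f, g, h) \<in> Dist C"

locale triangulated_category = additive_category C
  for C :: "('o, 'm, 'z) tri_data_scheme" (structure) +
  assumes shift_functor: "is_functor C C (ShO C n) (ShM C n)"
    and shift_add: "\<lbrakk>f \<in> Hom C X Y; g \<in> Hom C X Y\<rbrakk>
      \<Longrightarrow> ShM C n (Add C f g) = Add C (ShM C n f) (ShM C n g)"
    and shift_zero_obj: "X \<in> Obj C \<Longrightarrow> ShO C 0 X = X"
    and shift_zero_arr: "f \<in> Arr C \<Longrightarrow> ShM C 0 f = f"
    and shift_shift_obj: "X \<in> Obj C \<Longrightarrow> ShO C m (ShO C n X) = ShO C (m + n) X"
    and shift_shift_arr: "f \<in> Arr C \<Longrightarrow> ShM C m (ShM C n f) = ShM C (m + n) f"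
    and TR1_ident: "\<lbrakk>X \<in> Obj C; zero_object C N\<rbrakk>
      \<Longrightarrow> distinguished C X X N (Ident C X) (Zero C X N) (Zero C N (ShO C 1 X))"
    and TR1_iso: "\<lbrakk>distinguished C X Y Z f g h;
        f' \<in> Hom C X' Y'; g' \<in> Hom C Y' Z'; h' \<in> Hom C Z' (ShO C 1 X');
        is_iso C X X' a; is_iso C Y Y' b; is_iso C Z Z' c;
        f' \<cdot> a = b \<cdot> f; g' \<cdot> b = c \<cdot> g; h' \<cdot> c = ShM C 1 a \<cdot> h\<rbrakk>
      \<Longrightarrow> distinguished C X' Y' Z' f' g' h'"
    and TR1_cone: "f \<in> Hom C X Y \<Longrightarrow> \<exists>Z g h. distinguished C X Y Z f g h"
    and TR2: "f \<in> Hom C X Y \<Longrightarrow> distinguished C X Y Z f g h \<longleftrightarrow>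
        distinguished C Y Z (ShO C 1 X) g h (Neg C (ShM C 1 f))"
    and TR3: "\<lbrakk>distinguished C X Y Z f g h; distinguished C X' Y' Z' f' g' h';
        a \<in> Hom C X X'; b \<in> Hom C Y Y'; f' \<cdot> a = b \<cdot> f\<rbrakk>
      \<Longrightarrow> \<exists>c \<in> Hom C Z Z'. g' \<cdot> b = c \<cdot> g \<and> h' \<cdot> c = ShM C 1 a \<cdot> h"
    and TR4: "\<lbrakk>distinguished C X Y Z' f i i'; distinguished C Y Z X' g j j';
        distinguished C X Z Y' (g \<cdot> f) k k'\<rbrakk>
      \<Longrightarrow> \<exists>u v. distinguished C Z' Y' X' u v (ShM C 1 i \<cdot> j') \<and>
        u \<cdot> i = k \<cdot> g \<and> k' \<cdot> u = i' \<and> v \<cdot> k = j \<and> j' \<cdot> v = ShM C 1 f \<cdot> k'"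

definition triangulated_subcategory :: "('o, 'm, 'z) tri_data_scheme \<Rightarrow> 'o set \<Rightarrow> bool"
  where "triangulated_subcategory C D \<longleftrightarrow> D \<subseteq> Obj C \<and> iso_closed C D \<and>
    (\<exists>N \<in> D. zero_object C N) \<and>
    (\<forall>X \<in> D. \<forall>n. ShO C n X \<in> D) \<and>
    (\<forall>X Y Z f g h. distinguished C X Y Z f g h \<longrightarrow> X \<in> D \<longrightarrow> Y \<in> D \<longrightarrow> Z \<in> D)"

definition localizing_subcategory ::
  "'u itself \<Rightarrow> ('o, 'm, 'z) tri_data_scheme \<Rightarrow> 'o set \<Rightarrow> 'o set"
  where "localizing_subcategory U C P =
    \<Inter> {D. triangulated_subcategory C D \<and> P \<subseteq> D \<and> coproduct_closed U C D}"

text \<open>Functors to abelian groups: \<open>HO X\<close> is the value at the object \<open>X\<close>, and \<open>HM f\<close> is the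
  homomorphism induced by \<open>f\<close>. Since every small abelian group is isomorphic to one whose elements
  belong to \<open>'u\<close>, values of this kind suffice.\<close>

definition homological_functor ::
  "('o, 'm, 'z) tri_data_scheme \<Rightarrow> ('o \<Rightarrow> 'u monoid) \<Rightarrow> ('m \<Rightarrow> 'u \<Rightarrow> 'u) \<Rightarrow> bool"
  where "homological_functor C HO HM \<longleftrightarrow>
    (\<forall>X \<in> Obj C. comm_group (HO X) \<and> small TYPE('u) (carrier (HO X))) \<and>
    (\<forall>X Y. \<forall>f \<in> Hom C X Y. HM f \<in> hom (HO X) (HO Y)) \<and>
    (\<forall>X \<in> Obj C. \<forall>x \<in> carrier (HO X). HM (Ident C X) x = x) \<and>
    (\<forall>X Y Z. \<forall>f \<in> Hom C X Y. \<forall>g \<in> Hom C Y Z. \<forall>x \<in> carrier (HO X).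
      HM (g \<cdot>\<^bsub>C\<^esub> f) x = HM g (HM f x)) \<and>
    (\<forall>X Y. \<forall>f \<in> Hom C X Y. \<forall>g \<in> Hom C X Y. \<forall>x \<in> carrier (HO X).
      HM (Add C f g) x = HM f x \<otimes>\<^bsub>HO Y\<^esub> HM g x) \<and>
    (\<forall>X Y Z f g h. distinguished C X Y Z f g h \<longrightarrow>
      HM f ` carrier (HO X) = kernel (HO Y) (HO Z) (HM g))"

definition respects_products ::
  "('o, 'm, 'z) tri_data_scheme \<Rightarrow> ('o \<Rightarrow> 'u monoid) \<Rightarrow> ('m \<Rightarrow> 'u \<Rightarrow> 'u) \<Rightarrow> bool"
  where "respects_products C HO HM \<longleftrightarrow>
    (\<forall>(I :: 'u set) X S \<pi>. small TYPE('u) I \<longrightarrow> (\<forall>i \<in> I. X i \<in> Obj C) \<longrightarrow> is_product C I X S \<pi> \<longrightarrow>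
      bij_betw (\<lambda>x. \<lambda>i \<in> I. HM (\<pi> i) x) (carrier (HO S)) (\<Pi>\<^sub>E i \<in> I. carrier (HO (X i))))"

definition corepresentable ::
  "('o, 'm, 'z) tri_data_scheme \<Rightarrow> ('o \<Rightarrow> 'u monoid) \<Rightarrow> ('m \<Rightarrow> 'u \<Rightarrow> 'u) \<Rightarrow> bool"
  where "corepresentable C HO HM \<longleftrightarrow>
    (\<exists>A \<in> Obj C. \<exists>\<eta>. (\<forall>X \<in> Obj C. \<eta> X \<in> iso (hom_group C A X) (HO X)) \<and>
      (\<forall>X Y. \<forall>f \<in> Hom C X Y. \<forall>a \<in> Hom C A X. \<eta> Y (f \<cdot>\<^bsub>C\<^esub> a) = HM f (\<eta> X a)))"

definition dual_Brown_representability :: "'u itself \<Rightarrow> ('o, 'm, 'z) tri_data_scheme \<Rightarrow> bool"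
  where "dual_Brown_representability U C \<longleftrightarrow> cosmashing U C \<and>
    (\<forall>(HO :: 'o \<Rightarrow> 'u monoid) (HM :: 'm \<Rightarrow> 'u \<Rightarrow> 'u).
      homological_functor C HO HM \<longrightarrow> respects_products C HO HM \<longrightarrow> corepresentable C HO HM)"

text \<open>A pair \<open>s\<close> of classes of objects, together with its shifts:
  \<open>LE C s i\<close> and \<open>GE C s i\<close> are \<open>C\<^bsub>s \<le> i\<^esub>\<close> and \<open>C\<^bsub>s \<ge> i\<^esub>\<close> in the homological convention.\<close>

record 'o class_pair =
  LE0 :: "'o set"
  GE0 :: "'o set"

definition LE :: "('o, 'm, 'z) tri_data_scheme \<Rightarrow> 'o class_pair \<Rightarrow> int \<Rightarrow> 'o set"
  where "LE C s i = ShO C i ` LE0 s"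

definition GE :: "('o, 'm, 'z) tri_data_scheme \<Rightarrow> 'o class_pair \<Rightarrow> int \<Rightarrow> 'o set"
  where "GE C s i = ShO C i ` GE0 s"

definition pair_heart :: "('o, 'm, 'z) tri_data_scheme \<Rightarrow> 'o class_pair \<Rightarrow> ('o, 'm, 'z) tri_data_scheme"
  where "pair_heart C s = full_subcat C (LE0 s \<inter> GE0 s)"

locale t_structure = triangulated_category C
  for C :: "('o, 'm, 'z) tri_data_scheme" (structure) +
  fixes t :: "'o class_pair"
  assumes t_le_obj: "LE0 t \<subseteq> Obj C"
    and t_ge_obj: "GE0 t \<subseteq> Obj C"
    and t_le_iso_closed: "iso_closed C (LE0 t)"
    and t_ge_iso_closed: "iso_closed C (GE0 t)"
    and t_le_shift: "LE0 t \<subseteq> LE C t 1"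
    and t_ge_shift: "GE C t 1 \<subseteq> GE0 t"
    and t_orthogonal: "class_perp C (GE C t 1) (LE0 t)"
    and t_decomposition: "M \<in> Obj C \<Longrightarrow>
      \<exists>L \<in> GE0 t. \<exists>R \<in> LE C t (-1). \<exists>f g h. distinguished C L M R f g h"

locale weight_structure = triangulated_category C
  for C :: "('o, 'm, 'z) tri_data_scheme" (structure) +
  fixes w :: "'o class_pair"
  assumes w_le_obj: "LE0 w \<subseteq> Obj C"
    and w_ge_obj: "GE0 w \<subseteq> Obj C"
    and w_le_retract_closed: "retract_closed C (LE0 w)"
    and w_ge_retract_closed: "retract_closed C (GE0 w)"
    and w_le_shift: "LE0 w \<subseteq> LE C w 1"
    and w_ge_shift: "GE C w 1 \<subseteq> GE0 w"
    and w_orthogonal: "class_perp C (LE0 w) (GE C w 1)"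
    and w_decomposition: "M \<in> Obj C \<Longrightarrow>
      \<exists>L \<in> LE0 w. \<exists>R \<in> GE C w 1. \<exists>f g h. distinguished C L M R f g h"

text \<open>Values on objects of the functors \<open>L\<^sub>t\<close>, \<open>R\<^sub>t\<close> and \<open>H\<^sub>0\<^sup>t = t\<^bsub>\<le>0\<^esub> \<circ> t\<^bsub>\<ge>0\<^esub>\<close>. The decomposition
  triangle of an object is unique up to unique isomorphism, so the choice is immaterial.\<close>

definition L_t :: "('o, 'm, 'z) tri_data_scheme \<Rightarrow> 'o class_pair \<Rightarrow> 'o \<Rightarrow> 'o"
  where "L_t C t M = (SOME L. L \<in> GE0 t \<and>
    (\<exists>R \<in> LE C t (-1). \<exists>f g h. distinguished C L M R f g h))"

definition R_t :: "('o, 'm, 'z) tri_data_scheme \<Rightarrow> 'o class_pair \<Rightarrow> 'o \<Rightarrow> 'o"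
  where "R_t C t M = (SOME R. R \<in> LE C t (-1) \<and>
    (\<exists>L \<in> GE0 t. \<exists>f g h. distinguished C L M R f g h))"

definition trunc_ge0 :: "('o, 'm, 'z) tri_data_scheme \<Rightarrow> 'o class_pair \<Rightarrow> 'o \<Rightarrow> 'o"
  where "trunc_ge0 C t M = L_t C t M"

definition trunc_le0 :: "('o, 'm, 'z) tri_data_scheme \<Rightarrow> 'o class_pair \<Rightarrow> 'o \<Rightarrow> 'o"
  where "trunc_le0 C t M = ShO C 1 (R_t C t (ShO C (-1) M))"

definition H0_t :: "('o, 'm, 'z) tri_data_scheme \<Rightarrow> 'o class_pair \<Rightarrow> 'o \<Rightarrow> 'o"
  where "H0_t C t M = trunc_le0 C t (trunc_ge0 C t M)"

definition P_t :: "('o, 'm, 'z) tri_data_scheme \<Rightarrow> 'o class_pair \<Rightarrow> 'o set"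
  where "P_t C t = left_perp C (LE C t (-1) \<union> GE C t 1)"

definition cosmashing_t_structure ::
  "'u itself \<Rightarrow> ('o, 'm, 'z) tri_data_scheme \<Rightarrow> 'o class_pair \<Rightarrow> bool"
  where "cosmashing_t_structure U C t \<longleftrightarrow>
    t_structure C t \<and> cosmashing U C \<and> product_closed U C (GE0 t)"

definition smashing_weight_structure ::
  "'u itself \<Rightarrow> ('o, 'm, 'z) tri_data_scheme \<Rightarrow> 'o class_pair \<Rightarrow> bool"
  where "smashing_weight_structure U C w \<longleftrightarrow>
    weight_structure C w \<and> smashing U C \<and> coproduct_closed U C (GE0 w)"

definition extends_weight_structure ::
  "('o, 'm, 'z) tri_data_scheme \<Rightarrow> 'o set \<Rightarrow> 'o class_pair \<Rightarrow> 'o class_pair \<Rightarrow> bool"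
  where "extends_weight_structure C D w v \<longleftrightarrow>
    weight_structure C w \<and> weight_structure (full_subcat C D) v \<and>
    LE0 v = LE0 w \<inter> D \<and> GE0 v = GE0 w \<inter> D"

definition left_adjacent :: "'o class_pair \<Rightarrow> 'o class_pair \<Rightarrow> bool"
  where "left_adjacent w t \<longleftrightarrow> GE0 w = GE0 t"

text \<open>Here \<open>w\<close> is a weight structure on a triangulated subcategory of \<open>C\<close>, while the orthogonal
  is taken in \<open>C\<close>.\<close>

definition minus_orthogonal ::
  "('o, 'm, 'z) tri_data_scheme \<Rightarrow> 'o class_pair \<Rightarrow> 'o class_pair \<Rightarrow> bool"
  where "minus_orthogonal C t w \<longleftrightarrow> LE C t (-1) = right_perp C (GE0 w)"

definition bounded_below_objects :: "('o, 'm, 'z) tri_data_scheme \<Rightarrow> 'o class_pair \<Rightarrow> 'o set"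
  where "bounded_below_objects C t = (\<Union>i. GE C t i)"

definition projective_subcat :: "('o, 'm, 'z) cat_data_scheme \<Rightarrow> ('o, 'm, 'z) cat_data_scheme"
  where "projective_subcat A = full_subcat A {P. projective A P}"

end

theory Submission
  imports Defs "HOL-Algebra.Product_Groups"
begin

text \<open>
  Everything about weight structures follows from one closure property. Call \<open>M\<close>
  weight decomposable if it sits in a triangle \<open>L \<rightarrow> M \<rightarrow> R\<close> with \<open>R \<in> C\<^bsub>t\<ge>1\<^esub>\<close> and
  \<open>L\<close> left orthogonal to \<open>C\<^bsub>t\<ge>1\<^esub>\<close>. These objects are closed under extensions: for an extension
  of decomposable objects, the obstruction to gluing the two decompositions is a morphism from a
  shift \<open>L[-1]\<close> to some \<open>R \<in> C\<^bsub>t\<ge>1\<^esub>\<close>, which vanishes, and three octahedra do the rest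
  (\<open>weight_decomposable_extension\<close>). In a smashing category, coproducts preserve decomposability too
  (\<open>weight_decomposable_coproduct\<close>). As soon as all objects of a triangulated subcategory containing
  \<open>C\<^bsub>t\<ge>0\<^esub>\<close> are decomposable, it carries the weight structure whose right class is
  \<open>C\<^bsub>t\<ge>0\<^esub>\<close> (\<open>weight_structure_of_decompositions\<close>).

  The projectivity hypothesis starts the induction. For \<open>N \<in> C\<^bsub>t\<ge>0\<^esub>\<close> there is an
  epimorphism \<open>H\<^sub>0 P' \<rightarrow> H\<^sub>0 N\<close> of the heart with \<open>P' \<in> P\<^sub>t\<close>; since \<open>P'\<close> is orthogonal to \<open>C\<^bsub>t\<ge>1\<^esub>\<close>
  it lifts to \<open>P' \<rightarrow> N\<close>, and the cone of this morphism is in \<open>C\<^bsub>t\<ge>1\<^esub>\<close> because it is epimorphic on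
  \<open>H\<^sub>0\<close> (\<open>P_t_cover\<close>). Peeling off such \<open>P'\<close> finitely many times makes every object
  bounded below decomposable. If \<open>C\<^bsub>t\<le>0\<^esub> \<bottom> C\<^bsub>t\<ge>n\<^esub>\<close>, an arbitrary object is an extension of a very
  negative one, which is its own \<open>L\<close>, by one that is bounded below. In the smashing case, the
  objects all of whose shifts are decomposable form a localizing subcategory containing
  \<open>C\<^bsub>t\<ge>0\<^esub>\<close>, hence containing the one generated by it.

  The heart of this weight structure is \<open>P\<^sub>t\<close>. On \<open>P\<^sub>t\<close> the functor \<open>t\<^bsub>\<le>0\<^esub>\<close> is fully faithful,
  as both \<open>P' \<rightarrow> t\<^bsub>\<le>0\<^esub>Q'\<close> lifts uniquely to \<open>Q'\<close> and morphisms into \<open>C\<^bsub>t\<le>0\<^esub>\<close> factor uniquely through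
  the truncation, and its values are projective. A projective \<open>P\<close> of the heart of \<open>t\<close> is a retract of
  some \<open>H\<^sub>0 P'\<close>; the corresponding idempotent lifts to \<open>P'\<close> and splits there, since countable
  coproducts allow a swindle (\<open>idempotent_splits\<close>). So the functor is an equivalence onto the
  projectives (\<open>heart_equivalence\<close>).

  Under dual Brown representability, a coproduct of the \<open>X\<^sub>i\<close> is a corepresenting object of
  \<open>Y \<mapsto> \<Prod>\<^sub>i C(X\<^sub>i, Y)\<close>, and a lift of a projective \<open>P\<close> is a corepresenting object of
  \<open>Y \<mapsto> C(P, t\<^bsub>\<le>0\<^esub>Y)\<close>. The latter functor is homological because \<open>P\<close> is orthogonal to the shift by one of
  the heart (\<open>projective_exact_on_truncations\<close>), and it respects products because truncation does
  when \<open>C\<^bsub>t\<ge>0\<^esub>\<close> is closed under products (\<open>le_trunc_product\<close>).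
\<close>

section \<open>Arrows in additive categories\<close>

context category
begin

text \<open>Diagram chases are done by rewriting with untyped arrows: membership in a hom-set is split into
  \<open>Arr\<close>, \<open>Dom\<close> and \<open>Cod\<close>, so that the side conditions of associativity and distributivity
  can be discharged by the simplifier without guessing intermediate objects.\<close>

lemma HomD: assumes "f \<in> Hom C X Y"
  shows "f \<in> Arr C" "Dom C f = X" "Cod C f = Y" "X \<in> Obj C" "Y \<in> Obj C"
  using assms dom_in cod_in by (auto simp: Hom_def)

lemma Hom_iff: "f \<in> Hom C X Y \<longleftrightarrow> f \<in> Arr C \<and> Dom C f = X \<and> Cod C f = Y"
  by (simp add: Hom_def)

lemma comp_arr [simp]:
  assumes "f \<in> Arr C" "g \<in> Arr C" "Cod C f = Dom C g"
  shows "g \<cdot> f \<in> Arr C" "Dom C (g \<cdot> f) = Dom C f" "Cod C (g \<cdot> f) = Cod C g"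
proof -
  have "g \<cdot> f \<in> Hom C (Dom C f) (Cod C g)"
    using assms by (intro comp_in[where Y = "Dom C g"]) (auto simp: Hom_def)
  then show "g \<cdot> f \<in> Arr C" "Dom C (g \<cdot> f) = Dom C f" "Cod C (g \<cdot> f) = Cod C g"
    by (auto simp: Hom_def)
qed

lemma ident_arr [simp]:
  assumes "X \<in> Obj C"
  shows "Ident C X \<in> Arr C" "Dom C (Ident C X) = X" "Cod C (Ident C X) = X"
  using ident_in[OF assms] by (auto simp: Hom_def)

lemma comp_ident [simp]:
  assumes "f \<in> Arr C"
  shows "Dom C f = X \<Longrightarrow> f \<cdot> Ident C X = f" "Cod C f = Y \<Longrightarrow> Ident C Y \<cdot> f = f"
  using assms comp_ident_right[of f X "Cod C f"] comp_ident_left[of f "Dom C f" Y]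
  by (auto simp: Hom_def)

lemma assoc:
  assumes "f \<in> Arr C" "g \<in> Arr C" "h \<in> Arr C" "Cod C f = Dom C g" "Cod C g = Dom C h"
  shows "(h \<cdot> g) \<cdot> f = h \<cdot> (g \<cdot> f)"
  using comp_assoc[of f "Dom C f" "Cod C f" g "Cod C g" h "Cod C h"] assms by (auto simp: Hom_def)

end

context preadditive_category
begin

definition sub :: "'m \<Rightarrow> 'm \<Rightarrow> 'm"
  where "sub f g = Add C f (Neg C g)"

lemma hom_group_simps [simp]:
  "carrier (hom_group C X Y) = Hom C X Y"
  "monoid.mult (hom_group C X Y) = Add C"
  "one (hom_group C X Y) = Zero C X Y"
  by (simp_all add: hom_group_def)

lemma zero_arr [simp]:
  assumes "X \<in> Obj C" "Y \<in> Obj C"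
  shows "Zero C X Y \<in> Arr C" "Dom C (Zero C X Y) = X" "Cod C (Zero C X Y) = Y"
proof -
  interpret comm_group "hom_group C X Y" by (rule hom_comm_group[OF assms])
  show "Zero C X Y \<in> Arr C" "Dom C (Zero C X Y) = X" "Cod C (Zero C X Y) = Y"
    using one_closed by (auto simp: Hom_def)
qed

lemma zero_in: "X \<in> Obj C \<Longrightarrow> Y \<in> Obj C \<Longrightarrow> Zero C X Y \<in> Hom C X Y"
  by (simp add: Hom_def)

lemma add_arr [simp]:
  assumes "f \<in> Arr C" "g \<in> Arr C" "Dom C g = Dom C f" "Cod C g = Cod C f"
  shows "Add C f g \<in> Arr C" "Dom C (Add C f g) = Dom C f" "Cod C (Add C f g) = Cod C f"
proof -
  interpret comm_group "hom_group C (Dom C f) (Cod C f)"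
    using assms by (intro hom_comm_group dom_in cod_in)
  show "Add C f g \<in> Arr C" "Dom C (Add C f g) = Dom C f" "Cod C (Add C f g) = Cod C f"
    using m_closed[of f g] assms by (auto simp: Hom_def)
qed

lemma neg_arr [simp]:
  assumes "f \<in> Arr C"
  shows "Neg C f \<in> Arr C" "Dom C (Neg C f) = Dom C f" "Cod C (Neg C f) = Cod C f"
proof -
  interpret comm_group "hom_group C (Dom C f) (Cod C f)"
    using assms by (intro hom_comm_group dom_in cod_in)
  show "Neg C f \<in> Arr C" "Dom C (Neg C f) = Dom C f" "Cod C (Neg C f) = Cod C f"
    using inv_closed[of f] assms by (auto simp: Hom_def Neg_def)
qed

lemma neg_neg [simp]: "f \<in> Arr C \<Longrightarrow> Neg C (Neg C f) = f"
proof -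
  assume f: "f \<in> Arr C"
  interpret comm_group "hom_group C (Dom C f) (Cod C f)"
    using f by (intro hom_comm_group dom_in cod_in)
  have *: "Neg C f = inv\<^bsub>hom_group C (Dom C f) (Cod C f)\<^esub> f" by (simp add: Neg_def)
  have "Neg C (Neg C f) = inv\<^bsub>hom_group C (Dom C f) (Cod C f)\<^esub> (Neg C f)"
    using f by (subst Neg_def) simp
  then show ?thesis using inv_inv[of f] f by (simp add: Hom_def *)
qed

lemma add_zero [simp]:
  assumes "f \<in> Arr C"
  shows "Dom C f = X \<Longrightarrow> Cod C f = Y \<Longrightarrow> Add C f (Zero C X Y) = f"
    "Dom C f = X \<Longrightarrow> Cod C f = Y \<Longrightarrow> Add C (Zero C X Y) f = f"
proof -
  interpret comm_group "hom_group C (Dom C f) (Cod C f)"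
    using assms by (intro hom_comm_group dom_in cod_in)
  show "Dom C f = X \<Longrightarrow> Cod C f = Y \<Longrightarrow> Add C f (Zero C X Y) = f"
    "Dom C f = X \<Longrightarrow> Cod C f = Y \<Longrightarrow> Add C (Zero C X Y) f = f"
    using r_one[of f] l_one[of f] assms by (auto simp: Hom_def)
qed

lemma add_neg [simp]:
  assumes "f \<in> Arr C"
  shows "Add C f (Neg C f) = Zero C (Dom C f) (Cod C f)"
    "Add C (Neg C f) f = Zero C (Dom C f) (Cod C f)"
proof -
  interpret comm_group "hom_group C (Dom C f) (Cod C f)"
    using assms by (intro hom_comm_group dom_in cod_in)
  show "Add C f (Neg C f) = Zero C (Dom C f) (Cod C f)"
    "Add C (Neg C f) f = Zero C (Dom C f) (Cod C f)"
    using r_inv[of f] l_inv[of f] assms by (auto simp: Hom_def Neg_def)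
qed

lemma add_assoc:
  assumes "f \<in> Arr C" "g \<in> Arr C" "h \<in> Arr C" "Dom C g = Dom C f" "Cod C g = Cod C f"
    "Dom C h = Dom C f" "Cod C h = Cod C f"
  shows "Add C (Add C f g) h = Add C f (Add C g h)"
proof -
  interpret comm_group "hom_group C (Dom C f) (Cod C f)"
    using assms by (intro hom_comm_group dom_in cod_in)
  show ?thesis using m_assoc[of f g h] assms by (auto simp: Hom_def)
qed

lemma add_comm:
  assumes "f \<in> Arr C" "g \<in> Arr C" "Dom C g = Dom C f" "Cod C g = Cod C f"
  shows "Add C f g = Add C g f"
proof -
  interpret comm_group "hom_group C (Dom C f) (Cod C f)"
    using assms by (intro hom_comm_group dom_in cod_in)
  show ?thesis using m_comm[of f g] assms by (auto simp: Hom_def)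
qed

lemma add_cancel:
  assumes "f \<in> Arr C" "g \<in> Arr C" "h \<in> Arr C" "Dom C g = Dom C f" "Cod C g = Cod C f"
    "Dom C h = Dom C f" "Cod C h = Cod C f"
  shows "Add C h f = Add C h g \<longleftrightarrow> f = g"
proof -
  interpret comm_group "hom_group C (Dom C f) (Cod C f)"
    using assms by (intro hom_comm_group dom_in cod_in)
  show ?thesis using right_cancel[of h f g] m_comm[of h f] m_comm[of h g] assms by (auto simp: Hom_def)
qed

lemma add_comp:
  assumes "f \<in> Arr C" "g \<in> Arr C" "g' \<in> Arr C" "Cod C f = Dom C g" "Dom C g' = Dom C g" "Cod C g' = Cod C g"
  shows "Add C g g' \<cdot> f = Add C (g \<cdot> f) (g' \<cdot> f)"
  using comp_add_left[of f "Dom C f" "Cod C f" g "Cod C g" g'] assms by (auto simp: Hom_def)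

lemma comp_add:
  assumes "g \<in> Arr C" "f \<in> Arr C" "f' \<in> Arr C" "Cod C f = Dom C g" "Dom C f' = Dom C f" "Cod C f' = Cod C f"
  shows "g \<cdot> Add C f f' = Add C (g \<cdot> f) (g \<cdot> f')"
  using comp_add_right[of f "Dom C f" "Cod C f" f' g "Cod C g"] assms by (auto simp: Hom_def)

lemma add_idem_zero:
  assumes "f \<in> Arr C" "Add C f f = f" shows "f = Zero C (Dom C f) (Cod C f)"
proof -
  have "Dom C f \<in> Obj C" "Cod C f \<in> Obj C" using assms dom_in cod_in by auto
  then show ?thesis
    using add_cancel[of f "Zero C (Dom C f) (Cod C f)" f, THEN iffD1] assms by simp
qed

lemma comp_zero [simp]:
  assumes "f \<in> Arr C"
  shows "W \<in> Obj C \<Longrightarrow> Dom C f = X \<Longrightarrow> f \<cdot> Zero C W X = Zero C W (Cod C f)"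
    "Z \<in> Obj C \<Longrightarrow> Cod C f = Y \<Longrightarrow> Zero C Y Z \<cdot> f = Zero C (Dom C f) Z"
proof -
  have X: "Dom C f \<in> Obj C" "Cod C f \<in> Obj C" using assms dom_in cod_in by auto
  show "f \<cdot> Zero C W X = Zero C W (Cod C f)" if W: "W \<in> Obj C" "Dom C f = X"
  proof -
    have "Add C (f \<cdot> Zero C W X) (f \<cdot> Zero C W X) = f \<cdot> Zero C W X"
      using comp_add[of f "Zero C W X" "Zero C W X"] W X assms by simp
    from add_idem_zero[OF _ this] show ?thesis using W X assms by simp
  qed
  show "Zero C Y Z \<cdot> f = Zero C (Dom C f) Z" if Z: "Z \<in> Obj C" "Cod C f = Y"
  proof -
    have "Add C (Zero C Y Z \<cdot> f) (Zero C Y Z \<cdot> f) = Zero C Y Z \<cdot> f"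
      using add_comp[of f "Zero C Y Z" "Zero C Y Z"] Z X assms by simp
    from add_idem_zero[OF _ this] show ?thesis using Z X assms by simp
  qed
qed

lemma neg_unique:
  assumes "f \<in> Arr C" "g \<in> Arr C" "Dom C g = Dom C f" "Cod C g = Cod C f"
    "Add C f g = Zero C (Dom C f) (Cod C f)"
  shows "g = Neg C f"
  using assms by (intro add_cancel[of g "Neg C f" f, THEN iffD1]) simp_all

lemma neg_comp:
  assumes "f \<in> Arr C" "g \<in> Arr C" "Cod C f = Dom C g"
  shows "g \<cdot> Neg C f = Neg C (g \<cdot> f)" "Neg C g \<cdot> f = Neg C (g \<cdot> f)"
proof -
  have X: "Dom C f \<in> Obj C" "Cod C g \<in> Obj C" using assms dom_in cod_in by auto
  have "Add C (g \<cdot> f) (g \<cdot> Neg C f) = Zero C (Dom C f) (Cod C g)"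
    using comp_add[of g f "Neg C f"] assms X by simp
  then show "g \<cdot> Neg C f = Neg C (g \<cdot> f)" using assms by (intro neg_unique) simp_all
  have "Add C (g \<cdot> f) (Neg C g \<cdot> f) = Zero C (Dom C f) (Cod C g)"
    using add_comp[of f g "Neg C g"] assms X by simp
  then show "Neg C g \<cdot> f = Neg C (g \<cdot> f)" using assms by (intro neg_unique) simp_all
qed

lemma neg_zero [simp]: "X \<in> Obj C \<Longrightarrow> Y \<in> Obj C \<Longrightarrow> Neg C (Zero C X Y) = Zero C X Y"
  by (rule neg_unique[symmetric]) simp_all

lemma sub_arr [simp]:
  assumes "f \<in> Arr C" "g \<in> Arr C" "Dom C g = Dom C f" "Cod C g = Cod C f"
  shows "sub f g \<in> Arr C" "Dom C (sub f g) = Dom C f" "Cod C (sub f g) = Cod C f"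
  using assms by (simp_all add: sub_def)

lemma sub_zero_iff:
  assumes "f \<in> Arr C" "g \<in> Arr C" "Dom C f = X" "Cod C f = Y" "Dom C g = X" "Cod C g = Y"
  shows "sub f g = Zero C X Y \<longleftrightarrow> f = g"
proof -
  have "sub f g = Zero C X Y \<longleftrightarrow> Add C (Neg C g) f = Add C (Neg C g) g"
    using assms by (auto simp: sub_def add_comm)
  then show ?thesis using add_cancel[of f g "Neg C g"] assms by auto
qed

lemma sub_self [simp]: "f \<in> Arr C \<Longrightarrow> sub f f = Zero C (Dom C f) (Cod C f)"
  by (simp add: sub_def)

lemma sub_zero_right [simp]: "f \<in> Arr C \<Longrightarrow> Dom C f = X \<Longrightarrow> Cod C f = Y \<Longrightarrow> sub f (Zero C X Y) = f"
  using dom_in[of f] cod_in[of f] by (auto simp: sub_def)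

lemma comp_sub:
  assumes "g \<in> Arr C" "f \<in> Arr C" "f' \<in> Arr C" "Cod C f = Dom C g" "Dom C f' = Dom C f" "Cod C f' = Cod C f"
  shows "g \<cdot> sub f f' = sub (g \<cdot> f) (g \<cdot> f')"
  using assms by (simp add: sub_def comp_add neg_comp)

lemma sub_comp:
  assumes "f \<in> Arr C" "g \<in> Arr C" "g' \<in> Arr C" "Cod C f = Dom C g" "Dom C g' = Dom C g" "Cod C g' = Cod C g"
  shows "sub g g' \<cdot> f = sub (g \<cdot> f) (g' \<cdot> f)"
  using assms by (simp add: sub_def add_comp neg_comp)

lemma sub_add_cancel:
  assumes "f \<in> Arr C" "g \<in> Arr C" "Dom C g = Dom C f" "Cod C g = Cod C f"
  shows "Add C (sub f g) g = f"
  using assms by (simp add: sub_def add_assoc)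

lemma sub_eq_of_add:
  assumes "f \<in> Arr C" "g \<in> Arr C" "Dom C g = Dom C f" "Cod C g = Cod C f"
  shows "sub (Add C f g) f = g"
proof -
  let ?s = "sub (Add C f g) f"
  have "Add C ?s f = Add C f g" using assms by (intro sub_add_cancel) simp_all
  moreover have "Add C f ?s = Add C ?s f" using assms by (intro add_comm) simp_all
  moreover have "Add C f ?s = Add C f g \<longleftrightarrow> ?s = g" using assms by (intro add_cancel) simp_all
  ultimately show ?thesis by simp
qed

lemma sub_sub:
  assumes "f \<in> Arr C" "g \<in> Arr C" "Dom C g = Dom C f" "Cod C g = Cod C f"
  shows "sub f (sub f g) = g"
proof -
  have "sub (Add C (sub f g) g) (sub f g) = g" using assms by (intro sub_eq_of_add) simp_all
  moreover have "Add C (sub f g) g = f" using assms by (intro sub_add_cancel) simp_all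
  ultimately show ?thesis by simp
qed

lemma zero_object_iff: "zero_object C N \<longleftrightarrow> N \<in> Obj C \<and> Ident C N = Zero C N N"
proof
  assume "zero_object C N"
  then show "N \<in> Obj C \<and> Ident C N = Zero C N N"
    using ident_in[of N] by (auto simp: zero_object_def)
next
  assume N: "N \<in> Obj C \<and> Ident C N = Zero C N N"
  have "f = Zero C N X" if "f \<in> Hom C N X" for f X
    using comp_ident(1)[of f N] that N HomD[OF that] by auto
  moreover have "f = Zero C X N" if "f \<in> Hom C X N" for f X
    using comp_ident(2)[of f N] that N HomD[OF that] by auto
  ultimately show "zero_object C N" using N zero_in by (auto simp: zero_object_def)
qed

lemma perp_iff: 
  assumes "X \<in> Obj C" "Y \<in> Obj C"
  shows "perp C X Y \<longleftrightarrow> (\<forall>f \<in> Hom C X Y. f = Zero C X Y)"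
  using zero_in[OF assms] by (auto simp: perp_def)

lemma perpD: "perp C X Y \<Longrightarrow> f \<in> Hom C X Y \<Longrightarrow> f = Zero C X Y"
  by (auto simp: perp_def)

end

section \<open>Exactness and octahedra in triangulated categories\<close>

context triangulated_category
begin

lemma sh_obj [simp]: "X \<in> Obj C \<Longrightarrow> ShO C n X \<in> Obj C"
  using shift_functor[of n] by (auto simp: is_functor_def)

lemma sh_arr [simp]:
  assumes "f \<in> Arr C"
  shows "ShM C n f \<in> Arr C" "Dom C (ShM C n f) = ShO C n (Dom C f)"
    "Cod C (ShM C n f) = ShO C n (Cod C f)"
proof -
  have "f \<in> Hom C (Dom C f) (Cod C f)" using assms by (simp add: Hom_def)
  then have "ShM C n f \<in> Hom C (ShO C n (Dom C f)) (ShO C n (Cod C f))"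
    using shift_functor[of n] unfolding is_functor_def by blast
  then show "ShM C n f \<in> Arr C" "Dom C (ShM C n f) = ShO C n (Dom C f)"
    "Cod C (ShM C n f) = ShO C n (Cod C f)" by (auto simp: Hom_def)
qed

lemma sh_in: "f \<in> Hom C X Y \<Longrightarrow> ShM C n f \<in> Hom C (ShO C n X) (ShO C n Y)"
  by (auto simp: Hom_def)

lemma sh_comp:
  assumes "f \<in> Arr C" "g \<in> Arr C" "Cod C f = Dom C g"
  shows "ShM C n (g \<cdot> f) = ShM C n g \<cdot> ShM C n f"
proof -
  have "f \<in> Hom C (Dom C f) (Cod C f)" "g \<in> Hom C (Cod C f) (Cod C g)"
    using assms by (simp_all add: Hom_def)
  then show ?thesis using shift_functor[of n] unfolding is_functor_def by blast
qed

lemma sh_ident [simp]: "X \<in> Obj C \<Longrightarrow> ShM C n (Ident C X) = Ident C (ShO C n X)"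
  using shift_functor[of n] unfolding is_functor_def by blast

lemma sh_sh [simp]:
  "X \<in> Obj C \<Longrightarrow> ShO C m (ShO C n X) = ShO C (m + n) X"
  "X \<in> Obj C \<Longrightarrow> ShO C 0 X = X"
  "f \<in> Arr C \<Longrightarrow> ShM C m (ShM C n f) = ShM C (m + n) f"
  "f \<in> Arr C \<Longrightarrow> ShM C 0 f = f"
  by (simp_all add: shift_shift_obj shift_zero_obj shift_shift_arr shift_zero_arr)

lemma sh_zero [simp]:
  assumes "X \<in> Obj C" "Y \<in> Obj C"
  shows "ShM C n (Zero C X Y) = Zero C (ShO C n X) (ShO C n Y)"
proof -
  have "Add C (ShM C n (Zero C X Y)) (ShM C n (Zero C X Y)) = ShM C n (Zero C X Y)"
    using shift_add[OF zero_in zero_in, of X Y n] assms by simp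
  from add_idem_zero[OF _ this] show ?thesis using assms by simp
qed

lemma sh_neg [simp]:
  assumes "f \<in> Arr C" shows "ShM C n (Neg C f) = Neg C (ShM C n f)"
proof -
  have X: "Dom C f \<in> Obj C" "Cod C f \<in> Obj C" using assms dom_in cod_in by auto
  have "Add C (ShM C n f) (ShM C n (Neg C f)) = ShM C n (Add C f (Neg C f))"
    using assms by (intro shift_add[symmetric, of _ "Dom C f" "Cod C f"]) (auto simp: Hom_def)
  also have "\<dots> = Zero C (ShO C n (Dom C f)) (ShO C n (Cod C f))" using assms X by simp
  finally show ?thesis using assms by (intro neg_unique) simp_all
qed

lemma sh_eq_iff:
  assumes "f \<in> Arr C" "g \<in> Arr C"
  shows "ShM C n f = ShM C n g \<longleftrightarrow> f = g"
proof
  assume "ShM C n f = ShM C n g"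
  then have "ShM C (-n) (ShM C n f) = ShM C (-n) (ShM C n g)" by simp
  then show "f = g" using assms by simp
qed simp

lemma perp_shift:
  assumes "X \<in> Obj C" "Y \<in> Obj C"
  shows "perp C (ShO C n X) (ShO C n Y) \<longleftrightarrow> perp C X Y"
proof -
  have *: "perp C (ShO C n X) (ShO C n Y)" if "X \<in> Obj C" "Y \<in> Obj C" "perp C X Y" for X Y n
  proof (subst perp_iff)
    show "\<forall>f\<in>Hom C (ShO C n X) (ShO C n Y). f = Zero C (ShO C n X) (ShO C n Y)"
    proof
      fix f assume f: "f \<in> Hom C (ShO C n X) (ShO C n Y)"
      then have "ShM C (-n) f \<in> Hom C X Y" using sh_in[OF f, of "-n"] that by simp
      then have "ShM C (-n) f = Zero C X Y" using perpD that by blast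
      then have "ShM C n (ShM C (-n) f) = ShM C n (Zero C X Y)" by simp
      then show "f = Zero C (ShO C n X) (ShO C n Y)" using f that by (simp add: Hom_iff)
    qed
  qed (use that in auto)
  show ?thesis using *[of X Y n] *[of "ShO C n X" "ShO C n Y" "-n"] assms by auto
qed

lemma distD:
  assumes "distinguished C X Y Z f g h"
  shows "f \<in> Hom C X Y" "g \<in> Hom C Y Z" "h \<in> Hom C Z (ShO C 1 X)"
    "X \<in> Obj C" "Y \<in> Obj C" "Z \<in> Obj C"
  using assms HomD(4,5)[of f X Y] HomD(5)[of g Y Z] by (auto simp: distinguished_def)

lemma rotate:
  assumes "distinguished C X Y Z f g h"
  shows "distinguished C Y Z (ShO C 1 X) g h (Neg C (ShM C 1 f))"
  using TR2[OF distD(1)[OF assms]] assms by blast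

lemma rotate_back:
  assumes "distinguished C X Y Z f g h"
  shows "distinguished C (ShO C (-1) Z) X Y (Neg C (ShM C (-1) h)) f g"
proof -
  note d = distD[OF assms]
  have k: "Neg C (ShM C (-1) h) \<in> Hom C (ShO C (-1) Z) X"
    using d by (auto simp: Hom_iff)
  have "Neg C (ShM C 1 (Neg C (ShM C (-1) h))) = h" using d by (simp add: Hom_iff)
  then show ?thesis using TR2[OF k, of Y f g] assms d by simp
qed

lemma dist_comp_zero:
  assumes "distinguished C X Y Z f g h"
  shows "g \<cdot> f = Zero C X Z"
proof -
  note d = distD[OF assms]
  obtain N where N: "zero_object C N" using zero_object_exists by blast
  then have NO: "N \<in> Obj C" by (simp add: zero_object_def)
  have "f \<cdot> Ident C X = f \<cdot> Ident C X" ..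
  from TR3[OF TR1_ident[OF d(4) N] assms ident_in[OF d(4)] d(1) this]
  obtain c where "c \<in> Hom C N Z" "g \<cdot> f = c \<cdot> Zero C X N" by blast
  then show ?thesis using d(4) NO by (simp add: Hom_iff)
qed

lemma dist_comp_zero3:
  assumes "distinguished C X Y Z f g h"
  shows "ShM C 1 f \<cdot> h = Zero C Z (ShO C 1 Y)"
proof -
  note d = distD[OF assms]
  have "Neg C (ShM C 1 f \<cdot> h) = Zero C Z (ShO C 1 Y)"
    using dist_comp_zero[OF rotate[OF rotate[OF assms]]] d by (simp add: Hom_iff neg_comp)
  then have "Neg C (Neg C (ShM C 1 f \<cdot> h)) = Neg C (Zero C Z (ShO C 1 Y))" by simp
  then show ?thesis using d by (simp add: Hom_iff)
qed

text \<open>The long exact sequence of \<open>C(W, -)\<close> at the middle term. It needs only that morphisms of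
  triangles can be completed: compare the rotated triangle \<open>W \<rightarrow> 0 \<rightarrow> W[1]\<close> with the rotated given one.\<close>

lemma lift_along_f:
  assumes "distinguished C X Y Z f g h" "u \<in> Hom C W Y" "g \<cdot> u = Zero C W Z"
  shows "\<exists>v \<in> Hom C W X. u = f \<cdot> v"
proof -
  note d = distD[OF assms(1)]
  have W: "W \<in> Obj C" using HomD[OF assms(2)] by simp
  obtain N where N: "zero_object C N" using zero_object_exists by blast
  then have NO: "N \<in> Obj C" by (simp add: zero_object_def)
  have eq: "g \<cdot> u = Zero C N Z \<cdot> Zero C W N" using assms(3) W NO d(6) by simp
  from TR3[OF rotate[OF TR1_ident[OF W N]] rotate[OF assms(1)] assms(2) zero_in[OF NO d(6)] eq]
  obtain c where c: "c \<in> Hom C (ShO C 1 W) (ShO C 1 X)"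
    "Neg C (ShM C 1 f) \<cdot> c = ShM C 1 u \<cdot> Neg C (ShM C 1 (Ident C W))" by blast
  have "Neg C (ShM C 1 f \<cdot> c) = Neg C (ShM C 1 u)"
    using c(2) c(1) d assms(2) W by (simp add: Hom_iff neg_comp)
  then have "Neg C (Neg C (ShM C 1 f \<cdot> c)) = Neg C (Neg C (ShM C 1 u))" by simp
  then have "ShM C 1 f \<cdot> c = ShM C 1 u" using d c(1) assms(2) by (simp add: Hom_iff)
  then have "ShM C (-1) (ShM C 1 f \<cdot> c) = ShM C (-1) (ShM C 1 u)" by simp
  then have "f \<cdot> ShM C (-1) c = u" using d c(1) assms(2) by (simp add: Hom_iff sh_comp)
  moreover have "ShM C (-1) c \<in> Hom C W X" using sh_in[OF c(1), of "-1"] W d by simp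
  ultimately show ?thesis by blast
qed

text \<open>The dual statement for \<open>C(-, W)\<close> compares with \<open>0 \<rightarrow> W \<rightarrow> W\<close>. Exactness in the other
  places then follows by rotation.\<close>

lemma extend_along_g:
  assumes "distinguished C X Y Z f g h" "u \<in> Hom C Y W" "u \<cdot> f = Zero C X W"
  shows "\<exists>v \<in> Hom C Z W. u = v \<cdot> g"
proof -
  note d = distD[OF assms(1)]
  have W: "W \<in> Obj C" using HomD[OF assms(2)] by simp
  obtain N where N: "zero_object C N" using zero_object_exists by blast
  then have NO: "N \<in> Obj C" by (simp add: zero_object_def)
  have t: "distinguished C (ShO C (-1) N) W W (Neg C (ShM C (-1) (Zero C N (ShO C 1 W)))) (Ident C W) (Zero C W N)"
    using rotate_back[OF TR1_ident[OF W N]] .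
  have z: "Zero C X (ShO C (-1) N) \<in> Hom C X (ShO C (-1) N)" using zero_in d NO by simp
  have eq: "Neg C (ShM C (-1) (Zero C N (ShO C 1 W))) \<cdot> Zero C X (ShO C (-1) N) = u \<cdot> f"
    using assms(3) W NO d by simp
  from TR3[OF assms(1) t z assms(2) eq]
  obtain c where "c \<in> Hom C Z W" "Ident C W \<cdot> u = c \<cdot> g" by blast
  then show ?thesis using assms(2) by (auto simp: Hom_iff)
qed

lemma lift_along_g:
  assumes "distinguished C X Y Z f g h" "u \<in> Hom C W Z" "h \<cdot> u = Zero C W (ShO C 1 X)"
  shows "\<exists>v \<in> Hom C W Y. u = g \<cdot> v"
  using lift_along_f[OF rotate[OF assms(1)] assms(2,3)] .

lemma extend_along_h:
  assumes "distinguished C X Y Z f g h" "u \<in> Hom C Z W" "u \<cdot> g = Zero C Y W"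
  shows "\<exists>v \<in> Hom C (ShO C 1 X) W. u = v \<cdot> h"
  using extend_along_g[OF rotate[OF assms(1)] assms(2,3)] .

lemma lift_along_connecting:
  assumes "distinguished C X Y Z f g h" "u \<in> Hom C W X" "f \<cdot> u = Zero C W Y"
  shows "\<exists>v \<in> Hom C W (ShO C (-1) Z). u = Neg C (ShM C (-1) h) \<cdot> v"
  using lift_along_f[OF rotate_back[OF assms(1)] assms(2,3)] .

lemma extend_along_f:
  assumes "distinguished C X Y Z f g h" "u \<in> Hom C X W"
    "u \<cdot> Neg C (ShM C (-1) h) = Zero C (ShO C (-1) Z) W"
  shows "\<exists>v \<in> Hom C Y W. u = v \<cdot> f"
  using extend_along_g[OF rotate_back[OF assms(1)] assms(2,3)] .

lemma perp_extension_left: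
  assumes "distinguished C X Y Z f g h" "W \<in> Obj C" "perp C X W" "perp C Z W"
  shows "perp C Y W"
proof (subst perp_iff)
  note d = distD[OF assms(1)]
  show "\<forall>u\<in>Hom C Y W. u = Zero C Y W"
  proof
    fix u assume u: "u \<in> Hom C Y W"
    have "u \<cdot> f = Zero C X W" using perpD[OF assms(3)] u d(1) by (simp add: Hom_iff)
    from extend_along_g[OF assms(1) u this] obtain v where v: "v \<in> Hom C Z W" "u = v \<cdot> g" by blast
    then show "u = Zero C Y W" using perpD[OF assms(4) v(1)] d assms(2) by (simp add: Hom_iff)
  qed
qed (use distD[OF assms(1)] assms in auto)

lemma perp_extension_right:
  assumes "distinguished C X Y Z f g h" "W \<in> Obj C" "perp C W X" "perp C W Z"
  shows "perp C W Y"
proof (subst perp_iff)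
  note d = distD[OF assms(1)]
  show "\<forall>u\<in>Hom C W Y. u = Zero C W Y"
  proof
    fix u assume u: "u \<in> Hom C W Y"
    have "g \<cdot> u = Zero C W Z" using perpD[OF assms(4)] u d(2) by (simp add: Hom_iff)
    from lift_along_f[OF assms(1) u this] obtain v where v: "v \<in> Hom C W X" "u = f \<cdot> v" by blast
    then show "u = Zero C W Y" using perpD[OF assms(3) v(1)] d assms(2) by (simp add: Hom_iff)
  qed
qed (use distD[OF assms(1)] assms in auto)

lemma iso_of_zero_cone:
  assumes "distinguished C X Y Z f g h" "zero_object C Z"
  shows "is_iso C X Y f"
proof -
  note d = distD[OF assms(1)]
  have Z: "v = Zero C W Z" if "v \<in> Hom C W Z" for v W
    using assms(2) HomD[OF that] that by (auto simp: zero_object_def)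
  have "zero_object C (ShO C (-1) Z)"
  proof -
    have "ShM C (-1) (Ident C Z) = ShM C (-1) (Zero C Z Z)"
      using assms(2) by (simp only: zero_object_iff)
    then show ?thesis using d by (simp add: zero_object_iff)
  qed
  then have Z1: "v = Zero C W (ShO C (-1) Z)" if "v \<in> Hom C W (ShO C (-1) Z)" for v W
    using HomD[OF that] that by (auto simp: zero_object_def)
  have "g \<cdot> Ident C Y = Zero C Y Z" using Z[of "g \<cdot> Ident C Y" Y] d by (simp add: Hom_iff)
  from lift_along_f[OF assms(1) ident_in[OF d(5)] this] obtain s where
    s: "s \<in> Hom C Y X" "Ident C Y = f \<cdot> s" by blast
  have "f \<cdot> sub (s \<cdot> f) (Ident C X) = sub ((f \<cdot> s) \<cdot> f) f"
    using s(1) d by (simp add: Hom_iff comp_sub assoc)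
  also have "\<dots> = Zero C X Y" using d by (simp add: Hom_iff s(2)[symmetric])
  finally have e: "f \<cdot> sub (s \<cdot> f) (Ident C X) = Zero C X Y" .
  have "sub (s \<cdot> f) (Ident C X) \<in> Hom C X X" using s(1) d by (simp add: Hom_iff)
  from lift_along_connecting[OF assms(1) this e] obtain v where v: "v \<in> Hom C X (ShO C (-1) Z)"
    "sub (s \<cdot> f) (Ident C X) = Neg C (ShM C (-1) h) \<cdot> v" by blast
  have "sub (s \<cdot> f) (Ident C X) = Zero C X X"
    using Z1[OF v(1)] v d by (simp add: Hom_iff)
  then have "s \<cdot> f = Ident C X" using s(1) d by (subst (asm) sub_zero_iff) (simp_all add: Hom_iff)
  then show ?thesis using s d unfolding is_iso_def by auto
qed

text \<open>A triangle with zero connecting morphism is a biproduct diagram. Besides splitting monomorphisms,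
  this provides biproducts in a triangulated subcategory: take the cone of \<open>Y[-1] \<rightarrow> X\<close>.\<close>

lemma split_triangle:
  assumes "distinguished C X Y Z f g (Zero C Z (ShO C 1 X))"
  shows "\<exists>p \<in> Hom C Y X. \<exists>j \<in> Hom C Z Y. p \<cdot> f = Ident C X \<and> g \<cdot> j = Ident C Z \<and>
    p \<cdot> j = Zero C Z X \<and> g \<cdot> f = Zero C X Z \<and> Add C (f \<cdot> p) (j \<cdot> g) = Ident C Y"
proof -
  note d = distD[OF assms(1)]
  note gf = dist_comp_zero[OF assms]
  have "Zero C Z (ShO C 1 X) \<cdot> Ident C Z = Zero C Z (ShO C 1 X)" using d by simp
  from lift_along_g[OF assms ident_in[OF d(6)] this]
  obtain j0 where j0: "j0 \<in> Hom C Z Y" "Ident C Z = g \<cdot> j0" by blast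
  have "Ident C X \<cdot> Neg C (ShM C (-1) (Zero C Z (ShO C 1 X))) = Zero C (ShO C (-1) Z) X"
    using d by simp
  from extend_along_f[OF assms ident_in[OF d(4)] this]
  obtain p where p: "p \<in> Hom C Y X" "Ident C X = p \<cdot> f" by blast
  \<comment> \<open>Any two splittings exist separately; correcting \<open>j0\<close> makes them compatible.\<close>
  define j where "j = sub j0 (f \<cdot> (p \<cdot> j0))"
  note h = d(1,2,4-6)[unfolded Hom_iff] j0(1)[unfolded Hom_iff] p(1)[unfolded Hom_iff]
  have j: "j \<in> Hom C Z Y" unfolding j_def using h by (simp add: Hom_iff)
  have "g \<cdot> (f \<cdot> (p \<cdot> j0)) = (g \<cdot> f) \<cdot> (p \<cdot> j0)" using h by (simp add: assoc)
  also have "\<dots> = Zero C Z Z" unfolding gf using h by simp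
  finally have gj: "g \<cdot> j = Ident C Z"
    unfolding j_def using h by (simp add: comp_sub j0(2)[symmetric])
  have "p \<cdot> (f \<cdot> (p \<cdot> j0)) = (p \<cdot> f) \<cdot> (p \<cdot> j0)" using h by (simp add: assoc)
  also have "\<dots> = p \<cdot> j0" unfolding p(2)[symmetric] using h by simp
  finally have pj: "p \<cdot> j = Zero C Z X"
    unfolding j_def using h by (simp add: comp_sub)
  define e where "e = sub (sub (Ident C Y) (f \<cdot> p)) (j \<cdot> g)"
  note h = h j[unfolded Hom_iff]
  have e: "e \<in> Hom C Y Y" unfolding e_def using h by (simp add: Hom_iff)
  have "g \<cdot> e = sub (sub g ((g \<cdot> f) \<cdot> p)) ((g \<cdot> j) \<cdot> g)"
    unfolding e_def using h by (simp add: comp_sub assoc)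
  also have "\<dots> = Zero C Y Z" unfolding gf gj using h by simp
  finally have "g \<cdot> e = Zero C Y Z" .
  from lift_along_f[OF assms e this] obtain c where c: "c \<in> Hom C Y X" "e = f \<cdot> c" by blast
  have "p \<cdot> e = sub (sub p ((p \<cdot> f) \<cdot> p)) ((p \<cdot> j) \<cdot> g)"
    unfolding e_def using h by (simp add: comp_sub assoc)
  also have "\<dots> = Zero C Y X" unfolding p(2)[symmetric] pj using h by simp
  finally have pe: "p \<cdot> e = Zero C Y X" .
  have "c = (p \<cdot> f) \<cdot> c" unfolding p(2)[symmetric] using c(1) by (simp add: Hom_iff)
  also have "\<dots> = p \<cdot> e" unfolding c(2) using h c(1)[unfolded Hom_iff] by (simp add: assoc)
  finally have "e = Zero C Y Y" using c(2) pe h by simp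
  then have "sub (Ident C Y) (f \<cdot> p) = j \<cdot> g"
    unfolding e_def using h by (subst (asm) sub_zero_iff) simp_all
  moreover have "Add C (sub (Ident C Y) (f \<cdot> p)) (f \<cdot> p) = Ident C Y"
    using h by (intro sub_add_cancel) simp_all
  ultimately have "Add C (f \<cdot> p) (j \<cdot> g) = Ident C Y" using h by (simp add: add_comm)
  then show ?thesis using p j gj pj gf by metis
qed

lemma split_mono_complement:
  assumes "s \<in> Hom C X Y" "r \<in> Hom C Y X" "r \<cdot> s = Ident C X"
  shows "\<exists>Z. \<exists>q \<in> Hom C Y Z. \<exists>j \<in> Hom C Z Y. q \<cdot> j = Ident C Z \<and> j \<cdot> q = sub (Ident C Y) (s \<cdot> r)"
proof -
  obtain Z q h where t: "distinguished C X Y Z s q h" using TR1_cone[OF assms(1)] by blast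
  note d = distD[OF t]
  note hh = d[unfolded Hom_iff] assms(1,2)[unfolded Hom_iff]
  have "h = ShM C 1 (r \<cdot> s) \<cdot> h" unfolding assms(3) using hh by simp
  also have "\<dots> = ShM C 1 r \<cdot> (ShM C 1 s \<cdot> h)" using hh by (simp add: sh_comp assoc)
  also have "\<dots> = Zero C Z (ShO C 1 X)" unfolding dist_comp_zero3[OF t] using hh by simp
  finally have h0: "h = Zero C Z (ShO C 1 X)" .
  then obtain p j where p: "p \<in> Hom C Y X" "j \<in> Hom C Z Y" "p \<cdot> s = Ident C X" "q \<cdot> j = Ident C Z"
    "p \<cdot> j = Zero C Z X" "q \<cdot> s = Zero C X Z" "Add C (s \<cdot> p) (j \<cdot> q) = Ident C Y"
    using split_triangle t by blast
  note hh = hh p(1,2)[unfolded Hom_iff]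
  \<comment> \<open>The retraction \<open>p\<close> obtained from the triangle need not be \<open>r\<close>; adapt \<open>j\<close> to \<open>r\<close>.\<close>
  define j' where "j' = sub j (s \<cdot> (r \<cdot> j))"
  have j': "j' \<in> Hom C Z Y" unfolding j'_def using hh by (simp add: Hom_iff)
  have "q \<cdot> (s \<cdot> (r \<cdot> j)) = (q \<cdot> s) \<cdot> (r \<cdot> j)" using hh by (simp add: assoc)
  then have 1: "q \<cdot> j' = Ident C Z" unfolding j'_def using hh p(4,6) by (simp add: comp_sub)
  define e where "e = sub (Ident C Y) (s \<cdot> r)"
  have e: "e \<in> Arr C" "Dom C e = Y" "Cod C e = Y" unfolding e_def using hh by simp_all
  have es: "e \<cdot> s = Zero C X Y" unfolding e_def using hh assms(3) by (simp add: sub_comp assoc)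
  have ej: "e \<cdot> j = j'" unfolding e_def j'_def using hh by (simp add: sub_comp assoc)
  have "e = e \<cdot> Add C (s \<cdot> p) (j \<cdot> q)" unfolding p(7) using e by simp
  also have "\<dots> = Add C ((e \<cdot> s) \<cdot> p) ((e \<cdot> j) \<cdot> q)" using hh e by (simp add: comp_add assoc)
  also have "\<dots> = j' \<cdot> q" unfolding es ej using hh j'[unfolded Hom_iff] by simp
  finally show ?thesis using 1 j' d(2) unfolding e_def by metis
qed

text \<open>Orthogonality arguments see only the vertices of a triangle, so the signs introduced by rotations
  and shifts can be forgotten.\<close>

definition triangle :: "'o \<Rightarrow> 'o \<Rightarrow> 'o \<Rightarrow> bool"
  where "triangle X Y Z \<longleftrightarrow> (\<exists>f g h. distinguished C X Y Z f g h)"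

lemma triangleI: "distinguished C X Y Z f g h \<Longrightarrow> triangle X Y Z"
  by (auto simp: triangle_def)

lemma triangleD: "triangle X Y Z \<Longrightarrow> X \<in> Obj C" "triangle X Y Z \<Longrightarrow> Y \<in> Obj C" "triangle X Y Z \<Longrightarrow> Z \<in> Obj C"
  by (auto simp: triangle_def dest: distD)

lemma triangle_rotate: "triangle X Y Z \<Longrightarrow> triangle Y Z (ShO C 1 X)"
  unfolding triangle_def using rotate by blast

lemma triangle_rotate_back: "triangle X Y Z \<Longrightarrow> triangle (ShO C (-1) Z) X Y"
  unfolding triangle_def using rotate_back by blast

lemma triangle_shift:
  assumes "triangle X Y Z"
  shows "triangle (ShO C n X) (ShO C n Y) (ShO C n Z)"
proof (induction n rule: int_induct[where k = 0])
  case base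
  show ?case using assms triangleD[OF assms] by simp
next
  case (step1 n)
  from triangle_rotate[OF triangle_rotate[OF triangle_rotate[OF step1(2)]]] triangleD[OF assms]
  show ?case by (simp add: add.commute)
next
  case (step2 n)
  from triangle_rotate_back[OF triangle_rotate_back[OF triangle_rotate_back[OF step2(2)]]] triangleD[OF assms]
  show ?case by (simp add: add.commute)
qed

lemma triangle_ident: 
  assumes "X \<in> Obj C" shows "\<exists>N. zero_object C N \<and> triangle X X N" "\<exists>N. zero_object C N \<and> triangle N X X"
proof -
  obtain N where N: "zero_object C N" using zero_object_exists by blast
  then have NO: "N \<in> Obj C" by (simp add: zero_object_def)
  have t: "triangle X X N" using TR1_ident[OF assms N] by (rule triangleI)
  show "\<exists>N. zero_object C N \<and> triangle X X N" using t N by blast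
  have "ShM C (-1) (Ident C N) = ShM C (-1) (Zero C N N)"
    using N by (simp only: zero_object_iff)
  then have "zero_object C (ShO C (-1) N)" using NO by (simp add: zero_object_iff)
  then show "\<exists>N. zero_object C N \<and> triangle N X X" using triangle_rotate_back[OF t] by blast
qed

text \<open>The octahedral axiom is used in three shapes, which tell how to rearrange a two-step
  extension.\<close>

lemma octahedron_cone:
  assumes "triangle G F R" "triangle F B R'"
  shows "\<exists>S. triangle G B S \<and> triangle R S R'"
proof -
  obtain f i i' where 1: "distinguished C G F R f i i'" using assms by (auto simp: triangle_def)
  obtain g j j' where 2: "distinguished C F B R' g j j'" using assms by (auto simp: triangle_def)
  have "g \<cdot> f \<in> Hom C G B" using distD[OF 1] distD[OF 2] by (auto simp: Hom_iff)
  from TR1_cone[OF this] obtain S k k' where 3: "distinguished C G B S (g \<cdot> f) k k'" by blast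
  from TR4[OF 1 2 3] 3 show ?thesis by (auto simp: triangle_def)
qed

lemma octahedron_fibre:
  assumes "triangle A B K" "triangle L K R"
  shows "\<exists>F. triangle F B R \<and> triangle A F L"
proof -
  obtain S where S: "triangle B R S" "triangle (ShO C 1 A) S (ShO C 1 L)"
    using octahedron_cone[OF triangle_rotate[OF assms(1)] triangle_rotate[OF assms(2)]] by blast
  have "triangle (ShO C (-1) S) B R" using triangle_rotate_back[OF S(1)] .
  moreover have "triangle A (ShO C (-1) S) L"
    using triangle_shift[OF S(2), of "-1"] triangleD[OF assms(1)] triangleD[OF assms(2)] by simp
  ultimately show ?thesis by blast
qed

text \<open>If \<open>r : A \<rightarrow> R\<close> extends along \<open>A \<rightarrow> F\<close>, then the fibre of the extension is itself an extension
  of the cone \<open>K\<close> of \<open>A \<rightarrow> F\<close> by the fibre of \<open>r\<close>.\<close>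

lemma octahedron_extend:
  assumes "distinguished C A F K a b c" "distinguished C L A R l r s"
    "d \<in> Hom C F R" "d \<cdot> a = r"
  shows "\<exists>G. triangle G F R \<and> triangle L G K"
proof -
  obtain X j j' where 2: "distinguished C F R X d j j'" using TR1_cone[OF assms(3)] by blast
  have "distinguished C A R (ShO C 1 L) (d \<cdot> a) s (Neg C (ShM C 1 l))"
    using rotate[OF assms(2)] assms(4) by simp
  from TR4[OF assms(1) 2 this] have t: "triangle K (ShO C 1 L) X" by (auto simp: triangle_def)
  have "triangle L (ShO C (-1) X) K"
    using triangle_rotate_back[OF triangle_rotate_back[OF t]] distD[OF assms(2)] by simp
  moreover have "triangle (ShO C (-1) X) F R" using triangle_rotate_back[OF triangleI[OF 2]] .
  ultimately show ?thesis by blast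
qed

lemma perp_triangle_left: "triangle X Y Z \<Longrightarrow> W \<in> Obj C \<Longrightarrow> perp C X W \<Longrightarrow> perp C Z W \<Longrightarrow> perp C Y W"
  unfolding triangle_def using perp_extension_left by blast

lemma perp_triangle_right: "triangle X Y Z \<Longrightarrow> W \<in> Obj C \<Longrightarrow> perp C W X \<Longrightarrow> perp C W Z \<Longrightarrow> perp C W Y"
  unfolding triangle_def using perp_extension_right by blast

lemma perp_self: "X \<in> Obj C \<Longrightarrow> perp C X X \<longleftrightarrow> zero_object C X"
  using ident_in[of X] by (auto simp: perp_def zero_object_iff) (metis zero_object_def zero_object_iff singletonD)

end

section \<open>Full triangulated subcategories\<close>

lemma full_subcat_simps [simp]:
  "Obj (full_subcat C D) = Obj C \<inter> D"
  "Arr (full_subcat C D) = {f \<in> Arr C. Dom C f \<in> D \<and> Cod C f \<in> D}"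
  "Dom (full_subcat C D) = Dom C" "Cod (full_subcat C D) = Cod C"
  "Ident (full_subcat C D) = Ident C" "Comp (full_subcat C D) = Comp C"
  by (simp_all add: full_subcat_def)

lemma full_subcat_preadd_simps [simp]:
  fixes C :: "('o, 'm, 'z) preadd_data_scheme"
  shows "Add (full_subcat C D) = Add C" "Zero (full_subcat C D) = Zero C"
  by (simp_all add: full_subcat_def)

lemma full_subcat_tri_simps [simp]:
  fixes C :: "('o, 'm, 'z) tri_data_scheme"
  shows "ShO (full_subcat C D) = ShO C" "ShM (full_subcat C D) = ShM C" "Dist (full_subcat C D) = Dist C"
  by (simp_all add: full_subcat_def)

lemma Hom_full_subcat_eq:
  "Hom (full_subcat C D) X Y = (if X \<in> D \<and> Y \<in> D then Hom C X Y else {})"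
  by (auto simp: Hom_def)

lemma Hom_full_subcat [simp]:
  "X \<in> D \<Longrightarrow> Y \<in> D \<Longrightarrow> Hom (full_subcat C D) X Y = Hom C X Y"
  by (auto simp: Hom_def)

lemma Hom_full_subcatD:
  "f \<in> Hom (full_subcat C D) X Y \<Longrightarrow> f \<in> Hom C X Y \<and> X \<in> D \<and> Y \<in> D"
  by (auto simp: Hom_def)

lemma hom_group_full_subcat [simp]:
  "X \<in> D \<Longrightarrow> Y \<in> D \<Longrightarrow> hom_group (full_subcat C D) X Y = hom_group C X Y"
  by (simp add: hom_group_def)

lemma Neg_full_subcat [simp]:
  "Dom C f \<in> D \<Longrightarrow> Cod C f \<in> D \<Longrightarrow> Neg (full_subcat C D) f = Neg C f"
  by (simp add: Neg_def)

lemma perp_full_subcat [simp]: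
  "X \<in> D \<Longrightarrow> Y \<in> D \<Longrightarrow> perp (full_subcat C D) X Y \<longleftrightarrow> perp C X Y"
  by (simp add: perp_def)

lemma LE_GE_full_subcat [simp]:
  "LE (full_subcat C D) s i = LE C s i" "GE (full_subcat C D) s i = GE C s i"
  by (simp_all add: LE_def GE_def)

context category
begin

lemma category_full_subcat: "category (full_subcat C D)"
  by unfold_locales
    (auto simp: dom_in cod_in ident_in Hom_full_subcat_eq comp_assoc comp_in comp_ident_left comp_ident_right
      split: if_splits)

text \<open>The two records are equal, not merely equivalent, so a weight structure on the full subcategory
  of all objects is a weight structure on the category.\<close>

lemma full_subcat_all: "full_subcat C (Obj C) = C"
proof -
  have "{f \<in> Arr C. Dom C f \<in> Obj C \<and> Cod C f \<in> Obj C} = Arr C"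
    using dom_in cod_in by auto
  then show ?thesis by (simp add: full_subcat_def)
qed

lemma is_iso_full_subcat:
  "is_iso (full_subcat C D) X Y f \<longleftrightarrow> X \<in> D \<and> Y \<in> D \<and> is_iso C X Y f"
  by (auto simp: is_iso_def Hom_full_subcat_eq)

end

context preadditive_category
begin

lemma preadditive_full_subcat: "preadditive_category (full_subcat C D)"
proof -
  interpret S: category "full_subcat C D" by (rule category_full_subcat)
  show ?thesis
    by (intro preadditive_category.intro S.category_axioms preadditive_category_axioms.intro)
      (auto simp: hom_comm_group comp_add_left comp_add_right Hom_full_subcat_eq split: if_splits)
qed

lemma zero_object_full_subcat:
  "zero_object (full_subcat C D) N \<longleftrightarrow> N \<in> D \<and> zero_object C N"
proof -
  interpret S: preadditive_category "full_subcat C D" by (rule preadditive_full_subcat)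
  show ?thesis by (auto simp: zero_object_iff S.zero_object_iff)
qed

end

lemma distinguished_full_subcat:
  assumes "\<And>X n. X \<in> D \<Longrightarrow> ShO C n X \<in> D"
  shows "distinguished (full_subcat C D) X Y Z f g h \<longleftrightarrow>
    X \<in> D \<and> Y \<in> D \<and> Z \<in> D \<and> distinguished C X Y Z f g h"
  using assms by (auto simp: distinguished_def Hom_full_subcat_eq)

context triangulated_category
begin

lemma triangulated_subcategory_two_of_three:
  assumes "triangulated_subcategory C D" "triangle X Y Z"
  shows "X \<in> D \<Longrightarrow> Y \<in> D \<Longrightarrow> Z \<in> D" "Y \<in> D \<Longrightarrow> Z \<in> D \<Longrightarrow> X \<in> D" "X \<in> D \<Longrightarrow> Z \<in> D \<Longrightarrow> Y \<in> D"
proof -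
  have sh: "ShO C n X \<in> D" if "X \<in> D" for X n
    using assms(1) that by (auto simp: triangulated_subcategory_def)
  have c: "Z \<in> D" if "triangle X Y Z" "X \<in> D" "Y \<in> D" for X Y Z
    using assms(1) that unfolding triangulated_subcategory_def triangle_def by blast
  show "X \<in> D \<Longrightarrow> Y \<in> D \<Longrightarrow> Z \<in> D" using c assms(2) by blast
  show "X \<in> D" if "Y \<in> D" "Z \<in> D"
    using sh[OF c[OF triangle_rotate[OF assms(2)]], of "-1"] that triangleD[OF assms(2)] by simp
  show "Y \<in> D" if "X \<in> D" "Z \<in> D"
    using c[OF triangle_rotate_back[OF assms(2)] sh] that by simp
qed

lemma triangulated_full_subcat:
  assumes "triangulated_subcategory C D"
  shows "triangulated_category (full_subcat C D)"
proof -
  let ?E = "full_subcat C D"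
  interpret S: preadditive_category ?E by (rule preadditive_full_subcat)
  have sh: "ShO C n X \<in> D" if "X \<in> D" for X n
    using assms that by (auto simp: triangulated_subcategory_def)
  have DO: "X \<in> Obj C" if "X \<in> D" for X
    using assms that by (auto simp: triangulated_subcategory_def)
  have cone: "Z \<in> D" if "distinguished C X Y Z f g h" "X \<in> D" "Y \<in> D" for X Y Z f g h
    using assms that unfolding triangulated_subcategory_def by blast
  note ds = distinguished_full_subcat[OF sh]
  note Hs = Hom_full_subcat_eq
  show ?thesis
  proof unfold_locales
    show "\<exists>N. zero_object ?E N"
      using assms by (auto simp: triangulated_subcategory_def zero_object_full_subcat)
  next
    fix X Y assume "X \<in> Obj ?E" "Y \<in> Obj ?E"
    then have XY: "X \<in> Obj C" "X \<in> D" "Y \<in> Obj C" "Y \<in> D" by auto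
    obtain S i q where "distinguished C (ShO C (-1) Y) X S (Zero C (ShO C (-1) Y) X) i q"
      using TR1_cone[OF zero_in] XY by (meson sh_obj)
    note t = this cone[OF this sh]
    have d: "distinguished C X S Y i q (Zero C Y (ShO C 1 X))"
      using rotate[OF t(1)] XY by simp
    have "S \<in> D" using t(2) XY by blast
    from split_triangle[OF d] distD[OF d] this XY
    show "\<exists>S\<in>Obj ?E.
        \<exists>i\<in>Hom ?E X S. \<exists>j\<in>Hom ?E Y S.
        \<exists>p\<in>Hom ?E S X. \<exists>q\<in>Hom ?E S Y.
         p \<cdot>\<^bsub>?E\<^esub> i = Ident ?E X \<and>
         q \<cdot>\<^bsub>?E\<^esub> j = Ident ?E Y \<and>
         p \<cdot>\<^bsub>?E\<^esub> j = Zero ?E Y X \<and>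
         q \<cdot>\<^bsub>?E\<^esub> i = Zero ?E X Y \<and>
         Add ?E (i \<cdot>\<^bsub>?E\<^esub> p) (j \<cdot>\<^bsub>?E\<^esub> q) =
           Ident ?E S"
      by (intro bexI[where x = S]) (auto simp del: comp_arr)
  next
    fix n show "is_functor ?E ?E
        (ShO ?E n) (ShM ?E n)"
      using shift_functor[of n] by (auto simp: is_functor_def Hs sh split: if_splits)
  next
    fix f g X Y n assume "f \<in> Hom ?E X Y" "g \<in> Hom ?E X Y"
    then show "ShM ?E n (Add ?E f g) =
       Add ?E (ShM ?E n f) (ShM ?E n g)"
      by (auto dest!: Hom_full_subcatD simp: shift_add)
  next
    fix X N assume "X \<in> Obj ?E" "zero_object ?E N"
    then show "distinguished ?E X X N (Ident ?E X)
        (Zero ?E X N) (Zero ?E N (ShO ?E 1 X))"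
      using TR1_ident by (auto simp: ds zero_object_full_subcat)
  next
    fix X Y Z f g h f' X' Y' g' Z' h' a b c
    assume "distinguished ?E X Y Z f g h"
      "f' \<in> Hom ?E X' Y'" "g' \<in> Hom ?E Y' Z'"
      "h' \<in> Hom ?E Z' (ShO ?E 1 X')"
      "is_iso ?E X X' a" "is_iso ?E Y Y' b"
      "is_iso ?E Z Z' c"
      "f' \<cdot>\<^bsub>?E\<^esub> a = b \<cdot>\<^bsub>?E\<^esub> f"
      "g' \<cdot>\<^bsub>?E\<^esub> b = c \<cdot>\<^bsub>?E\<^esub> g"
      "h' \<cdot>\<^bsub>?E\<^esub> c = ShM ?E 1 a \<cdot>\<^bsub>?E\<^esub> h"
    then show "distinguished ?E X' Y' Z' f' g' h'"
      by (auto simp: ds is_iso_full_subcat dest!: Hom_full_subcatD intro: TR1_iso)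
  next
    fix f X Y assume f: "f \<in> Hom ?E X Y"
    then obtain Z g h where d: "distinguished C X Y Z f g h"
      using TR1_cone by (metis Hom_full_subcatD)
    have "distinguished ?E X Y Z f g h"
      using Hom_full_subcatD[OF f] cone[OF d] d by (simp add: ds)
    then show "\<exists>Z g h. distinguished ?E X Y Z f g h" by blast
  next
    fix f X Y Z g h assume "f \<in> Hom ?E X Y"
    then have f: "f \<in> Hom C X Y" "X \<in> D" "Y \<in> D" by (auto dest: Hom_full_subcatD)
    then have n: "Neg ?E (ShM C 1 f) = Neg C (ShM C 1 f)"
      by (auto simp: Hom_iff sh)
    show "distinguished ?E X Y Z f g h \<longleftrightarrow>
      distinguished ?E Y Z (ShO ?E 1 X) g h
        (Neg ?E (ShM ?E 1 f))"
      using TR2[OF f(1), of Z g h] f(2,3) sh n by (auto simp: ds)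
  next
    fix X Y Z f g h X' Y' Z' f' g' h' a b
    assume "distinguished ?E X Y Z f g h"
      "distinguished ?E X' Y' Z' f' g' h'"
      "a \<in> Hom ?E X X'" "b \<in> Hom ?E Y Y'"
      "f' \<cdot>\<^bsub>?E\<^esub> a = b \<cdot>\<^bsub>?E\<^esub> f"
    then show "\<exists>c\<in>Hom ?E Z Z'. g' \<cdot>\<^bsub>?E\<^esub> b = c \<cdot>\<^bsub>?E\<^esub> g \<and>
        h' \<cdot>\<^bsub>?E\<^esub> c = ShM ?E 1 a \<cdot>\<^bsub>?E\<^esub> h"
      using TR3[of X Y Z f g h X' Y' Z' f' g' h' a b] by (auto simp: ds dest!: Hom_full_subcatD)
  next
    fix X Y Z' f i i' Z X' g j j' Y' k k'
    assume "distinguished ?E X Y Z' f i i'"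
      "distinguished ?E Y Z X' g j j'"
      "distinguished ?E X Z Y' (g \<cdot>\<^bsub>?E\<^esub> f) k k'"
    then show "\<exists>u v. distinguished ?E Z' Y' X' u v
          (ShM ?E 1 i \<cdot>\<^bsub>?E\<^esub> j') \<and>
        u \<cdot>\<^bsub>?E\<^esub> i = k \<cdot>\<^bsub>?E\<^esub> g \<and> k' \<cdot>\<^bsub>?E\<^esub> u = i' \<and>
        v \<cdot>\<^bsub>?E\<^esub> k = j \<and>
        j' \<cdot>\<^bsub>?E\<^esub> v = ShM ?E 1 f \<cdot>\<^bsub>?E\<^esub> k'"
      using TR4[of X Y Z' f i i' Z X' g j j' Y' k k'] by (auto simp: ds)
  qed (use sh in \<open>auto simp del: sh_sh simp: shift_zero_obj shift_zero_arr shift_shift_obj shift_shift_arr\<close>)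
qed

end

section \<open>Orthogonality for t-structures\<close>

context triangulated_category
begin

lemma zero_object_shift: "zero_object C N \<Longrightarrow> zero_object C (ShO C n N)"
  unfolding zero_object_iff by (metis sh_ident sh_zero sh_obj)

lemma perp_zero: 
  assumes "zero_object C N" "X \<in> Obj C"
  shows "perp C N X" "perp C X N"
  using assms by (auto simp: zero_object_def perp_def)

lemma isomorphic_shift:
  assumes "isomorphic C X Y" shows "isomorphic C (ShO C n X) (ShO C n Y)"
proof -
  obtain f g where f: "f \<in> Hom C X Y" "g \<in> Hom C Y X" "g \<cdot> f = Ident C X" "f \<cdot> g = Ident C Y"
    and O: "X \<in> Obj C" "Y \<in> Obj C"
    using assms by (auto simp: isomorphic_def is_iso_def)
  have "ShM C n (g \<cdot> f) = ShM C n (Ident C X)" "ShM C n (f \<cdot> g) = ShM C n (Ident C Y)"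
    using f by simp_all
  then have "ShM C n g \<cdot> ShM C n f = Ident C (ShO C n X)" "ShM C n f \<cdot> ShM C n g = Ident C (ShO C n Y)"
    using f(1,2) O sh_comp[of f g n] sh_comp[of g f n] by (simp_all add: Hom_iff)
  then have "is_iso C (ShO C n X) (ShO C n Y) (ShM C n f)"
    using sh_in[OF f(1)] sh_in[OF f(2)] O by (auto simp: is_iso_def)
  then show ?thesis by (auto simp: isomorphic_def)
qed

lemma isomorphic_sym: "isomorphic C X Y \<Longrightarrow> isomorphic C Y X"
  by (auto simp: isomorphic_def is_iso_def)

lemma isomorphic_trans:
  assumes "isomorphic C X Y" "isomorphic C Y Z" shows "isomorphic C X Z"
proof -
  obtain f f' g g' where f: "f \<in> Hom C X Y" "f' \<in> Hom C Y X" "f' \<cdot> f = Ident C X" "f \<cdot> f' = Ident C Y"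
    and g: "g \<in> Hom C Y Z" "g' \<in> Hom C Z Y" "g' \<cdot> g = Ident C Y" "g \<cdot> g' = Ident C Z"
    using assms unfolding isomorphic_def is_iso_def by blast
  note h = f(1,2)[unfolded Hom_iff] g(1,2)[unfolded Hom_iff]
  have "(f' \<cdot> g') \<cdot> (g \<cdot> f) = f' \<cdot> ((g' \<cdot> g) \<cdot> f)" "(g \<cdot> f) \<cdot> (f' \<cdot> g') = g \<cdot> ((f \<cdot> f') \<cdot> g')"
    using h by (simp_all add: assoc)
  then have "(f' \<cdot> g') \<cdot> (g \<cdot> f) = Ident C X" "(g \<cdot> f) \<cdot> (f' \<cdot> g') = Ident C Z"
    unfolding f(4) g(3) using h f(3) g(4) by simp_all
  then show ?thesis
    using comp_in[OF f(1) g(1)] comp_in[OF g(2) f(2)] HomD(4)[OF f(1)] HomD(5)[OF g(1)]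
    unfolding isomorphic_def is_iso_def by blast
qed

lemma is_iso_ident: "X \<in> Obj C \<Longrightarrow> is_iso C X X (Ident C X)"
  using ident_in[of X] by (auto simp: is_iso_def intro!: bexI[of _ "Ident C X"])

lemma perp_retract:
  assumes "retract_of_object C X Y" "perp C Y Z" "Z \<in> Obj C"
  shows "perp C X Z"
proof (subst perp_iff)
  obtain i p where i: "i \<in> Hom C X Y" "p \<in> Hom C Y X" "p \<cdot> i = Ident C X" 
    and O: "X \<in> Obj C" "Y \<in> Obj C"
    using assms(1) by (auto simp: retract_of_object_def)
  show "\<forall>f\<in>Hom C X Z. f = Zero C X Z"
  proof
    fix f assume f: "f \<in> Hom C X Z"
    have "f = f \<cdot> (p \<cdot> i)" unfolding i(3) using f by (simp add: Hom_iff)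
    also have "\<dots> = (f \<cdot> p) \<cdot> i" using f i by (simp add: Hom_iff assoc)
    also have "f \<cdot> p = Zero C Y Z" using f i(2) by (intro perpD[OF assms(2)]) (auto simp: Hom_iff)
    finally show "f = Zero C X Z" using i(1) assms(3) by (simp add: Hom_iff)
  qed
qed (use assms in \<open>auto simp: retract_of_object_def\<close>)

text \<open>The tool that turns orthogonality into vanishing: if one of the two maps of a triangle is zero and
  there are no maps in the direction of the connecting morphism, then an identity must vanish.\<close>

lemma zero_of_dist_zero_map:
  assumes "distinguished C X Y Z f g h"
  shows "g = Zero C Y Z \<Longrightarrow> perp C (ShO C 1 X) Z \<Longrightarrow> zero_object C Z"
    and "f = Zero C X Y \<Longrightarrow> perp C X (ShO C (-1) Z) \<Longrightarrow> zero_object C X"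
proof -
  note d = distD[OF assms]
  show "zero_object C Z" if "g = Zero C Y Z" "perp C (ShO C 1 X) Z"
  proof -
    have "Ident C Z \<cdot> g = Zero C Y Z" using that d by simp
    from extend_along_h[OF assms ident_in[OF d(6)] this]
    obtain v where v: "v \<in> Hom C (ShO C 1 X) Z" "Ident C Z = v \<cdot> h" by blast
    have "Ident C Z = Zero C Z Z" using perpD[OF that(2) v(1)] v(2) d by (simp add: Hom_iff)
    then show ?thesis using d by (simp add: zero_object_iff)
  qed
  show "zero_object C X" if "f = Zero C X Y" "perp C X (ShO C (-1) Z)"
  proof -
    have "f \<cdot> Ident C X = Zero C X Y" using that d by simp
    from lift_along_connecting[OF assms ident_in[OF d(4)] this]
    obtain v where v: "v \<in> Hom C X (ShO C (-1) Z)" "Ident C X = Neg C (ShM C (-1) h) \<cdot> v" by blast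
    have "Ident C X = Zero C X X" using perpD[OF that(2) v(1)] v(2) d by (simp add: Hom_iff)
    then show ?thesis using d by (simp add: zero_object_iff)
  qed
qed

end

context t_structure
begin

lemma LE_iff: "X \<in> LE C t i \<longleftrightarrow> X \<in> Obj C \<and> ShO C (-i) X \<in> LE0 t"
  using t_le_obj by (force simp: LE_def image_iff)

lemma GE_iff: "X \<in> GE C t i \<longleftrightarrow> X \<in> Obj C \<and> ShO C (-i) X \<in> GE0 t"
  using t_ge_obj by (force simp: GE_def image_iff)

lemma LE_0 [simp]: "LE C t 0 = LE0 t" and GE_0 [simp]: "GE C t 0 = GE0 t"
  using t_le_obj t_ge_obj by (auto simp: LE_iff GE_iff)

lemma LE_obj: "X \<in> LE C t i \<Longrightarrow> X \<in> Obj C" and GE_obj: "X \<in> GE C t i \<Longrightarrow> X \<in> Obj C"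
  by (auto simp: LE_iff GE_iff)

lemma LE_shift_iff: "X \<in> Obj C \<Longrightarrow> ShO C n X \<in> LE C t i \<longleftrightarrow> X \<in> LE C t (i - n)"
  and GE_shift_iff: "X \<in> Obj C \<Longrightarrow> ShO C n X \<in> GE C t i \<longleftrightarrow> X \<in> GE C t (i - n)"
  by (auto simp: LE_iff GE_iff)

lemma LE_mono: "i \<le> j \<Longrightarrow> LE C t i \<subseteq> LE C t j"
proof (induction j rule: int_ge_induct)
  case (step j)
  have "X \<in> LE C t (j + 1)" if "X \<in> LE C t j" for X
  proof -
    have X: "X \<in> Obj C" "ShO C (-j) X \<in> LE C t 1" using that t_le_shift by (auto simp: LE_iff)
    then have "X \<in> LE C t (1 - (-j))" by (subst (asm) LE_shift_iff) 
    then show ?thesis by (simp add: add.commute)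
  qed
  then show ?case using step by auto
qed simp

lemma GE_antimono: "i \<le> j \<Longrightarrow> GE C t j \<subseteq> GE C t i"
proof (induction j rule: int_ge_induct)
  case (step j)
  have "X \<in> GE C t j" if "X \<in> GE C t (j + 1)" for X
  proof -
    have X: "X \<in> Obj C" "ShO C (-j-1) X \<in> GE0 t" using that by (auto simp: GE_iff)
    then have "ShO C 1 (ShO C (-j-1) X) \<in> GE C t 1" unfolding GE_def by blast
    then show ?thesis using X t_ge_shift by (auto simp: GE_iff)
  qed
  then show ?case using step by auto
qed simp

lemma t_perp:
  assumes "X \<in> GE C t i" "Y \<in> LE C t j" "j < i" shows "perp C X Y"
proof -
  have O: "X \<in> Obj C" "Y \<in> Obj C" using assms by (auto dest: LE_obj GE_obj)
  have "X \<in> GE C t (j + 1)" using GE_antimono[of "j + 1" i] assms by auto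
  then have "ShO C (-j) X \<in> GE C t 1" using O by (simp add: GE_shift_iff add.commute)
  moreover have "ShO C (-j) Y \<in> LE0 t" using assms by (simp add: LE_iff)
  ultimately have "perp C (ShO C (-j) X) (ShO C (-j) Y)"
    using t_orthogonal by (auto simp: class_perp_def)
  then show ?thesis using O perp_shift by blast
qed

lemma t_decomposition_at:
  assumes "M \<in> Obj C" shows "\<exists>T \<in> GE C t i. \<exists>R \<in> LE C t (i - 1). triangle T M R"
proof -
  obtain L R where LR: "L \<in> GE0 t" "R \<in> LE C t (-1)" "triangle L (ShO C (-i) M) R"
    using t_decomposition[OF sh_obj[OF assms], of "-i"] unfolding triangle_def by blast
  have "triangle (ShO C i L) M (ShO C i R)" using triangle_shift[OF LR(3), of i] assms by simp
  moreover have "ShO C i L \<in> GE C t i" using LR by (auto simp: GE_def)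
  moreover have "ShO C i R \<in> LE C t (i - 1)"
    using LR LE_obj by (simp add: LE_shift_iff)
  ultimately show ?thesis by blast
qed

lemma GE_isomorphic: "X \<in> GE C t i \<Longrightarrow> isomorphic C X Y \<Longrightarrow> Y \<in> GE C t i"
  using t_ge_iso_closed isomorphic_shift[of X Y "-i"] unfolding GE_iff iso_closed_def
  by (metis isomorphic_def is_iso_def)

lemma LE_isomorphic: "X \<in> LE C t i \<Longrightarrow> isomorphic C X Y \<Longrightarrow> Y \<in> LE C t i"
  using t_le_iso_closed isomorphic_shift[of X Y "-i"] unfolding LE_iff iso_closed_def
  by (metis isomorphic_def is_iso_def)

text \<open>Each class of a t-structure is determined by the other one. All closure properties below are read
  off from these two descriptions.\<close>

lemma GE_iff_perp: "X \<in> GE C t i \<longleftrightarrow> X \<in> Obj C \<and> (\<forall>Y \<in> LE C t (i - 1). perp C X Y)"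
proof
  assume "X \<in> GE C t i" then show "X \<in> Obj C \<and> (\<forall>Y \<in> LE C t (i - 1). perp C X Y)"
    using t_perp[of X i _ "i - 1"] by (auto dest: GE_obj)
next
  assume X: "X \<in> Obj C \<and> (\<forall>Y \<in> LE C t (i - 1). perp C X Y)"
  then obtain T R f g h where T: "T \<in> GE C t i" "R \<in> LE C t (i - 1)"
    and d: "distinguished C T X R f g h"
    using t_decomposition_at[of X i] by (auto simp: triangle_def)
  have "g = Zero C X R" using X T(2) distD[OF d] by (auto intro: perpD)
  moreover have "perp C (ShO C 1 T) R"
    using T GE_obj[OF T(1)] by (intro t_perp[of _ "i + 1" _ "i - 1"]) (auto simp: GE_shift_iff)
  ultimately have "zero_object C R" using zero_of_dist_zero_map[OF d] by blast
  from iso_of_zero_cone[OF d this] show "X \<in> GE C t i"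
    using GE_isomorphic T(1) by (auto simp: isomorphic_def)
qed

lemma LE_iff_perp: "Y \<in> LE C t i \<longleftrightarrow> Y \<in> Obj C \<and> (\<forall>X \<in> GE C t (i + 1). perp C X Y)"
proof
  assume "Y \<in> LE C t i" then show "Y \<in> Obj C \<and> (\<forall>X \<in> GE C t (i + 1). perp C X Y)"
    using t_perp[of _ "i + 1" Y i] by (auto dest: LE_obj)
next
  assume Y: "Y \<in> Obj C \<and> (\<forall>X \<in> GE C t (i + 1). perp C X Y)"
  then obtain T R f g h where T: "T \<in> GE C t (i + 1)" "R \<in> LE C t i"
    and d: "distinguished C T Y R f g h"
    using t_decomposition_at[of Y "i + 1"] by (auto simp: triangle_def)
  have "f = Zero C T Y" using Y T(1) distD[OF d] by (auto intro: perpD)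
  moreover have "perp C T (ShO C (-1) R)"
    using T LE_obj[OF T(2)] by (intro t_perp[of _ "i + 1" _ "i - 1"]) (auto simp: LE_shift_iff)
  ultimately have "zero_object C (ShO C 1 T)"
    using zero_of_dist_zero_map[OF d] zero_object_shift by blast
  from iso_of_zero_cone[OF rotate[OF d] this] have "isomorphic C Y R" by (auto simp: isomorphic_def)
  then show "Y \<in> LE C t i" using LE_isomorphic[OF T(2) isomorphic_sym] by blast
qed

lemma GE_extension: "triangle X Y Z \<Longrightarrow> X \<in> GE C t i \<Longrightarrow> Z \<in> GE C t i \<Longrightarrow> Y \<in> GE C t i"
  using perp_triangle_left[of X Y Z] triangleD[of X Y Z] LE_obj unfolding GE_iff_perp by blast

lemma LE_extension: "triangle X Y Z \<Longrightarrow> X \<in> LE C t i \<Longrightarrow> Z \<in> LE C t i \<Longrightarrow> Y \<in> LE C t i"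
  using perp_triangle_right[of X Y Z] triangleD[of X Y Z] GE_obj unfolding LE_iff_perp by blast

lemma GE_cone: "triangle X Y Z \<Longrightarrow> X \<in> GE C t (i - 1) \<Longrightarrow> Y \<in> GE C t i \<Longrightarrow> Z \<in> GE C t i"
  using GE_extension[OF triangle_rotate] triangleD[of X Y Z] by (simp add: GE_shift_iff)

lemma LE_fibre: "triangle X Y Z \<Longrightarrow> Y \<in> LE C t i \<Longrightarrow> Z \<in> LE C t (i + 1) \<Longrightarrow> X \<in> LE C t i"
  using LE_extension[OF triangle_rotate_back] triangleD[of X Y Z] by (simp add: LE_shift_iff)

lemma zero_in_GE: "zero_object C N \<Longrightarrow> N \<in> GE C t i"
  using perp_zero LE_obj by (auto simp: GE_iff_perp zero_object_def)

lemma GE_LE_zero: "X \<in> GE C t i \<Longrightarrow> X \<in> LE C t j \<Longrightarrow> j < i \<Longrightarrow> zero_object C X"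
  using t_perp[of X i X j] perp_self GE_obj by blast

lemma bounded_below_eq: "bounded_below_objects C t = {X. \<exists>i. X \<in> GE C t i}"
  by (auto simp: bounded_below_objects_def)

lemma triangulated_bounded_below: "triangulated_subcategory C (bounded_below_objects C t)"
proof -
  obtain N where "zero_object C N" using zero_object_exists by blast
  then have "\<exists>N\<in>{X. \<exists>i. X \<in> GE C t i}. zero_object C N" using zero_in_GE by blast
  moreover have "iso_closed C {X. \<exists>i. X \<in> GE C t i}"
    using GE_isomorphic by (auto simp: iso_closed_def)
  moreover have "\<exists>j. ShO C n X \<in> GE C t j" if "X \<in> GE C t i" for X i n
  proof
    show "ShO C n X \<in> GE C t (i + n)" using that GE_obj by (auto simp: GE_shift_iff)
  qed
  moreover have "\<exists>k. Z \<in> GE C t k" if d: "distinguished C X Y Z f g h" "X \<in> GE C t i" "Y \<in> GE C t j"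
    for X Y Z f g h i j
  proof
    have "min i j - 1 \<le> i" "min i j \<le> j" by simp_all
    from this[THEN GE_antimono] have "X \<in> GE C t (min i j - 1)" "Y \<in> GE C t (min i j)"
      using d(2,3) by blast+
    then show "Z \<in> GE C t (min i j)" by (rule GE_cone[OF triangleI[OF d(1)]])
  qed
  ultimately show ?thesis
    unfolding triangulated_subcategory_def bounded_below_eq by (auto dest: GE_obj)
qed

section \<open>Weight decompositions\<close>

abbreviation weight_le :: "'o set" where "weight_le \<equiv> left_perp C (GE C t 1)"

definition weight_decomposable :: "'o \<Rightarrow> bool"
  where "weight_decomposable M \<longleftrightarrow> (\<exists>L \<in> weight_le. \<exists>R \<in> GE C t 1. triangle L M R)"

lemma weight_le_iff: "L \<in> weight_le \<longleftrightarrow> L \<in> Obj C \<and> (\<forall>Y \<in> GE C t 1. perp C L Y)"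
  by (auto simp: left_perp_def)

lemma weight_le_extension: "triangle X Y Z \<Longrightarrow> X \<in> weight_le \<Longrightarrow> Z \<in> weight_le \<Longrightarrow> Y \<in> weight_le"
  using perp_triangle_left[of X Y Z] triangleD[of X Y Z] GE_obj unfolding weight_le_iff by blast

lemma weight_le_shift:
  assumes "X \<in> weight_le" "n \<le> 0" shows "ShO C n X \<in> weight_le"
  unfolding weight_le_iff
proof (intro conjI ballI)
  fix Y assume Y: "Y \<in> GE C t 1"
  then have "ShO C (-n) Y \<in> GE C t 1"
    using GE_antimono[of "1 + n" 1] assms(2) GE_obj[OF Y] by (auto simp: GE_shift_iff)
  then have "perp C X (ShO C (-n) Y)" using assms by (auto simp: weight_le_iff)
  then have "perp C (ShO C n X) (ShO C n (ShO C (-n) Y))"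
    using perp_shift[of X "ShO C (-n) Y" n] assms GE_obj[OF Y] by (auto simp: weight_le_iff)
  then show "perp C (ShO C n X) Y" using GE_obj[OF Y] by simp
qed (use assms in \<open>auto simp: weight_le_iff\<close>)

lemma weight_decomposable_GE: "M \<in> GE C t 1 \<Longrightarrow> weight_decomposable M"
proof -
  assume M: "M \<in> GE C t 1"
  obtain N where N: "zero_object C N" "triangle N M M" using triangle_ident[OF GE_obj[OF M]] by blast
  then have "N \<in> weight_le" using perp_zero GE_obj by (auto simp: weight_le_iff zero_object_def)
  then show ?thesis using N M by (auto simp: weight_decomposable_def)
qed

lemma weight_decomposable_weight_le: "M \<in> weight_le \<Longrightarrow> weight_decomposable M"
proof -
  assume M: "M \<in> weight_le"
  obtain N where N: "zero_object C N" "triangle M M N" using triangle_ident[of M] M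
    by (auto simp: weight_le_iff)
  then show ?thesis using zero_in_GE M by (auto simp: weight_decomposable_def)
qed

text \<open>The central step. Let \<open>A\<close> and \<open>K\<close> have decompositions \<open>(L1, R1)\<close> and \<open>(L2, R2)\<close>. First pull \<open>B\<close> back
  along \<open>L2 \<rightarrow> K\<close> to an extension \<open>F\<close> of \<open>L2\<close> by \<open>A\<close>. Since \<open>L2[-1] \<bottom> R1\<close>, the map \<open>A \<rightarrow> R1\<close>
  extends to \<open>F\<close>, and the fibre \<open>G\<close> of the extension is an extension of \<open>L2\<close> by \<open>L1\<close>. The cone of
  \<open>G \<rightarrow> B\<close> is then an extension of \<open>R2\<close> by \<open>R1\<close>.\<close>

lemma weight_decomposable_extension:
  assumes "triangle A B K" "weight_decomposable A" "weight_decomposable K"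
  shows "weight_decomposable B"
proof -
  obtain L1 R1 where 1: "L1 \<in> weight_le" "R1 \<in> GE C t 1" "triangle L1 A R1" using assms by (auto simp: weight_decomposable_def)
  obtain L2 R2 where 2: "L2 \<in> weight_le" "R2 \<in> GE C t 1" "triangle L2 K R2" using assms by (auto simp: weight_decomposable_def)
  obtain F where F: "triangle F B R2" "triangle A F L2" using octahedron_fibre[OF assms(1) 2(3)] by blast
  obtain a b c where d: "distinguished C A F L2 a b c" using F by (auto simp: triangle_def)
  obtain l r s where d1: "distinguished C L1 A R1 l r s" using 1 by (auto simp: triangle_def)
  have "perp C (ShO C (-1) L2) R1" using weight_le_shift[OF 2(1), of "-1"] 1(2) by (auto simp: weight_le_iff)
  moreover have "r \<cdot> Neg C (ShM C (-1) c) \<in> Hom C (ShO C (-1) L2) R1"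
    using distD[OF d] distD[OF d1] by (simp add: Hom_iff)
  ultimately have "r \<cdot> Neg C (ShM C (-1) c) = Zero C (ShO C (-1) L2) R1" by (rule perpD)
  from extend_along_f[OF d distD(2)[OF d1] this] obtain e where e: "e \<in> Hom C F R1" "e \<cdot> a = r" by blast
  obtain G where G: "triangle G F R1" "triangle L1 G L2" using octahedron_extend[OF d d1 e] by blast
  obtain S where S: "triangle G B S" "triangle R1 S R2" using octahedron_cone[OF G(1) F(1)] by blast
  have "G \<in> weight_le" using weight_le_extension[OF G(2) 1(1) 2(1)] .
  moreover have "S \<in> GE C t 1" using GE_extension[OF S(2) 1(2) 2(2)] .
  ultimately show ?thesis using S(1) by (auto simp: weight_decomposable_def)
qed

text \<open>Only the existence of decompositions has content: the left class is defined by orthogonality, and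
  both classes are orthogonals, hence closed under retracts.\<close>

lemma weight_structure_of_decompositions:
  assumes D: "triangulated_subcategory C D" and G: "GE0 t \<subseteq> D" and dec: "\<And>M. M \<in> D \<Longrightarrow> weight_decomposable M"
  shows "weight_structure (full_subcat C D) \<lparr>LE0 = weight_le \<inter> D, GE0 = GE0 t\<rparr>"
    (is "weight_structure ?E ?w")
proof -
  interpret E: triangulated_category ?E by (rule triangulated_full_subcat[OF D])
  have sh: "ShO C n X \<in> D" if "X \<in> D" for X n
    using D that by (auto simp: triangulated_subcategory_def)
  have DO: "X \<in> Obj C" if "X \<in> D" for X
    using D that by (auto simp: triangulated_subcategory_def)
  have GEw: "GE C ?w 1 = GE C t 1" by (simp add: GE_def)
  have ret: "retract_of_object C X Y \<and> X \<in> D \<and> Y \<in> D" if "retract_of_object ?E X Y" for X Y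
    using that by (auto simp: retract_of_object_def Hom_full_subcat_eq split: if_splits)
  show ?thesis
  proof unfold_locales
    show "LE0 ?w \<subseteq> Obj ?E" "GE0 ?w \<subseteq> Obj ?E" using G DO by auto
    show "retract_closed ?E (LE0 ?w)"
      using perp_retract GE_obj DO by (auto simp: retract_closed_def weight_le_iff dest!: ret)
    show "retract_closed ?E (GE0 ?w)"
      unfolding retract_closed_def
    proof (intro ballI allI impI)
      fix Y X assume Y: "Y \<in> GE0 ?w" "retract_of_object ?E X Y"
      have "X \<in> GE C t 0" unfolding GE_iff_perp
        using ret[OF Y(2)] Y(1) perp_retract[of X Y] t_perp[of Y 0 _ "-1"] LE_obj DO by auto
      then show "X \<in> GE0 ?w" by simp
    qed
    show "LE0 ?w \<subseteq> LE ?E ?w 1"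
    proof
      fix X assume X: "X \<in> LE0 ?w"
      then have "ShO C (-1) X \<in> LE0 ?w" using weight_le_shift[of X "-1"] sh by auto
      moreover have "X = ShO C 1 (ShO C (-1) X)" using X by (simp add: weight_le_iff)
      ultimately show "X \<in> LE ?E ?w 1" by (auto simp: LE_def)
    qed
    show "GE ?E ?w 1 \<subseteq> GE0 ?w" using t_ge_shift by (simp add: GEw)
    show "class_perp ?E (LE0 ?w) (GE ?E ?w 1)"
      using G sh t_ge_shift by (auto simp: class_perp_def GEw weight_le_iff)
    fix M assume "M \<in> Obj ?E"
    then have M: "M \<in> D" by simp
    obtain L R where LR: "L \<in> weight_le" "R \<in> GE C t 1" "triangle L M R" using dec[OF M] by (auto simp: weight_decomposable_def)
    have R: "R \<in> D" using LR(2) t_ge_shift G by auto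
    have L: "L \<in> D" using triangulated_subcategory_two_of_three(2)[OF D LR(3) M R] .
    obtain f g h where "distinguished C L M R f g h" using LR by (auto simp: triangle_def)
    then have "distinguished ?E L M R f g h" using L M R distinguished_full_subcat[OF sh] by auto
    then show "\<exists>L\<in>LE0 ?w. \<exists>R\<in>GE ?E ?w 1. \<exists>f g h. distinguished ?E L M R f g h"
      using LR L by (intro bexI[of _ L] bexI[of _ R] exI) (auto simp: GEw)
  qed
qed

end

context weight_structure
begin

text \<open>If \<open>X \<bottom> w\<^bsub>\<ge>1\<^esub>\<close>, then in a decomposition \<open>L \<rightarrow> X \<rightarrow> R\<close> the second map is zero, so \<open>X\<close> is a retract
  of \<open>L\<close>. Hence a weight structure is determined by its right class, which is what makes an arbitrary
  weight structure with the prescribed right class extend.\<close>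

lemma LE0_eq_left_perp: "LE0 w = left_perp C (GE C w 1)"
proof
  show "LE0 w \<subseteq> left_perp C (GE C w 1)"
    using w_le_obj w_orthogonal by (auto simp: left_perp_def class_perp_def)
  show "left_perp C (GE C w 1) \<subseteq> LE0 w"
  proof
    fix X assume X: "X \<in> left_perp C (GE C w 1)"
    then have XO: "X \<in> Obj C" by (simp add: left_perp_def)
    obtain L R f g h where L: "L \<in> LE0 w" "R \<in> GE C w 1" and d: "distinguished C L X R f g h"
      using w_decomposition[OF XO] by blast
    have "g = Zero C X R" using X L(2) distD[OF d] by (auto simp: left_perp_def intro: perpD)
    then have "g \<cdot> Ident C X = Zero C X R" using XO distD(6)[OF d] by simp
    from lift_along_f[OF d ident_in[OF XO] this] obtain v where v: "v \<in> Hom C X L" "Ident C X = f \<cdot> v" by blast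
    have "retract_of_object C X L"
      unfolding retract_of_object_def using v distD[OF d] by (metis (no_types, lifting))
    then show "X \<in> LE0 w" using w_le_retract_closed L(1) by (auto simp: retract_closed_def)
  qed
qed

end

context t_structure
begin

lemma extend_weight_structure:
  assumes w: "weight_structure (full_subcat C D) v" "GE0 v = GE0 t"
    and D: "triangulated_subcategory C D" "GE0 t \<subseteq> D" and dec: "\<And>M. M \<in> Obj C \<Longrightarrow> weight_decomposable M"
  shows "\<exists>w. weight_structure C w \<and> extends_weight_structure C D w v \<and> left_adjacent w t"
proof -
  interpret v: weight_structure "full_subcat C D" v by (rule w)
  have DO: "X \<in> Obj C" if "X \<in> D" for X
    using D that by (auto simp: triangulated_subcategory_def)
  obtain N where N: "zero_object C N" using zero_object_exists by blast
  have "triangulated_subcategory C (Obj C)"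
    unfolding triangulated_subcategory_def iso_closed_def isomorphic_def is_iso_def
    using N by (auto dest: distD simp: zero_object_def)
  from weight_structure_of_decompositions[OF this t_ge_obj dec]
  have W: "weight_structure C \<lparr>LE0 = weight_le \<inter> Obj C, GE0 = GE0 t\<rparr>" (is "weight_structure C ?w")
    by (simp add: full_subcat_all)
  have G1: "GE C v 1 = GE C t 1" using w(2) by (simp add: GE_def)
  have "Y \<in> D" if "Y \<in> GE C t 1" for Y using that t_ge_shift D by auto
  then have "LE0 v = weight_le \<inter> D" 
    unfolding v.LE0_eq_left_perp LE_GE_full_subcat G1 using DO
    by (auto simp: left_perp_def)
  then have "LE0 v = LE0 ?w \<inter> D" using DO by auto
  moreover have "GE0 v = GE0 ?w \<inter> D" using w(2) D by auto
  ultimately have "extends_weight_structure C D ?w v" using W w(1) by (simp add: extends_weight_structure_def)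
  then show ?thesis using W by (intro exI[of _ ?w]) (simp add: left_adjacent_def)
qed

text \<open>Truncate \<open>M\<close> so low that the remaining part in \<open>C\<^bsub>t\<le>1-n\<^esub>\<close> is left orthogonal to
  \<open>C\<^bsub>t\<ge>1\<^esub>\<close>; the rest of \<open>M\<close> is bounded below.\<close>

lemma weight_decomposable_of_orthogonal_bound:
  assumes "class_perp C (LE0 t) (GE C t n)" "\<And>X. X \<in> bounded_below_objects C t \<Longrightarrow> weight_decomposable X" "M \<in> Obj C"
  shows "weight_decomposable M"
proof -
  obtain T R where T: "T \<in> GE C t (2 - n)" "R \<in> LE C t (1 - n)" "triangle T M R"
    using t_decomposition_at[of M "2 - n"] assms(3) by auto
  have "R \<in> weight_le" unfolding weight_le_iff
  proof (intro conjI ballI)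
    fix Y assume Y: "Y \<in> GE C t 1"
    have "ShO C (n - 1) R \<in> LE0 t" "ShO C (n - 1) Y \<in> GE C t n"
      using T Y LE_obj GE_obj by (auto simp: LE_iff GE_shift_iff)
    then have "perp C (ShO C (n - 1) R) (ShO C (n - 1) Y)" using assms(1) by (auto simp: class_perp_def)
    then show "perp C R Y" using perp_shift LE_obj[OF T(2)] GE_obj[OF Y] by blast
  qed (use LE_obj[OF T(2)] in simp)
  then have "weight_decomposable R" by (rule weight_decomposable_weight_le)
  moreover have "weight_decomposable T" using T(1) assms(2) by (auto simp: bounded_below_eq)
  ultimately show ?thesis using weight_decomposable_extension[OF T(3)] by blast
qed

lemma minus_orthogonal_of_same_GE0: "GE0 w = GE0 t \<Longrightarrow> minus_orthogonal C t w"
  using LE_iff_perp[of _ "-1"] by (auto simp: minus_orthogonal_def right_perp_def)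

end

section \<open>Fully faithful essentially surjective functors\<close>

lemma equivalent_categories_of_fully_faithful:
  fixes A :: "('o, 'm, 'z) cat_data_scheme" and B :: "('p, 'n, 'y) cat_data_scheme"
  assumes "category A" "category B" and F: "is_functor A B FO FM"
    and ff: "\<And>X Y. X \<in> Obj A \<Longrightarrow> Y \<in> Obj A \<Longrightarrow> bij_betw FM (Hom A X Y) (Hom B (FO X) (FO Y))"
    and es: "\<And>Z. Z \<in> Obj B \<Longrightarrow> \<exists>X \<in> Obj A. isomorphic B (FO X) Z"
  shows "equivalent_categories A B"
proof -
  interpret A: category A by fact
  interpret B: category B by fact
  have FO: "FO X \<in> Obj B" if "X \<in> Obj A" for X using F that by (auto simp: is_functor_def)
  have FI: "FM (Ident A X) = Ident B (FO X)" if "X \<in> Obj A" for X using F that by (auto simp: is_functor_def)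
  have FH: "FM f \<in> Hom B (FO X) (FO Y)" if "f \<in> Hom A X Y" for f X Y
    using F[unfolded is_functor_def, THEN conjunct2, THEN conjunct1] that by simp
  have FC: "FM (g \<cdot>\<^bsub>A\<^esub> f) = FM g \<cdot>\<^bsub>B\<^esub> FM f" if "f \<in> Hom A X Y" "g \<in> Hom A Y Z" for f g X Y Z
    using F[unfolded is_functor_def, THEN conjunct2, THEN conjunct2] that by simp
  have faithful: "f = g" if "f \<in> Hom A X Y" "g \<in> Hom A X Y" "FM f = FM g" for f g X Y
  proof -
    have "inj_on FM (Hom A X Y)" using ff A.HomD(4,5)[OF that(1)] by (auto simp: bij_betw_def)
    then show ?thesis using that by (auto dest: inj_onD)
  qed
  have full: "\<exists>f \<in> Hom A X Y. FM f = g" if "X \<in> Obj A" "Y \<in> Obj A" "g \<in> Hom B (FO X) (FO Y)" for X Y g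
    using ff[OF that(1,2)] that(3) unfolding bij_betw_def by (metis imageE)
  have "\<forall>Z \<in> Obj B. \<exists>X e d. X \<in> Obj A \<and> e \<in> Hom B (FO X) Z \<and> d \<in> Hom B Z (FO X) \<and>
      d \<cdot>\<^bsub>B\<^esub> e = Ident B (FO X) \<and> e \<cdot>\<^bsub>B\<^esub> d = Ident B Z"
  proof
    fix Z assume "Z \<in> Obj B"
    then obtain X where X: "X \<in> Obj A" "isomorphic B (FO X) Z" using es by metis
    from X(2) obtain e where "is_iso B (FO X) Z e" unfolding isomorphic_def by (rule exE)
    then have e: "e \<in> Hom B (FO X) Z" and
      "\<exists>d \<in> Hom B Z (FO X). d \<cdot>\<^bsub>B\<^esub> e = Ident B (FO X) \<and> e \<cdot>\<^bsub>B\<^esub> d = Ident B Z"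
      by (simp_all only: is_iso_def)
    then obtain d where d: "d \<in> Hom B Z (FO X)" "d \<cdot>\<^bsub>B\<^esub> e = Ident B (FO X)" "e \<cdot>\<^bsub>B\<^esub> d = Ident B Z"
      by (elim bexE conjE)
    show "\<exists>X e d. X \<in> Obj A \<and> e \<in> Hom B (FO X) Z \<and> d \<in> Hom B Z (FO X) \<and>
      d \<cdot>\<^bsub>B\<^esub> e = Ident B (FO X) \<and> e \<cdot>\<^bsub>B\<^esub> d = Ident B Z"
      by (intro exI[of _ X] exI[of _ e] exI[of _ d] conjI X e d)
  qed
  then obtain GO \<epsilon> \<delta> where G: "\<And>Z. Z \<in> Obj B \<Longrightarrow> GO Z \<in> Obj A"
    and e: "\<And>Z. Z \<in> Obj B \<Longrightarrow> \<epsilon> Z \<in> Hom B (FO (GO Z)) Z"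
    and d: "\<And>Z. Z \<in> Obj B \<Longrightarrow> \<delta> Z \<in> Hom B Z (FO (GO Z))"
    and de: "\<And>Z. Z \<in> Obj B \<Longrightarrow> \<delta> Z \<cdot>\<^bsub>B\<^esub> \<epsilon> Z = Ident B (FO (GO Z))"
    and ed: "\<And>Z. Z \<in> Obj B \<Longrightarrow> \<epsilon> Z \<cdot>\<^bsub>B\<^esub> \<delta> Z = Ident B Z"
    by metis
  have e_arr: "\<epsilon> Z \<in> Arr B" "Dom B (\<epsilon> Z) = FO (GO Z)" "Cod B (\<epsilon> Z) = Z"
    and d_arr: "\<delta> Z \<in> Arr B" "Cod B (\<delta> Z) = FO (GO Z)" "Dom B (\<delta> Z) = Z" if "Z \<in> Obj B" for Z
    using e[OF that] d[OF that] by (simp_all add: Hom_def)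
  have "\<forall>g \<in> Arr B. \<exists>f. f \<in> Hom A (GO (Dom B g)) (GO (Cod B g)) \<and>
      FM f = \<delta> (Cod B g) \<cdot>\<^bsub>B\<^esub> (g \<cdot>\<^bsub>B\<^esub> \<epsilon> (Dom B g))"
  proof
    fix g assume g: "g \<in> Arr B"
    then have O: "Dom B g \<in> Obj B" "Cod B g \<in> Obj B" using B.dom_in B.cod_in by auto
    have "\<delta> (Cod B g) \<cdot>\<^bsub>B\<^esub> (g \<cdot>\<^bsub>B\<^esub> \<epsilon> (Dom B g)) \<in> Hom B (FO (GO (Dom B g))) (FO (GO (Cod B g)))"
      using g O by (simp add: Hom_def e_arr d_arr)
    from full[OF G[OF O(1)] G[OF O(2)] this]
    show "\<exists>f. f \<in> Hom A (GO (Dom B g)) (GO (Cod B g)) \<and>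
      FM f = \<delta> (Cod B g) \<cdot>\<^bsub>B\<^esub> (g \<cdot>\<^bsub>B\<^esub> \<epsilon> (Dom B g))" by blast
  qed
  then obtain GM where GM': "\<And>g. g \<in> Arr B \<Longrightarrow> GM g \<in> Hom A (GO (Dom B g)) (GO (Cod B g))"
    "\<And>g. g \<in> Arr B \<Longrightarrow> FM (GM g) = \<delta> (Cod B g) \<cdot>\<^bsub>B\<^esub> (g \<cdot>\<^bsub>B\<^esub> \<epsilon> (Dom B g))" by metis
  have GM: "GM g \<in> Hom A (GO X) (GO Y)" "FM (GM g) = \<delta> Y \<cdot>\<^bsub>B\<^esub> (g \<cdot>\<^bsub>B\<^esub> \<epsilon> X)" if "g \<in> Hom B X Y" for g X Y
    using GM'[of g] that by (auto simp: Hom_def)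
  have nat_e: "\<epsilon> Y \<cdot>\<^bsub>B\<^esub> FM (GM g) = g \<cdot>\<^bsub>B\<^esub> \<epsilon> X" if g: "g \<in> Hom B X Y" for g X Y
  proof -
    note O = B.HomD[OF g]
    have "\<epsilon> Y \<cdot>\<^bsub>B\<^esub> FM (GM g) = (\<epsilon> Y \<cdot>\<^bsub>B\<^esub> \<delta> Y) \<cdot>\<^bsub>B\<^esub> (g \<cdot>\<^bsub>B\<^esub> \<epsilon> X)"
      unfolding GM(2)[OF g] using O by (simp add: e_arr d_arr B.assoc)
    then show ?thesis unfolding ed[OF O(5)] using O by (simp add: e_arr d_arr)
  qed
  \<comment> \<open>Both sides of the functoriality equation for \<open>GM\<close> are compared after composing with \<open>\<epsilon>\<close>.\<close>
  have e_cancel: "f = g" if "f \<in> Hom B X (FO (GO Y))" "g \<in> Hom B X (FO (GO Y))" "Y \<in> Obj B"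
    "\<epsilon> Y \<cdot>\<^bsub>B\<^esub> f = \<epsilon> Y \<cdot>\<^bsub>B\<^esub> g" for f g X Y
  proof -
    have *: "\<delta> Y \<cdot>\<^bsub>B\<^esub> (\<epsilon> Y \<cdot>\<^bsub>B\<^esub> h) = h" if "h \<in> Hom B X (FO (GO Y))" for h
    proof -
      have "\<delta> Y \<cdot>\<^bsub>B\<^esub> (\<epsilon> Y \<cdot>\<^bsub>B\<^esub> h) = (\<delta> Y \<cdot>\<^bsub>B\<^esub> \<epsilon> Y) \<cdot>\<^bsub>B\<^esub> h"
        using B.HomD[OF that] \<open>Y \<in> Obj B\<close> by (simp add: e_arr d_arr B.assoc)
      then show ?thesis unfolding de[OF \<open>Y \<in> Obj B\<close>] using B.HomD[OF that] by simp
    qed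
    show ?thesis using *[OF that(1)] *[OF that(2)] that(4) by metis
  qed
  have "is_functor B A GO GM"
    unfolding is_functor_def
  proof (intro conjI ballI allI)
    fix X assume X: "X \<in> Obj B"
    then show "GO X \<in> Obj A" by (rule G)
    show "GM (Ident B X) = Ident A (GO X)"
      using GM[OF B.ident_in[OF X]] X G[OF X] de
      by (intro faithful[OF GM(1)[OF B.ident_in[OF X]] A.ident_in[OF G[OF X]]])
        (simp add: FI e_arr)
  next
    show "GM f \<in> Hom A (GO X) (GO Y)" if "f \<in> Hom B X Y" for X Y f using GM that by blast
    fix X Y Z f g assume f: "f \<in> Hom B X Y" and g: "g \<in> Hom B Y Z"
    have gf: "g \<cdot>\<^bsub>B\<^esub> f \<in> Hom B X Z" using B.comp_in f g by blast
    note hf = B.HomD[OF f] and hg = B.HomD[OF g]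
    note kf = B.HomD[OF FH[OF GM(1)[OF f]]] and kg = B.HomD[OF FH[OF GM(1)[OF g]]]
    show "GM (g \<cdot>\<^bsub>B\<^esub> f) = GM g \<cdot>\<^bsub>A\<^esub> GM f"
    proof (rule faithful[OF GM(1)[OF gf] A.comp_in[OF GM(1)[OF f] GM(1)[OF g]]])
      show "FM (GM (g \<cdot>\<^bsub>B\<^esub> f)) = FM (GM g \<cdot>\<^bsub>A\<^esub> GM f)"
      proof (rule e_cancel[OF FH[OF GM(1)[OF gf]] _ hg(5)])
        show "FM (GM g \<cdot>\<^bsub>A\<^esub> GM f) \<in> Hom B (FO (GO X)) (FO (GO Z))"
          using FH A.comp_in GM(1) f g by blast
        have "\<epsilon> Z \<cdot>\<^bsub>B\<^esub> FM (GM g \<cdot>\<^bsub>A\<^esub> GM f) = (\<epsilon> Z \<cdot>\<^bsub>B\<^esub> FM (GM g)) \<cdot>\<^bsub>B\<^esub> FM (GM f)"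
          using FC[OF GM(1)[OF f] GM(1)[OF g]] kf kg hg by (simp add: B.assoc e_arr)
        also have "\<dots> = g \<cdot>\<^bsub>B\<^esub> (\<epsilon> Y \<cdot>\<^bsub>B\<^esub> FM (GM f))"
          unfolding nat_e[OF g] using kf hg by (simp add: B.assoc e_arr)
        also have "\<dots> = (g \<cdot>\<^bsub>B\<^esub> f) \<cdot>\<^bsub>B\<^esub> \<epsilon> X"
          unfolding nat_e[OF f] using hf hg by (simp add: B.assoc e_arr)
        also have "\<dots> = \<epsilon> Z \<cdot>\<^bsub>B\<^esub> FM (GM (g \<cdot>\<^bsub>B\<^esub> f))" by (rule nat_e[OF gf, symmetric])
        finally show "\<epsilon> Z \<cdot>\<^bsub>B\<^esub> FM (GM (g \<cdot>\<^bsub>B\<^esub> f)) = \<epsilon> Z \<cdot>\<^bsub>B\<^esub> FM (GM g \<cdot>\<^bsub>A\<^esub> GM f)" ..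
      qed
    qed
  qed
  moreover have "is_iso B (FO (GO Z)) Z (\<epsilon> Z)" if "Z \<in> Obj B" for Z
    unfolding is_iso_def using e[OF that] d[OF that] de[OF that] ed[OF that] FO G that by auto
  then have "naturally_isomorphic B B (FO \<circ> GO) (FM \<circ> GM) id id"
    unfolding naturally_isomorphic_def using nat_e by (intro exI[of _ \<epsilon>]) auto
  moreover have "naturally_isomorphic A A (GO \<circ> FO) (GM \<circ> FM) id id"
  proof -
    have ex: "\<exists>h. h \<in> Hom A (GO (FO X)) X \<and> FM h = \<epsilon> (FO X)" if "X \<in> Obj A" for X
      using full[OF G[OF FO[OF that]] that e[OF FO[OF that]]] by blast
    then obtain \<eta> where \<eta>: "\<And>X. X \<in> Obj A \<Longrightarrow> \<eta> X \<in> Hom A (GO (FO X)) X"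
      "\<And>X. X \<in> Obj A \<Longrightarrow> FM (\<eta> X) = \<epsilon> (FO X)" by metis
    show ?thesis
      unfolding naturally_isomorphic_def
    proof (intro exI[of _ \<eta>] conjI ballI allI)
      fix X assume X: "X \<in> Obj A"
      obtain k where k: "k \<in> Hom A X (GO (FO X))" "FM k = \<delta> (FO X)"
        using full[OF X G[OF FO[OF X]] d[OF FO[OF X]]] by blast
      have "k \<cdot>\<^bsub>A\<^esub> \<eta> X = Ident A (GO (FO X))"
        by (rule faithful[OF A.comp_in[OF \<eta>(1)[OF X] k(1)] A.ident_in[OF G[OF FO[OF X]]]])
          (simp add: FC[OF \<eta>(1)[OF X] k(1)] \<eta>(2)[OF X] k(2) de FO X FI G)
      moreover have "\<eta> X \<cdot>\<^bsub>A\<^esub> k = Ident A X"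
        by (rule faithful[OF A.comp_in[OF k(1) \<eta>(1)[OF X]] A.ident_in[OF X]])
          (simp add: FC[OF k(1) \<eta>(1)[OF X]] \<eta>(2)[OF X] k(2) ed FO X FI G)
      ultimately show "is_iso A ((GO \<circ> FO) X) (id X) (\<eta> X)"
        using \<eta>(1)[OF X] k(1) X G FO by (auto simp: is_iso_def)
    next
      fix X Y f assume f: "f \<in> Hom A X Y"
      note O = A.HomD[OF f]
      have 1: "\<eta> Y \<cdot>\<^bsub>A\<^esub> GM (FM f) \<in> Hom A (GO (FO X)) Y"
        using A.comp_in[OF GM(1)[OF FH[OF f]] \<eta>(1)[OF O(5)]] .
      have 2: "f \<cdot>\<^bsub>A\<^esub> \<eta> X \<in> Hom A (GO (FO X)) Y" using A.comp_in[OF \<eta>(1)[OF O(4)] f] .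
      have "FM (\<eta> Y \<cdot>\<^bsub>A\<^esub> GM (FM f)) = \<epsilon> (FO Y) \<cdot>\<^bsub>B\<^esub> FM (GM (FM f))"
        using FC[OF GM(1)[OF FH[OF f]] \<eta>(1)[OF O(5)]] \<eta>(2)[OF O(5)] by simp
      also have "\<dots> = FM (f \<cdot>\<^bsub>A\<^esub> \<eta> X)"
        using nat_e[OF FH[OF f]] FC[OF \<eta>(1)[OF O(4)] f] \<eta>(2)[OF O(4)] by simp
      finally show "\<eta> Y \<cdot>\<^bsub>A\<^esub> (GM \<circ> FM) f = id f \<cdot>\<^bsub>A\<^esub> \<eta> X" using faithful[OF 1 2] by simp
    qed
  qed
  ultimately show ?thesis using F by (auto simp: equivalent_categories_def)
qed

context t_structure
begin

section \<open>Truncation and the objects P_t\<close>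

text \<open>The property that \<open>y\<close> exhibits \<open>Y\<^sub>0\<close> as \<open>t\<^bsub>\<le>0\<^esub> Y\<close>. It is kept as a relation because the truncations
  that occur come from different choices.\<close>

definition le_trunc :: "'o \<Rightarrow> 'o \<Rightarrow> 'm \<Rightarrow> bool"
  where "le_trunc Y Y\<^sub>0 y \<longleftrightarrow> Y\<^sub>0 \<in> LE0 t \<and> (\<exists>T \<in> GE C t 1. \<exists>u h. distinguished C T Y Y\<^sub>0 u y h)"

lemma le_truncD:
  assumes "le_trunc Y Y\<^sub>0 y"
  shows "y \<in> Hom C Y Y\<^sub>0" "Y \<in> Obj C" "Y\<^sub>0 \<in> Obj C" "Y\<^sub>0 \<in> LE0 t"
  using assms by (auto simp: le_trunc_def dest: distD)

lemma le_trunc_exists: "Y \<in> Obj C \<Longrightarrow> \<exists>Y\<^sub>0 y. le_trunc Y Y\<^sub>0 y"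
  using t_decomposition_at[of Y 1] by (simp add: le_trunc_def triangle_def) blast

lemma le_trunc_factor:
  assumes "le_trunc Y Y\<^sub>0 y" "W \<in> LE0 t" "f \<in> Hom C Y W"
  shows "\<exists>v \<in> Hom C Y\<^sub>0 W. f = v \<cdot> y"
proof -
  obtain T u h where T: "T \<in> GE C t 1" and d: "distinguished C T Y Y\<^sub>0 u y h"
    using assms by (auto simp: le_trunc_def)
  have "perp C T W" using t_perp[OF T, of W 0] assms by simp
  then have "f \<cdot> u = Zero C T W" using assms(3) distD[OF d] by (auto intro!: perpD simp: Hom_iff)
  from extend_along_g[OF d assms(3) this] show ?thesis .
qed

lemma le_trunc_cancel_zero:
  assumes "le_trunc Y Y\<^sub>0 y" "W \<in> LE0 t" "v \<in> Hom C Y\<^sub>0 W" "v \<cdot> y = Zero C Y W"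
  shows "v = Zero C Y\<^sub>0 W"
proof -
  obtain T u h where T: "T \<in> GE C t 1" and d: "distinguished C T Y Y\<^sub>0 u y h"
    using assms by (auto simp: le_trunc_def)
  have "ShO C 1 T \<in> GE C t 2" using GE_obj[OF T] T by (simp add: GE_shift_iff)
  then have p: "perp C (ShO C 1 T) W" using t_perp[of _ 2 W 0] assms by simp
  from extend_along_h[OF d assms(3,4)] obtain k where k: "k \<in> Hom C (ShO C 1 T) W" "v = k \<cdot> h" by blast
  have "v = Zero C (ShO C 1 T) W \<cdot> h" using perpD[OF p k(1)] k(2) by simp
  then show ?thesis using distD[OF d] HomD(5)[OF assms(3)] by (simp add: Hom_iff)
qed

lemma le_trunc_cancel:
  assumes "le_trunc Y Y\<^sub>0 y" "W \<in> LE0 t" "v \<in> Hom C Y\<^sub>0 W" "v' \<in> Hom C Y\<^sub>0 W" "v \<cdot> y = v' \<cdot> y"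
  shows "v = v'"
proof -
  note h = le_truncD(1-3)[OF assms(1), unfolded Hom_iff] assms(3,4)[unfolded Hom_iff]
    HomD(5)[OF assms(3)]
  have "sub v v' \<cdot> y = Zero C Y W" using assms(5) h by (simp add: sub_comp)
  from le_trunc_cancel_zero[OF assms(1,2) _ this] have "sub v v' = Zero C Y\<^sub>0 W"
    using h by (simp add: Hom_iff)
  then show ?thesis using h by (subst (asm) sub_zero_iff) simp_all
qed

lemma le_trunc_GE0:
  assumes "le_trunc Y Y\<^sub>0 y" "Y \<in> GE0 t" shows "Y\<^sub>0 \<in> GE0 t"
proof -
  obtain T u h where T: "T \<in> GE C t 1" and d: "distinguished C T Y Y\<^sub>0 u y h"
    using assms by (auto simp: le_trunc_def)
  have "T \<in> GE C t (0 - 1)" using GE_antimono[of "-1" 1] T by auto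
  from GE_cone[OF triangleI[OF d] this] show ?thesis using assms(2) by simp
qed

lemma le_trunc_unique:
  assumes "le_trunc Y U u" "le_trunc Y V v"
  shows "\<exists>c \<in> Hom C U V. \<exists>c' \<in> Hom C V U. c \<cdot> u = v \<and> c' \<cdot> v = u \<and> c' \<cdot> c = Ident C U \<and> c \<cdot> c' = Ident C V"
proof -
  note U = le_truncD[OF assms(1)] and V = le_truncD[OF assms(2)]
  obtain c where c: "c \<in> Hom C U V" "v = c \<cdot> u" using le_trunc_factor[OF assms(1) V(4,1)] by blast
  obtain c' where c': "c' \<in> Hom C V U" "u = c' \<cdot> v" using le_trunc_factor[OF assms(2) U(4,1)] by blast
  note h = c(1)[unfolded Hom_iff] c'(1)[unfolded Hom_iff] U(1,3)[unfolded Hom_iff] V(1,3)[unfolded Hom_iff]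
  have "(c' \<cdot> c) \<cdot> u = c' \<cdot> v" unfolding c(2) using h by (simp add: assoc)
  also have "\<dots> = Ident C U \<cdot> u" unfolding c'(2)[symmetric] using h by simp
  finally have 1: "c' \<cdot> c = Ident C U"
    by (rule le_trunc_cancel[OF assms(1) U(4) comp_in[OF c(1) c'(1)] ident_in[OF U(3)]])
  have "(c \<cdot> c') \<cdot> v = c \<cdot> u" unfolding c'(2) using h by (simp add: assoc)
  also have "\<dots> = Ident C V \<cdot> v" unfolding c(2)[symmetric] using h by simp
  finally have 2: "c \<cdot> c' = Ident C V"
    by (rule le_trunc_cancel[OF assms(2) V(4) comp_in[OF c'(1) c(1)] ident_in[OF V(3)]])
  show ?thesis using c c' 1 2 by metis
qed

text \<open>One choice of truncations, made functorial by the universal property.\<close>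

definition trunc :: "'o \<Rightarrow> 'o"
  where "trunc Y = (SOME U. \<exists>u. le_trunc Y U u)"

definition trunc_unit :: "'o \<Rightarrow> 'm"
  where "trunc_unit Y = (SOME u. le_trunc Y (trunc Y) u)"

definition trunc_map :: "'m \<Rightarrow> 'm"
  where "trunc_map f = (SOME v. v \<in> Hom C (trunc (Dom C f)) (trunc (Cod C f)) \<and>
    v \<cdot> trunc_unit (Dom C f) = trunc_unit (Cod C f) \<cdot> f)"

lemma le_trunc_trunc: "Y \<in> Obj C \<Longrightarrow> le_trunc Y (trunc Y) (trunc_unit Y)"
  unfolding trunc_unit_def trunc_def by (rule someI_ex, rule someI_ex, rule le_trunc_exists)

lemmas truncD = le_truncD[OF le_trunc_trunc]

lemma trunc_map:
  assumes "f \<in> Hom C X Y"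
  shows "trunc_map f \<in> Hom C (trunc X) (trunc Y)" "trunc_map f \<cdot> trunc_unit X = trunc_unit Y \<cdot> f"
proof -
  note O = HomD(4,5)[OF assms]
  have "\<exists>v. v \<in> Hom C (trunc X) (trunc Y) \<and> v \<cdot> trunc_unit X = trunc_unit Y \<cdot> f"
    using le_trunc_factor[OF le_trunc_trunc[OF O(1)] truncD(4)[OF O(2)] comp_in[OF assms truncD(1)[OF O(2)]]]
    by metis
  from someI_ex[OF this] assms
  show "trunc_map f \<in> Hom C (trunc X) (trunc Y)" "trunc_map f \<cdot> trunc_unit X = trunc_unit Y \<cdot> f"
    by (simp_all add: trunc_map_def Hom_iff)
qed

lemma trunc_map_unique:
  assumes "f \<in> Hom C X Y" "v \<in> Hom C (trunc X) (trunc Y)" "v \<cdot> trunc_unit X = trunc_unit Y \<cdot> f"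
  shows "trunc_map f = v"
  using le_trunc_cancel[OF le_trunc_trunc[OF HomD(4)[OF assms(1)]] truncD(4)[OF HomD(5)[OF assms(1)]]
      trunc_map(1)[OF assms(1)] assms(2)] trunc_map(2)[OF assms(1)] assms(3) by simp

lemma trunc_map_comp:
  assumes f: "f \<in> Hom C X Y" and g: "g \<in> Hom C Y Z"
  shows "trunc_map (g \<cdot> f) = trunc_map g \<cdot> trunc_map f"
proof (rule trunc_map_unique[OF comp_in[OF f g] comp_in[OF trunc_map(1)[OF f] trunc_map(1)[OF g]]])
  note O = HomD(4,5)[OF f] HomD(5)[OF g]
  note h = trunc_map(1)[OF f, unfolded Hom_iff] trunc_map(1)[OF g, unfolded Hom_iff]
    f[unfolded Hom_iff] g[unfolded Hom_iff] O[THEN truncD(1), unfolded Hom_iff]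
  have "(trunc_map g \<cdot> trunc_map f) \<cdot> trunc_unit X = trunc_map g \<cdot> (trunc_map f \<cdot> trunc_unit X)"
    using h by (simp add: assoc)
  also have "\<dots> = (trunc_map g \<cdot> trunc_unit Y) \<cdot> f" unfolding trunc_map(2)[OF f] using h by (simp add: assoc)
  finally show "(trunc_map g \<cdot> trunc_map f) \<cdot> trunc_unit X = trunc_unit Z \<cdot> (g \<cdot> f)"
    unfolding trunc_map(2)[OF g] using h by (simp add: assoc)
qed

lemma trunc_map_add:
  assumes f: "f \<in> Hom C X Y" and g: "g \<in> Hom C X Y"
  shows "trunc_map (Add C f g) = Add C (trunc_map f) (trunc_map g)"
proof (rule trunc_map_unique)
  note h = trunc_map(1)[OF f, unfolded Hom_iff] trunc_map(1)[OF g, unfolded Hom_iff]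
    f[unfolded Hom_iff] g[unfolded Hom_iff] HomD(4,5)[OF f, THEN truncD(1), unfolded Hom_iff]
  show "Add C f g \<in> Hom C X Y" "Add C (trunc_map f) (trunc_map g) \<in> Hom C (trunc X) (trunc Y)"
    using h by (simp_all add: Hom_iff)
  show "Add C (trunc_map f) (trunc_map g) \<cdot> trunc_unit X = trunc_unit Y \<cdot> Add C f g"
    using h trunc_map(2)[OF f] trunc_map(2)[OF g] by (simp add: add_comp comp_add)
qed

lemma trunc_map_ident: "X \<in> Obj C \<Longrightarrow> trunc_map (Ident C X) = Ident C (trunc X)"
  using trunc_map_unique[OF ident_in ident_in] truncD(1,3)[of X] by (simp add: Hom_iff)

lemma trunc_map_zero: "X \<in> Obj C \<Longrightarrow> Y \<in> Obj C \<Longrightarrow> trunc_map (Zero C X Y) = Zero C (trunc X) (trunc Y)"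
  using trunc_map_unique[OF zero_in zero_in] truncD(1,3)[of X] truncD(1,3)[of Y] by (simp add: Hom_iff)

lemma P_t_iff: "P \<in> P_t C t \<longleftrightarrow> P \<in> GE0 t \<and> P \<in> weight_le"
  using GE_iff_perp[of P 0] by (auto simp: P_t_def left_perp_def)

lemma P_t_obj: "P \<in> P_t C t \<Longrightarrow> P \<in> Obj C"
  by (simp add: P_t_def left_perp_def)

lemma P_t_perp: "P \<in> P_t C t \<Longrightarrow> Y \<in> GE C t 1 \<Longrightarrow> perp C P Y"
  by (simp add: P_t_def left_perp_def)

text \<open>The fibre \<open>T\<close> of a truncation is in \<open>C\<^bsub>t\<ge>1\<^esub>\<close>, and so is \<open>T[1]\<close>. Hence an object of \<open>P\<^sub>t\<close> sees no
  difference between \<open>Y\<close> and its truncation. Together with the universal property of truncations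
  this makes truncation fully faithful on \<open>P\<^sub>t\<close>.\<close>

lemma P_t_lift:
  assumes "le_trunc Y Y\<^sub>0 y" "P \<in> P_t C t" "f \<in> Hom C P Y\<^sub>0"
  shows "\<exists>v \<in> Hom C P Y. f = y \<cdot> v"
proof -
  obtain T u h where T: "T \<in> GE C t 1" and d: "distinguished C T Y Y\<^sub>0 u y h"
    using assms by (auto simp: le_trunc_def)
  have "ShO C 1 T \<in> GE C t 1" using GE_obj[OF T] T GE_antimono[of 0 1] by (auto simp: GE_shift_iff)
  then have "h \<cdot> f = Zero C P (ShO C 1 T)" using P_t_perp[OF assms(2)] assms(3) distD[OF d]
    by (auto intro!: perpD simp: Hom_iff)
  from lift_along_g[OF d assms(3) this] show ?thesis .
qed

lemma P_t_cancel:
  assumes "le_trunc Y Y\<^sub>0 y" "P \<in> P_t C t" "v \<in> Hom C P Y" "v' \<in> Hom C P Y" "y \<cdot> v = y \<cdot> v'"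
  shows "v = v'"
proof -
  obtain T u h where T: "T \<in> GE C t 1" and d: "distinguished C T Y Y\<^sub>0 u y h"
    using assms by (auto simp: le_trunc_def)
  note hh = distD[OF d, unfolded Hom_iff] assms(3,4)[unfolded Hom_iff] P_t_obj[OF assms(2)]
  have s: "sub v v' \<in> Hom C P Y" using hh by (simp add: Hom_iff)
  have "y \<cdot> sub v v' = Zero C P Y\<^sub>0" using assms(5) hh by (simp add: comp_sub)
  from lift_along_f[OF d s this] obtain k where k: "k \<in> Hom C P T" "sub v v' = u \<cdot> k" by blast
  have "sub v v' = Zero C P Y" using perpD[OF P_t_perp[OF assms(2) T] k(1)] k(2) hh by simp
  then show ?thesis using hh by (subst (asm) sub_zero_iff) simp_all
qed

lemma le_trunc_iso:
  assumes "le_trunc L H q" "is_iso C L M l"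
  shows "\<exists>p. le_trunc M H p"
proof -
  obtain T u h where T: "T \<in> GE C t 1" and d: "distinguished C T L H u q h"
    using assms by (auto simp: le_trunc_def)
  obtain m where m: "m \<in> Hom C M L" "m \<cdot> l = Ident C L" "l \<cdot> m = Ident C M"
    and l: "l \<in> Hom C L M" and O: "L \<in> Obj C" "M \<in> Obj C" using assms(2) by (auto simp: is_iso_def)
  note hh = distD[OF d, unfolded Hom_iff] m(1)[unfolded Hom_iff] l[unfolded Hom_iff] O
  have "(q \<cdot> m) \<cdot> l = q" using hh m(2) by (simp add: assoc)
  then have "distinguished C T M H (l \<cdot> u) (q \<cdot> m) h"
    using hh by (intro TR1_iso[OF d _ _ _ is_iso_ident assms(2) is_iso_ident]) (simp_all add: Hom_iff)
  then show ?thesis using T assms(1) by (auto simp: le_trunc_def)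
qed

text \<open>On \<open>C\<^bsub>t\<ge>0\<^esub>\<close> the functor \<open>H\<^sub>0\<close> is \<open>t\<^bsub>\<le>0\<^esub>\<close>: the first truncation \<open>L\<^sub>t M \<rightarrow> M\<close> has a cone in both
  \<open>C\<^bsub>t\<ge>0\<^esub>\<close> and \<open>C\<^bsub>t\<le>-1\<^esub>\<close>, so it is an isomorphism.\<close>

lemma H0_trunc:
  assumes "M \<in> GE0 t" shows "\<exists>p. le_trunc M (H0_t C t M) p"
proof -
  have MO: "M \<in> Obj C" using assms t_ge_obj by auto
  define L where "L = L_t C t M"
  have "\<exists>L. L \<in> GE0 t \<and> (\<exists>R \<in> LE C t (-1). \<exists>f g h. distinguished C L M R f g h)"
    using t_decomposition[OF MO] by blast
  from someI_ex[OF this] obtain R l g h where L: "L \<in> GE0 t" "R \<in> LE C t (-1)" "distinguished C L M R l g h"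
    unfolding L_def L_t_def by blast
  have "R \<in> GE C t 0" using L(1) assms GE_antimono[of "-1" 0] by (intro GE_cone[OF triangleI[OF L(3)]]) auto
  then have "zero_object C R" using GE_LE_zero[of R 0 "-1"] L(2) by simp
  from iso_of_zero_cone[OF L(3) this] have l: "is_iso C L M l" .
  have LO: "L \<in> Obj C" using distD[OF L(3)] by simp
  define R' where "R' = R_t C t (ShO C (-1) L)"
  have "\<exists>R. R \<in> LE C t (-1) \<and> (\<exists>L' \<in> GE0 t. \<exists>f g h. distinguished C L' (ShO C (-1) L) R f g h)"
    using t_decomposition[OF sh_obj[OF LO]] by blast
  from someI_ex[OF this] obtain L' where L': "R' \<in> LE C t (-1)" "L' \<in> GE0 t" "triangle L' (ShO C (-1) L) R'"
    unfolding R'_def R_t_def triangle_def by blast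
  have "triangle (ShO C 1 L') L (ShO C 1 R')" using triangle_shift[OF L'(3), of 1] LO by simp
  moreover have "ShO C 1 L' \<in> GE C t 1" using L'(2) by (auto simp: GE_def)
  moreover have "ShO C 1 R' \<in> LE0 t" using L'(1) by (simp add: LE_iff)
  ultimately obtain q where "le_trunc L (ShO C 1 R') q" unfolding triangle_def le_trunc_def by blast
  moreover have "H0_t C t M = ShO C 1 R'"
    by (simp add: H0_t_def trunc_ge0_def trunc_le0_def R'_def L_def)
  ultimately show ?thesis using le_trunc_iso[OF _ l] by simp
qed

section \<open>Epimorphisms and projectives of the heart\<close>

abbreviation heart :: "('o, 'm, 'z) tri_data_scheme" where "heart \<equiv> pair_heart C t"

lemma heart_simps [simp]:
  "Obj heart = LE0 t \<inter> GE0 t"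
  "Comp heart = Comp C" "Ident heart = Ident C"
  "Dom heart = Dom C" "Cod heart = Cod C"
  using t_le_obj by (auto simp: pair_heart_def)

lemma Hom_heart [simp]:
  "X \<in> LE0 t \<Longrightarrow> X \<in> GE0 t \<Longrightarrow> Y \<in> LE0 t \<Longrightarrow> Y \<in> GE0 t \<Longrightarrow> Hom heart X Y = Hom C X Y"
  by (simp add: pair_heart_def)

lemma Hom_heartD:
  assumes "f \<in> Hom heart X Y"
  shows "f \<in> Hom C X Y" "X \<in> LE0 t" "X \<in> GE0 t" "Y \<in> LE0 t" "Y \<in> GE0 t"
  using assms by (auto simp: pair_heart_def Hom_full_subcat_eq split: if_splits)

lemma category_heart: "category heart"
  unfolding pair_heart_def by (rule category_full_subcat)

lemma is_iso_heart: "is_iso heart X Y f \<longleftrightarrow>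
  X \<in> LE0 t \<and> X \<in> GE0 t \<and> Y \<in> LE0 t \<and> Y \<in> GE0 t \<and> is_iso C X Y f"
  unfolding pair_heart_def is_iso_full_subcat by auto

text \<open>Epimorphisms of the heart can be cancelled against maps to the larger class \<open>C\<^bsub>t\<le>0\<^esub>\<close>: such a map
  factors through \<open>t\<^bsub>\<ge>0\<^esub> W\<close>, which lies in the heart. This replaces arguments about cokernels in the
  heart.\<close>

lemma epi_heart_cancel_zero:
  assumes "epimorphism heart e" "e \<in> Hom heart X Y"
    "W \<in> LE0 t" "f \<in> Hom C Y W" "f \<cdot> e = Zero C X W"
  shows "f = Zero C Y W"
proof -
  note e = Hom_heartD[OF assms(2)]
  have WO: "W \<in> Obj C" using assms(3) t_le_obj by auto
  obtain T R l r s where T: "T \<in> GE C t 0" "R \<in> LE C t (-1)" and d: "distinguished C T W R l r s"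
    using t_decomposition_at[OF WO, of 0] by (auto simp: triangle_def)
  have RO: "R \<in> Obj C" using T LE_obj by auto
  have "R \<in> LE C t (0 + 1)" using T LE_mono[of "-1" 1] by auto
  then have TL: "T \<in> LE0 t" using LE_fibre[OF triangleI[OF d], of 0] assms(3) by simp
  have "perp C Y R" using t_perp[of Y 0 R "-1"] e T by simp
  then have "r \<cdot> f = Zero C Y R" using distD[OF d] assms(4) by (auto intro!: perpD simp: Hom_iff)
  from lift_along_f[OF d assms(4) this] obtain f' where f': "f' \<in> Hom C Y T" "f = l \<cdot> f'" by blast
  note hh = distD[OF d, unfolded Hom_iff] f'(1)[unfolded Hom_iff] e(1)[unfolded Hom_iff] HomD(4,5)[OF e(1)]
  have "f' \<cdot> e \<in> Hom C X T" using hh by (simp add: Hom_iff)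
  moreover have "l \<cdot> (f' \<cdot> e) = Zero C X W" using assms(5) hh unfolding f'(2) by (simp add: assoc)
  ultimately obtain k where k: "k \<in> Hom C X (ShO C (-1) R)" "f' \<cdot> e = Neg C (ShM C (-1) s) \<cdot> k"
    using lift_along_connecting[OF d] by blast
  have "perp C X (ShO C (-1) R)"
    using t_perp[of X 0 "ShO C (-1) R" "-2"] e T RO by (simp add: LE_shift_iff)
  then have "f' \<cdot> e = Zero C Y T \<cdot> e" using perpD[OF _ k(1)] k(2) hh by simp
  moreover have "Zero C Y T \<in> Hom C Y T" using hh by (simp add: zero_in)
  moreover have "\<forall>Z. \<forall>f \<in> Hom heart Y Z. \<forall>g \<in> Hom heart Y Z.
      f \<cdot> e = g \<cdot> e \<longrightarrow> f = g"
    using assms(1) hh by (simp add: epimorphism_def)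
  moreover have "Hom heart Y T = Hom C Y T" using e T(1) TL by simp
  ultimately have "f' = Zero C Y T" using f'(1) by metis
  then show ?thesis using f'(2) hh by simp
qed

text \<open>Any \<open>w : K \<rightarrow> W\<close> with \<open>W \<in> C\<^bsub>t\<le>0\<^esub>\<close> vanishes on \<open>Y\<close> because \<open>e\<close> is epimorphic for such targets; so
  it factors through \<open>X[1]\<close>, which is orthogonal to \<open>W\<close>.\<close>

lemma cone_GE1:
  assumes "distinguished C X Y K e k h" "X \<in> GE0 t" "Y \<in> GE0 t"
    and epi: "\<And>W v. W \<in> LE0 t \<Longrightarrow> v \<in> Hom C Y W \<Longrightarrow> v \<cdot> e = Zero C X W \<Longrightarrow> v = Zero C Y W"
  shows "K \<in> GE C t 1"
proof -
  note d = distD[OF assms(1)]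
  have "perp C K W" if W: "W \<in> LE0 t" for W
  proof (subst perp_iff)
    show WO: "W \<in> Obj C" using W t_le_obj by auto
    show "\<forall>w\<in>Hom C K W. w = Zero C K W"
    proof
      fix w assume w: "w \<in> Hom C K W"
      have "(w \<cdot> k) \<cdot> e = w \<cdot> (k \<cdot> e)" using w d by (simp add: Hom_iff assoc)
      then have "(w \<cdot> k) \<cdot> e = Zero C X W"
        unfolding dist_comp_zero[OF assms(1)] using w d by (simp add: Hom_iff)
      moreover have "w \<cdot> k \<in> Hom C Y W" using w d by (simp add: Hom_iff)
      ultimately have "w \<cdot> k = Zero C Y W" using epi[OF W] by blast
      from extend_along_h[OF assms(1) w this] obtain v where v: "v \<in> Hom C (ShO C 1 X) W" "w = v \<cdot> h" by blast
      have "ShO C 1 X \<in> GE C t 1" using assms(2) by (auto simp: GE_def)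
      then have "perp C (ShO C 1 X) W" using t_perp[of _ 1 W 0] W by simp
      then show "w = Zero C K W" using perpD[OF _ v(1)] v(2) d WO by (simp add: Hom_iff)
    qed
  qed (rule d)
  then show ?thesis using d by (simp add: GE_iff_perp)
qed

text \<open>A map \<open>P \<rightarrow> B\<close> lifts along an epimorphism \<open>A \<rightarrow> B\<close> of the heart since the obstruction lies in the
  cone, an object of \<open>C\<^bsub>t\<ge>1\<^esub>\<close>; maps from \<open>P\<close> to the heart are maps from its truncation.\<close>

lemma P_t_projective:
  assumes "P \<in> P_t C t" "le_trunc P P\<^sub>0 p"
  shows "projective heart P\<^sub>0"
  unfolding projective_def
proof (intro conjI allI ballI impI)
  show P0: "P\<^sub>0 \<in> Obj heart"
    using le_trunc_GE0[OF assms(2)] assms(1) le_truncD[OF assms(2)] by (simp add: P_t_iff)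
  fix A B e f
  assume e: "e \<in> Hom heart A B" and epi: "epimorphism heart e"
    and f: "f \<in> Hom heart P\<^sub>0 B"
  note eD = Hom_heartD[OF e] and fD = Hom_heartD[OF f]
  obtain K k h where d: "distinguished C A B K e k h" using TR1_cone[OF eD(1)] by blast
  have K: "K \<in> GE C t 1" by (rule cone_GE1[OF d eD(3,5) epi_heart_cancel_zero[OF epi e]])
  note hh = distD[OF d, unfolded Hom_iff] fD(1)[unfolded Hom_iff] le_truncD(1-3)[OF assms(2), unfolded Hom_iff]
  have "f \<cdot> p \<in> Hom C P B" using hh by (simp add: Hom_iff)
  moreover have "k \<cdot> (f \<cdot> p) = Zero C P K"
    using hh by (intro perpD[OF P_t_perp[OF assms(1) K]]) (simp add: Hom_iff)
  ultimately obtain g0 where g0: "g0 \<in> Hom C P A" "f \<cdot> p = e \<cdot> g0" using lift_along_f[OF d] by blast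
  obtain g where g: "g \<in> Hom C P\<^sub>0 A" "g0 = g \<cdot> p" using le_trunc_factor[OF assms(2) eD(2) g0(1)] by blast
  have eq: "f \<cdot> p = (e \<cdot> g) \<cdot> p" using g0(2) g hh by (simp add: Hom_iff assoc)
  have "e \<cdot> g \<in> Hom C P\<^sub>0 B" using hh g(1) by (simp add: Hom_iff)
  from le_trunc_cancel[OF assms(2) eD(4) fD(1) this eq] have "f = e \<cdot> g" .
  then show "\<exists>g\<in>Hom heart P\<^sub>0 A. e \<cdot>\<^bsub>heart\<^esub> g = f"
    using g(1) eD fD by auto
qed

definition enough_lifted_projectives :: bool where
  "enough_lifted_projectives \<longleftrightarrow> (\<forall>P. projective heart P \<longrightarrow>
        (\<exists>P' \<in> P_t C t. \<exists>e \<in> Hom heart (H0_t C t P') P. epimorphism heart e))"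

text \<open>Compose \<open>H\<^sub>0 P \<rightarrow> Q \<rightarrow> H\<^sub>0 N\<close>, two epimorphisms of the heart, and lift the composite to
  \<open>P \<rightarrow> N\<close>.\<close>

lemma P_t_cover:
  assumes "enough_projectives heart" "enough_lifted_projectives" "N \<in> GE0 t"
  shows "\<exists>P \<in> P_t C t. \<exists>K \<in> GE C t 1. triangle P N K"
proof -
  obtain N0 n where n: "le_trunc N N0 n" using le_trunc_exists assms(3) t_ge_obj by blast
  have N0: "N0 \<in> LE0 t" "N0 \<in> GE0 t" using le_truncD[OF n] le_trunc_GE0[OF n assms(3)] by auto
  obtain Q e where Q: "projective heart Q" "e \<in> Hom heart Q N0" "epimorphism heart e"
    using assms(1) N0 unfolding enough_projectives_def heart_simps by blast
  obtain P e' where P: "P \<in> P_t C t" "e' \<in> Hom heart (H0_t C t P) Q" "epimorphism heart e'"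
    using assms(2) Q(1) unfolding enough_lifted_projectives_def by blast
  have PG: "P \<in> GE0 t" using P(1) by (simp add: P_t_iff)
  obtain p where p: "le_trunc P (H0_t C t P) p" using H0_trunc[OF PG] by blast
  note hh = Hom_heartD(1)[OF Q(2), unfolded Hom_iff] Hom_heartD(1)[OF P(2), unfolded Hom_iff]
    le_truncD(1-3)[OF p, unfolded Hom_iff] le_truncD(1-3)[OF n, unfolded Hom_iff]
    HomD(4,5)[OF Hom_heartD(1)[OF Q(2)]]
  have "e \<cdot> (e' \<cdot> p) \<in> Hom C P N0" using hh by (simp add: Hom_iff)
  from P_t_lift[OF n P(1) this] obtain q where q: "q \<in> Hom C P N" "e \<cdot> (e' \<cdot> p) = n \<cdot> q" by blast
  obtain K k h where d: "distinguished C P N K q k h" using TR1_cone[OF q(1)] by blast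
  have "K \<in> GE C t 1"
  proof (rule cone_GE1[OF d PG assms(3)])
    fix W v assume W: "W \<in> LE0 t" and v: "v \<in> Hom C N W" "v \<cdot> q = Zero C P W"
    have WO: "W \<in> Obj C" using W t_le_obj by auto
    obtain v0 where v0: "v0 \<in> Hom C N0 W" "v = v0 \<cdot> n" using le_trunc_factor[OF n W v(1)] by blast
    note hh = hh v0(1)[unfolded Hom_iff] q(1)[unfolded Hom_iff]
    have "((v0 \<cdot> e) \<cdot> e') \<cdot> p = v0 \<cdot> (e \<cdot> (e' \<cdot> p))" using hh by (simp add: assoc)
    also have "\<dots> = v \<cdot> q" unfolding q(2) v0(2) using hh by (simp add: assoc)
    finally have "((v0 \<cdot> e) \<cdot> e') \<cdot> p = Zero C P W" using v(2) by simp
    then have "(v0 \<cdot> e) \<cdot> e' = Zero C (H0_t C t P) W"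
      using hh by (intro le_trunc_cancel_zero[OF p W]) (simp_all add: Hom_iff)
    then have "v0 \<cdot> e = Zero C Q W"
      using hh by (intro epi_heart_cancel_zero[OF P(3,2) W]) (simp_all add: Hom_iff)
    then have "v0 = Zero C N0 W"
      by (intro epi_heart_cancel_zero[OF Q(3,2) W v0(1)])
    then show "v = Zero C N W" using v0(2) hh WO by simp
  qed
  then show ?thesis using P(1) triangleI[OF d] by blast
qed

text \<open>Descending induction on the bound: the cone of a cover of \<open>M[1-i] \<in> C\<^bsub>t\<ge>0\<^esub>\<close> is one step closer to
  \<open>C\<^bsub>t\<ge>1\<^esub>\<close>, where objects are their own \<open>R\<close>.\<close>

lemma weight_decomposable_bounded_below:
  assumes "enough_projectives heart" "enough_lifted_projectives" "M \<in> GE C t i"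
  shows "weight_decomposable M"
proof -
  have *: "\<forall>M \<in> GE C t i. weight_decomposable M" if "i \<le> 1" for i
    using that
  proof (induction i rule: int_le_induct)
    case base show ?case using weight_decomposable_GE by blast
  next
    case (step i)
    show ?case
    proof
      fix M assume M: "M \<in> GE C t (i - 1)"
      have MO: "M \<in> Obj C" using GE_obj[OF M] .
      have "ShO C (1 - i) M \<in> GE0 t" using M by (simp add: GE_iff)
      from P_t_cover[OF assms(1,2) this] obtain P K where P: "P \<in> P_t C t" "K \<in> GE C t 1"
        "triangle P (ShO C (1 - i) M) K" by blast
      have t: "triangle (ShO C (i - 1) P) M (ShO C (i - 1) K)"
        using triangle_shift[OF P(3), of "i - 1"] MO by simp
      have "ShO C (i - 1) P \<in> weight_le" using weight_le_shift[of P "i - 1"] P(1) step(1) by (simp add: P_t_iff)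
      moreover have "ShO C (i - 1) K \<in> GE C t i"
        using P(2) GE_obj[OF P(2)] GE_antimono[of 1 1] by (simp add: GE_shift_iff)
      ultimately show "weight_decomposable M" using weight_decomposable_extension[OF t] weight_decomposable_weight_le step(2) by blast
    qed
  qed
  show ?thesis
  proof (cases "i \<le> 1")
    case True then show ?thesis using * assms(3) by blast
  next
    case False then show ?thesis using weight_decomposable_GE GE_antimono[of 1 i] assms(3) by auto
  qed
qed

section \<open>The heart of the weight structure\<close>

lemma heart_equivalence:
  assumes D: "triangulated_subcategory C D" "GE0 t \<subseteq> D"
    and w: "LE0 w = weight_le \<inter> D" "GE0 w = GE0 t"
    and es: "\<And>P. projective heart P \<Longrightarrow> \<exists>X \<in> P_t C t. isomorphic heart (H0_t C t X) P"
  shows "equivalent_categories (pair_heart (full_subcat C D) w) (projective_subcat heart)"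
proof -
  let ?A = "pair_heart (full_subcat C D) w" and ?B = "projective_subcat heart"
  have DO: "X \<in> Obj C" if "X \<in> D" for X
    using D that by (auto simp: triangulated_subcategory_def)
  interpret E: category "full_subcat C D" by (rule category_full_subcat)
  have catA: "category ?A" unfolding pair_heart_def by (rule E.category_full_subcat)
  have catB: "category ?B" unfolding projective_subcat_def
    by (rule category.category_full_subcat[OF category_heart])
  have objA: "Obj ?A = P_t C t" using D w DO by (auto simp: pair_heart_def P_t_iff)
  have objB: "Obj ?B = {P. projective heart P}"
    by (auto simp: projective_subcat_def projective_def)
  have HA: "f \<in> Hom ?A X Y \<longleftrightarrow> X \<in> P_t C t \<and> Y \<in> P_t C t \<and> f \<in> Hom C X Y" for f X Y
    using D w by (auto simp: pair_heart_def Hom_full_subcat_eq P_t_iff split: if_splits)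
  have HB: "f \<in> Hom ?B X Y \<longleftrightarrow> projective heart X \<and> projective heart Y \<and> f \<in> Hom C X Y" for f X Y
    by (auto simp: projective_subcat_def Hom_full_subcat_eq projective_def split: if_splits dest: Hom_heartD)
  have [simp]: "Comp ?A = Comp C" "Ident ?A = Ident C" by (simp_all add: pair_heart_def)
  have [simp]: "Comp ?B = Comp C" "Ident ?B = Ident C" by (simp_all add: projective_subcat_def)
  note x = le_trunc_trunc[OF P_t_obj] and xD = truncD[OF P_t_obj]
  have pr: "projective heart (trunc X)" if "X \<in> P_t C t" for X
    by (rule P_t_projective[OF that x[OF that]])
  show ?thesis
  proof (rule equivalent_categories_of_fully_faithful[OF catA catB, of trunc trunc_map])
    show "is_functor ?A ?B trunc trunc_map"
      unfolding is_functor_def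
    proof (intro conjI ballI allI)
      fix X assume "X \<in> Obj ?A"
      then have X: "X \<in> P_t C t" by (simp add: objA)
      show "trunc X \<in> Obj ?B" using pr[OF X] by (simp add: objB)
      show "trunc_map (Ident ?A X) = Ident ?B (trunc X)" using trunc_map_ident[OF P_t_obj[OF X]] by simp
    next
      show "trunc_map f \<in> Hom ?B (trunc X) (trunc Y)" if "f \<in> Hom ?A X Y" for X Y f
        using trunc_map(1) pr that by (simp add: HA HB)
      show "trunc_map (g \<cdot>\<^bsub>?A\<^esub> f) = trunc_map g \<cdot>\<^bsub>?B\<^esub> trunc_map f"
        if "f \<in> Hom ?A X Y" "g \<in> Hom ?A Y Z" for X Y Z f g
        using that trunc_map_comp[of f X Y g Z] by (simp add: HA)
    qed
  next
    fix X Y assume "X \<in> Obj ?A" "Y \<in> Obj ?A"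
    then have P: "X \<in> P_t C t" "Y \<in> P_t C t" by (simp_all add: objA)
    have A: "Hom ?A X Y = Hom C X Y" using P by (auto simp: HA)
    have B: "Hom ?B (trunc X) (trunc Y) = Hom C (trunc X) (trunc Y)" using P pr by (auto simp: HB)
    show "bij_betw trunc_map (Hom ?A X Y) (Hom ?B (trunc X) (trunc Y))"
      unfolding A B bij_betw_def
    proof (intro conjI inj_onI subset_antisym subsetI)
      fix f g assume fg: "f \<in> Hom C X Y" "g \<in> Hom C X Y" "trunc_map f = trunc_map g"
      then have "trunc_unit Y \<cdot> f = trunc_unit Y \<cdot> g" using trunc_map(2) by metis
      then show "f = g" using P_t_cancel[OF x[OF P(2)] P(1)] fg by blast
    next
      fix v assume "v \<in> trunc_map ` Hom C X Y"
      then show "v \<in> Hom C (trunc X) (trunc Y)" using trunc_map(1) by blast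
    next
      fix v assume v: "v \<in> Hom C (trunc X) (trunc Y)"
      then have "v \<cdot> trunc_unit X \<in> Hom C X (trunc Y)" using xD[OF P(1)] by (simp add: Hom_iff)
      from P_t_lift[OF x[OF P(2)] P(1) this] obtain f where f: "f \<in> Hom C X Y" "v \<cdot> trunc_unit X = trunc_unit Y \<cdot> f" by blast
      then show "v \<in> trunc_map ` Hom C X Y" using trunc_map_unique[OF f(1) v f(2)] by blast
    qed
  next
    fix Z assume "Z \<in> Obj ?B"
    then have Z: "projective heart Z" by (simp add: objB)
    from es[OF this] obtain X h where X: "X \<in> P_t C t" "is_iso heart (H0_t C t X) Z h"
      by (auto simp: isomorphic_def)
    have "X \<in> GE0 t" using X(1) by (simp add: P_t_iff)
    from H0_trunc[OF this] obtain p where p: "le_trunc X (H0_t C t X) p" by blast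
    have "isomorphic C (trunc X) (H0_t C t X)"
      using le_trunc_unique[OF x[OF X(1)] p] xD[OF X(1)] le_truncD[OF p] unfolding isomorphic_def is_iso_def by metis
    moreover have "isomorphic C (H0_t C t X) Z" using X(2) by (auto simp: is_iso_heart isomorphic_def)
    ultimately have "isomorphic C (trunc X) Z" by (rule isomorphic_trans)
    then have "isomorphic ?B (trunc X) Z"
      using pr[OF X(1)] Z unfolding isomorphic_def projective_subcat_def
        category.is_iso_full_subcat[OF category_heart] by (auto simp: is_iso_heart projective_def)
    then show "\<exists>X\<in>Obj ?A. isomorphic ?B (trunc X) Z" using X(1) by (auto simp: objA)
  qed
qed

text \<open>A projective \<open>P\<close> splits off some \<open>H\<^sub>0 X\<close>. Full faithfulness lifts the idempotent \<open>s e\<close> of \<open>H\<^sub>0 X\<close> to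
  an idempotent \<open>\<epsilon>\<close> of \<open>X\<close>, and an object splitting \<open>\<epsilon>\<close> is the required lift of \<open>P\<close>.\<close>

lemma lift_projective:
  assumes split: "\<And>X e. e \<in> Hom C X X \<Longrightarrow> e \<cdot> e = e \<Longrightarrow>
      \<exists>Y. \<exists>a \<in> Hom C X Y. \<exists>b \<in> Hom C Y X. a \<cdot> b = Ident C Y \<and> b \<cdot> a = e"
    and lifted: enough_lifted_projectives and P: "projective heart P"
  shows "\<exists>Y \<in> P_t C t. isomorphic heart (H0_t C t Y) P"
proof -
  obtain X e where X: "X \<in> P_t C t" "e \<in> Hom heart (H0_t C t X) P" "epimorphism heart e"
    using lifted P unfolding enough_lifted_projectives_def by blast
  let ?H = "H0_t C t X"
  note e = Hom_heartD[OF X(2)]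
  obtain p where p: "le_trunc X ?H p" using H0_trunc X(1) by (auto simp: P_t_iff)
  have PO: "P \<in> Obj C" using HomD[OF e(1)] by simp
  have "Ident C P \<in> Hom heart P P" using e ident_in[OF PO] by simp
  then have "\<exists>s \<in> Hom heart P ?H. e \<cdot>\<^bsub>heart\<^esub> s = Ident C P"
    using P X(2,3) unfolding projective_def by blast
  then obtain s where s: "s \<in> Hom C P ?H" "e \<cdot> s = Ident C P" by (auto dest: Hom_heartD)
  note hh = e(1)[unfolded Hom_iff] s(1)[unfolded Hom_iff] PO le_truncD(1-3)[OF p, unfolded Hom_iff]
  have "s \<cdot> (e \<cdot> p) \<in> Hom C X ?H" using hh by (simp add: Hom_iff)
  from P_t_lift[OF p X(1) this] obtain \<epsilon> where \<epsilon>: "\<epsilon> \<in> Hom C X X" "s \<cdot> (e \<cdot> p) = p \<cdot> \<epsilon>" by blast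
  note hh = hh \<epsilon>(1)[unfolded Hom_iff]
  have ese: "e \<cdot> (s \<cdot> (e \<cdot> p)) = e \<cdot> p"
  proof -
    have "e \<cdot> (s \<cdot> (e \<cdot> p)) = (e \<cdot> s) \<cdot> (e \<cdot> p)" using hh by (simp add: assoc)
    then show ?thesis unfolding s(2) using hh by simp
  qed
  have ep: "(e \<cdot> p) \<cdot> \<epsilon> = e \<cdot> p"
  proof -
    have "(e \<cdot> p) \<cdot> \<epsilon> = e \<cdot> (p \<cdot> \<epsilon>)" using hh by (simp add: assoc)
    then show ?thesis unfolding \<epsilon>(2)[symmetric] ese .
  qed
  have "p \<cdot> (\<epsilon> \<cdot> \<epsilon>) = (s \<cdot> (e \<cdot> p)) \<cdot> \<epsilon>" unfolding \<epsilon>(2) using hh by (simp add: assoc)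
  also have "\<dots> = s \<cdot> ((e \<cdot> p) \<cdot> \<epsilon>)" using hh by (simp add: assoc)
  also have "\<dots> = p \<cdot> \<epsilon>" unfolding ep \<epsilon>(2) ..
  finally have "\<epsilon> \<cdot> \<epsilon> = \<epsilon>"
    using P_t_cancel[OF p X(1), of "\<epsilon> \<cdot> \<epsilon>" \<epsilon>] hh by (simp add: Hom_iff)
  from split[OF \<epsilon>(1) this] obtain Y a b where ab: "a \<in> Hom C X Y" "b \<in> Hom C Y X"
    "a \<cdot> b = Ident C Y" "b \<cdot> a = \<epsilon>" by blast
  have "retract_of_object C Y X" unfolding retract_of_object_def
    using ab HomD(4,5)[OF ab(1)] by blast
  then have Y: "Y \<in> P_t C t"
    using perp_retract[of Y X] X(1) LE_obj GE_obj unfolding P_t_def left_perp_def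
    by (auto simp: retract_of_object_def)
  obtain y where y: "le_trunc Y (H0_t C t Y) y" using H0_trunc Y by (auto simp: P_t_iff)
  let ?K = "H0_t C t Y"
  note hh = hh ab(1,2)[unfolded Hom_iff] le_truncD(1-3)[OF y, unfolded Hom_iff]
  have "(e \<cdot> p) \<cdot> b \<in> Hom C Y P" using hh by (simp add: Hom_iff)
  from le_trunc_factor[OF y e(4) this] obtain c where c: "c \<in> Hom C ?K P" "(e \<cdot> p) \<cdot> b = c \<cdot> y" by blast
  have "y \<cdot> a \<in> Hom C X ?K" using hh by (simp add: Hom_iff)
  from le_trunc_factor[OF p le_truncD(4)[OF y] this] obtain q where q: "q \<in> Hom C ?H ?K" "y \<cdot> a = q \<cdot> p" by blast
  define d where "d = q \<cdot> s"
  note hh = hh c(1)[unfolded Hom_iff] q(1)[unfolded Hom_iff]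
  have d: "d \<in> Hom C P ?K" unfolding d_def using hh by (simp add: Hom_iff)
  have dep: "d \<cdot> (e \<cdot> p) = y \<cdot> a"
  proof -
    have "d \<cdot> (e \<cdot> p) = q \<cdot> (s \<cdot> (e \<cdot> p))" unfolding d_def using hh by (simp add: assoc)
    also have "\<dots> = (q \<cdot> p) \<cdot> \<epsilon>" unfolding \<epsilon>(2) using hh by (simp add: assoc)
    also have "\<dots> = y \<cdot> ((a \<cdot> b) \<cdot> a)" unfolding q(2)[symmetric] ab(4)[symmetric] using hh by (simp add: assoc)
    finally show ?thesis unfolding ab(3) using hh by simp
  qed
  note hh = hh d[unfolded Hom_iff]
  have "((c \<cdot> d) \<cdot> e) \<cdot> p = c \<cdot> (d \<cdot> (e \<cdot> p))" using hh by (simp add: assoc)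
  also have "\<dots> = (c \<cdot> y) \<cdot> a" unfolding dep using hh by (simp add: assoc)
  also have "\<dots> = (e \<cdot> p) \<cdot> (b \<cdot> a)" unfolding c(2)[symmetric] using hh by (simp add: assoc)
  also have "\<dots> = e \<cdot> p" unfolding ab(4) ep ..
  finally have eq: "((c \<cdot> d) \<cdot> e) \<cdot> p = e \<cdot> p" .
  have "(c \<cdot> d) \<cdot> e = e"
    by (rule le_trunc_cancel[OF p e(4) _ _ eq]) (use hh in \<open>simp_all add: Hom_iff\<close>)
  then have "((c \<cdot> d) \<cdot> e) \<cdot> s = e \<cdot> s" by simp
  then have "(c \<cdot> d) \<cdot> (e \<cdot> s) = e \<cdot> s" using hh by (simp add: assoc)
  then have cd: "c \<cdot> d = Ident C P" unfolding s(2) using hh by simp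
  have "(d \<cdot> c) \<cdot> y = d \<cdot> ((e \<cdot> p) \<cdot> b)" unfolding c(2) using hh by (simp add: assoc)
  also have "\<dots> = (y \<cdot> a) \<cdot> b" unfolding dep[symmetric] using hh by (simp add: assoc)
  also have "\<dots> = y \<cdot> (a \<cdot> b)" using hh by (simp add: assoc)
  also have "\<dots> = Ident C ?K \<cdot> y" unfolding ab(3) using hh by simp
  finally have eq: "(d \<cdot> c) \<cdot> y = Ident C ?K \<cdot> y" .
  have dc: "d \<cdot> c = Ident C ?K"
    by (rule le_trunc_cancel[OF y le_truncD(4)[OF y] _ _ eq]) (use hh in \<open>simp_all add: Hom_iff\<close>)
  have "is_iso C ?K P c" unfolding is_iso_def using c(1) d cd dc hh by auto
  then have "is_iso heart ?K P c"
    using e(4,5) le_truncD(4)[OF y] le_trunc_GE0[OF y] Y by (simp add: is_iso_heart P_t_iff)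
  then show ?thesis using Y by (auto simp: isomorphic_def)
qed

end

section \<open>Products and coproducts\<close>

context category
begin

lemma is_coproductD:
  assumes "is_coproduct C I X S \<iota>"
  shows "S \<in> Obj C" "i \<in> I \<Longrightarrow> \<iota> i \<in> Hom C (X i) S"
    "Y \<in> Obj C \<Longrightarrow> (\<And>i. i \<in> I \<Longrightarrow> f i \<in> Hom C (X i) Y) \<Longrightarrow> \<exists>g \<in> Hom C S Y. \<forall>i \<in> I. g \<cdot> \<iota> i = f i"
proof -
  show "S \<in> Obj C" "i \<in> I \<Longrightarrow> \<iota> i \<in> Hom C (X i) S" using assms by (simp_all add: is_coproduct_def)
  assume "Y \<in> Obj C" "\<And>i. i \<in> I \<Longrightarrow> f i \<in> Hom C (X i) Y"
  then have "\<exists>!g. g \<in> Hom C S Y \<and> (\<forall>i \<in> I. g \<cdot> \<iota> i = f i)" using assms by (simp add: is_coproduct_def)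
  then show "\<exists>g \<in> Hom C S Y. \<forall>i \<in> I. g \<cdot> \<iota> i = f i" by blast
qed

lemma coproduct_eqI:
  assumes "is_coproduct C I X S \<iota>" "g \<in> Hom C S Y" "g' \<in> Hom C S Y"
    "\<And>i. i \<in> I \<Longrightarrow> g \<cdot> \<iota> i = g' \<cdot> \<iota> i"
  shows "g = g'"
proof -
  have "g' \<cdot> \<iota> i \<in> Hom C (X i) Y" if "i \<in> I" for i
    using comp_in[OF is_coproductD(2)[OF assms(1) that] assms(3)] .
  moreover have "Y \<in> Obj C" using HomD(5)[OF assms(2)] .
  ultimately have "\<exists>!h. h \<in> Hom C S Y \<and> (\<forall>i \<in> I. h \<cdot> \<iota> i = g' \<cdot> \<iota> i)"
    using assms(1) by (simp add: is_coproduct_def)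
  then show ?thesis using assms(2-4) by (metis (no_types, lifting))
qed

lemma is_coproductI:
  assumes "S \<in> Obj C" "\<And>i. i \<in> I \<Longrightarrow> \<iota> i \<in> Hom C (X i) S"
    "\<And>Y f. Y \<in> Obj C \<Longrightarrow> (\<And>i. i \<in> I \<Longrightarrow> f i \<in> Hom C (X i) Y) \<Longrightarrow> \<exists>g \<in> Hom C S Y. \<forall>i \<in> I. g \<cdot> \<iota> i = f i"
    "\<And>Y g g'. Y \<in> Obj C \<Longrightarrow> g \<in> Hom C S Y \<Longrightarrow> g' \<in> Hom C S Y \<Longrightarrow> (\<And>i. i \<in> I \<Longrightarrow> g \<cdot> \<iota> i = g' \<cdot> \<iota> i) \<Longrightarrow> g = g'"
  shows "is_coproduct C I X S \<iota>"
  unfolding is_coproduct_def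
proof (intro conjI ballI allI impI)
  fix Y f assume Y: "Y \<in> Obj C" and f: "\<forall>i\<in>I. f i \<in> Hom C (X i) Y"
  then obtain g where g: "g \<in> Hom C S Y" "\<forall>i \<in> I. g \<cdot> \<iota> i = f i" using assms(3)[of Y f] by blast
  show "\<exists>!g. g \<in> Hom C S Y \<and> (\<forall>i\<in>I. g \<cdot> \<iota> i = f i)"
  proof (rule ex1I[of _ g])
    fix g' assume g': "g' \<in> Hom C S Y \<and> (\<forall>i\<in>I. g' \<cdot> \<iota> i = f i)"
    show "g' = g" by (rule assms(4)[OF Y]) (use g g' in auto)
  qed (use g in auto)
qed (use assms in auto)

lemma is_productD:
  assumes "is_product C I X S \<pi>"
  shows "S \<in> Obj C" "i \<in> I \<Longrightarrow> \<pi> i \<in> Hom C S (X i)"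
    "Y \<in> Obj C \<Longrightarrow> (\<And>i. i \<in> I \<Longrightarrow> f i \<in> Hom C Y (X i)) \<Longrightarrow> \<exists>g \<in> Hom C Y S. \<forall>i \<in> I. \<pi> i \<cdot> g = f i"
proof -
  show "S \<in> Obj C" "i \<in> I \<Longrightarrow> \<pi> i \<in> Hom C S (X i)" using assms by (simp_all add: is_product_def)
  assume "Y \<in> Obj C" "\<And>i. i \<in> I \<Longrightarrow> f i \<in> Hom C Y (X i)"
  then have "\<exists>!g. g \<in> Hom C Y S \<and> (\<forall>i \<in> I. \<pi> i \<cdot> g = f i)" using assms by (simp add: is_product_def)
  then show "\<exists>g \<in> Hom C Y S. \<forall>i \<in> I. \<pi> i \<cdot> g = f i" by blast
qed

lemma product_eqI:
  assumes "is_product C I X S \<pi>" "g \<in> Hom C Y S" "g' \<in> Hom C Y S"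
    "\<And>i. i \<in> I \<Longrightarrow> \<pi> i \<cdot> g = \<pi> i \<cdot> g'"
  shows "g = g'"
proof -
  have "\<pi> i \<cdot> g' \<in> Hom C Y (X i)" if "i \<in> I" for i
    using comp_in[OF assms(3) is_productD(2)[OF assms(1) that]] .
  moreover have "Y \<in> Obj C" using HomD(4)[OF assms(2)] .
  ultimately have "\<exists>!h. h \<in> Hom C Y S \<and> (\<forall>i \<in> I. \<pi> i \<cdot> h = \<pi> i \<cdot> g')"
    using assms(1) by (simp add: is_product_def)
  then show ?thesis using assms(2-4) by (metis (no_types, lifting))
qed

lemma is_productI:
  assumes "S \<in> Obj C" "\<And>i. i \<in> I \<Longrightarrow> \<pi> i \<in> Hom C S (X i)"
    "\<And>Y f. Y \<in> Obj C \<Longrightarrow> (\<And>i. i \<in> I \<Longrightarrow> f i \<in> Hom C Y (X i)) \<Longrightarrow> \<exists>g \<in> Hom C Y S. \<forall>i \<in> I. \<pi> i \<cdot> g = f i"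
    "\<And>Y g g'. Y \<in> Obj C \<Longrightarrow> g \<in> Hom C Y S \<Longrightarrow> g' \<in> Hom C Y S \<Longrightarrow> (\<And>i. i \<in> I \<Longrightarrow> \<pi> i \<cdot> g = \<pi> i \<cdot> g') \<Longrightarrow> g = g'"
  shows "is_product C I X S \<pi>"
  unfolding is_product_def
proof (intro conjI ballI allI impI)
  fix Y f assume Y: "Y \<in> Obj C" and f: "\<forall>i\<in>I. f i \<in> Hom C Y (X i)"
  then obtain g where g: "g \<in> Hom C Y S" "\<forall>i \<in> I. \<pi> i \<cdot> g = f i" using assms(3)[of Y f] by blast
  show "\<exists>!g. g \<in> Hom C Y S \<and> (\<forall>i\<in>I. \<pi> i \<cdot> g = f i)"
  proof (rule ex1I[of _ g])
    fix g' assume g': "g' \<in> Hom C Y S \<and> (\<forall>i\<in>I. \<pi> i \<cdot> g' = f i)"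
    show "g' = g" by (rule assms(4)[OF Y]) (use g g' in auto)
  qed (use g in auto)
qed (use assms in auto)

lemma coproducts_isomorphic:
  assumes "is_coproduct C I X S \<iota>" "is_coproduct C I X S' \<iota>'"
  shows "isomorphic C S S'"
proof -
  note D = is_coproductD[OF assms(1)] and D' = is_coproductD[OF assms(2)]
  obtain g where g: "g \<in> Hom C S S'" "\<And>i. i \<in> I \<Longrightarrow> g \<cdot> \<iota> i = \<iota>' i"
    using D(3)[OF D'(1) D'(2)] by blast
  obtain g' where g': "g' \<in> Hom C S' S" "\<And>i. i \<in> I \<Longrightarrow> g' \<cdot> \<iota>' i = \<iota> i"
    using D'(3)[OF D(1) D(2)] by blast
  have "g' \<cdot> g = Ident C S"
  proof (rule coproduct_eqI[OF assms(1) comp_in[OF g(1) g'(1)] ident_in[OF D(1)]])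
    fix i assume i: "i \<in> I"
    show "(g' \<cdot> g) \<cdot> \<iota> i = Ident C S \<cdot> \<iota> i"
      using comp_assoc[OF D(2)[OF i] g(1) g'(1)] g(2)[OF i] g'(2)[OF i] comp_ident_left[OF D(2)[OF i]] by simp
  qed
  moreover have "g \<cdot> g' = Ident C S'"
  proof (rule coproduct_eqI[OF assms(2) comp_in[OF g'(1) g(1)] ident_in[OF D'(1)]])
    fix i assume i: "i \<in> I"
    show "(g \<cdot> g') \<cdot> \<iota>' i = Ident C S' \<cdot> \<iota>' i"
      using comp_assoc[OF D'(2)[OF i] g'(1) g(1)] g(2)[OF i] g'(2)[OF i] comp_ident_left[OF D'(2)[OF i]] by simp
  qed
  ultimately show ?thesis using g(1) g'(1) D(1) D'(1) by (auto simp: isomorphic_def is_iso_def)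
qed

end

context triangulated_category
begin

lemma perp_coproduct:
  assumes "is_coproduct C I X S \<iota>" "\<And>i. i \<in> I \<Longrightarrow> perp C (X i) Y" "Y \<in> Obj C"
  shows "perp C S Y"
proof (subst perp_iff)
  show "\<forall>f\<in>Hom C S Y. f = Zero C S Y"
  proof
    fix f assume f: "f \<in> Hom C S Y"
    show "f = Zero C S Y"
    proof (rule coproduct_eqI[OF assms(1) f zero_in[OF is_coproductD(1)[OF assms(1)] assms(3)]])
      fix i assume i: "i \<in> I"
      note d = is_coproductD(2)[OF assms(1) i]
      show "f \<cdot> \<iota> i = Zero C S Y \<cdot> \<iota> i"
        using perpD[OF assms(2)[OF i] comp_in[OF d f]] d assms(3) by (simp add: Hom_iff)
    qed
  qed
qed (use assms is_coproductD in auto)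

lemma perp_product:
  assumes "is_product C I X S \<pi>" "\<And>i. i \<in> I \<Longrightarrow> perp C Y (X i)" "Y \<in> Obj C"
  shows "perp C Y S"
proof (subst perp_iff)
  show "\<forall>f\<in>Hom C Y S. f = Zero C Y S"
  proof
    fix f assume f: "f \<in> Hom C Y S"
    show "f = Zero C Y S"
    proof (rule product_eqI[OF assms(1) f zero_in[OF assms(3) is_productD(1)[OF assms(1)]]])
      fix i assume i: "i \<in> I"
      note d = is_productD(2)[OF assms(1) i]
      show "\<pi> i \<cdot> f = \<pi> i \<cdot> Zero C Y S"
        using perpD[OF assms(2)[OF i] comp_in[OF f d]] d assms(3) by (simp add: Hom_iff)
    qed
  qed
qed (use assms is_productD in auto)

lemma unshift_in:
  assumes "X \<in> Obj C" "f \<in> Hom C (ShO C n X) Y" shows "ShM C (-n) f \<in> Hom C X (ShO C (-n) Y)"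
  using sh_in[OF assms(2), of "-n"] assms(1) by simp

lemma coproduct_shift:
  assumes "is_coproduct C I X S \<iota>" "\<And>i. i \<in> I \<Longrightarrow> X i \<in> Obj C"
  shows "is_coproduct C I (\<lambda>i. ShO C n (X i)) (ShO C n S) (\<lambda>i. ShM C n (\<iota> i))"
proof (rule is_coproductI)
  note D = is_coproductD[OF assms(1)]
  show "ShO C n S \<in> Obj C" using D(1) by simp
  show "ShM C n (\<iota> i) \<in> Hom C (ShO C n (X i)) (ShO C n S)" if "i \<in> I" for i
    using sh_in[OF D(2)[OF that]] .
  fix Y assume Y: "Y \<in> Obj C"
  show "\<exists>g\<in>Hom C (ShO C n S) Y. \<forall>i\<in>I. g \<cdot> ShM C n (\<iota> i) = f i"
    if f: "\<And>i. i \<in> I \<Longrightarrow> f i \<in> Hom C (ShO C n (X i)) Y" for f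
  proof -
    have "ShM C (-n) (f i) \<in> Hom C (X i) (ShO C (-n) Y)" if "i \<in> I" for i
      using unshift_in[OF assms(2)[OF that] f[OF that]] .
    then obtain g where g: "g \<in> Hom C S (ShO C (-n) Y)" "\<And>i. i \<in> I \<Longrightarrow> g \<cdot> \<iota> i = ShM C (-n) (f i)"
      using D(3)[of "ShO C (-n) Y" "\<lambda>i. ShM C (-n) (f i)"] Y by auto
    have "ShM C n g \<in> Hom C (ShO C n S) Y" using sh_in[OF g(1), of n] Y by simp
    moreover have "ShM C n g \<cdot> ShM C n (\<iota> i) = f i" if i: "i \<in> I" for i
    proof -
      have "ShM C n g \<cdot> ShM C n (\<iota> i) = ShM C n (g \<cdot> \<iota> i)"
        using g(1) D(2)[OF i] by (simp add: Hom_iff sh_comp)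
      then show ?thesis unfolding g(2)[OF i] using f[OF i] by (simp add: Hom_iff)
    qed
    ultimately show ?thesis by blast
  qed
  show "g = g'" if g: "g \<in> Hom C (ShO C n S) Y" "g' \<in> Hom C (ShO C n S) Y"
    and eq: "\<And>i. i \<in> I \<Longrightarrow> g \<cdot> ShM C n (\<iota> i) = g' \<cdot> ShM C n (\<iota> i)" for g g'
  proof -
    have *: "ShM C (-n) h \<cdot> \<iota> i = ShM C (-n) (h \<cdot> ShM C n (\<iota> i))" if "i \<in> I" "h \<in> Hom C (ShO C n S) Y" for i h
      using that(2) D(2)[OF that(1)] by (simp add: Hom_iff sh_comp)
    have "ShM C (-n) g = ShM C (-n) g'"
      by (rule coproduct_eqI[OF assms(1) unshift_in[OF D(1) g(1)] unshift_in[OF D(1) g(2)]])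
        (simp add: * g eq)
    then show ?thesis using g by (simp add: sh_eq_iff Hom_iff)
  qed
qed

lemma product_shift:
  assumes "is_product C I X S \<pi>" "\<And>i. i \<in> I \<Longrightarrow> X i \<in> Obj C"
  shows "is_product C I (\<lambda>i. ShO C n (X i)) (ShO C n S) (\<lambda>i. ShM C n (\<pi> i))"
proof (rule is_productI)
  note D = is_productD[OF assms(1)]
  show "ShO C n S \<in> Obj C" using D(1) by simp
  show "ShM C n (\<pi> i) \<in> Hom C (ShO C n S) (ShO C n (X i))" if "i \<in> I" for i
    using sh_in[OF D(2)[OF that]] .
  fix Y assume Y: "Y \<in> Obj C"
  have sh': "ShM C (-n) f \<in> Hom C (ShO C (-n) Y) X" if "X \<in> Obj C" "f \<in> Hom C Y (ShO C n X)" for f X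
    using sh_in[OF that(2), of "-n"] that(1) by simp
  show "\<exists>g\<in>Hom C Y (ShO C n S). \<forall>i\<in>I. ShM C n (\<pi> i) \<cdot> g = f i"
    if f: "\<And>i. i \<in> I \<Longrightarrow> f i \<in> Hom C Y (ShO C n (X i))" for f
  proof -
    have "ShM C (-n) (f i) \<in> Hom C (ShO C (-n) Y) (X i)" if "i \<in> I" for i
      using sh'[OF assms(2)[OF that] f[OF that]] .
    then obtain g where g: "g \<in> Hom C (ShO C (-n) Y) S" "\<And>i. i \<in> I \<Longrightarrow> \<pi> i \<cdot> g = ShM C (-n) (f i)"
      using D(3)[of "ShO C (-n) Y" "\<lambda>i. ShM C (-n) (f i)"] Y by auto
    have "ShM C n g \<in> Hom C Y (ShO C n S)" using sh_in[OF g(1), of n] Y by simp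
    moreover have "ShM C n (\<pi> i) \<cdot> ShM C n g = f i" if i: "i \<in> I" for i
    proof -
      have "ShM C n (\<pi> i) \<cdot> ShM C n g = ShM C n (\<pi> i \<cdot> g)"
        using g(1) D(2)[OF i] by (simp add: Hom_iff sh_comp)
      then show ?thesis unfolding g(2)[OF i] using f[OF i] by (simp add: Hom_iff)
    qed
    ultimately show ?thesis by blast
  qed
  show "g = g'" if g: "g \<in> Hom C Y (ShO C n S)" "g' \<in> Hom C Y (ShO C n S)"
    and eq: "\<And>i. i \<in> I \<Longrightarrow> ShM C n (\<pi> i) \<cdot> g = ShM C n (\<pi> i) \<cdot> g'" for g g'
  proof -
    have *: "\<pi> i \<cdot> ShM C (-n) h = ShM C (-n) (ShM C n (\<pi> i) \<cdot> h)" if "i \<in> I" "h \<in> Hom C Y (ShO C n S)" for i h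
      using that(2) D(2)[OF that(1)] by (simp add: Hom_iff sh_comp)
    have "ShM C (-n) g = ShM C (-n) g'"
      by (rule product_eqI[OF assms(1) sh'[OF D(1) g(1)] sh'[OF D(1) g(2)]])
        (simp add: * g eq)
    then show ?thesis using g by (simp add: sh_eq_iff Hom_iff)
  qed
qed

text \<open>The projections of the cone come from completing morphisms of triangles. Existence and uniqueness
  of maps into the cone are then the two halves of a five lemma, with the products of the \<open>A i\<close>, the
  \<open>B i\<close> and their shifts as the known terms. In effect, products of triangles are triangles.\<close>

lemma product_cone:
  assumes A: "is_product C I A SA \<pi>A" and B: "is_product C I B SB \<pi>B"
    and d: "\<And>i. i \<in> I \<Longrightarrow> distinguished C (A i) (B i) (K i) (f i) (g i) (h i)"
    and F: "\<And>i. i \<in> I \<Longrightarrow> f i \<cdot> \<pi>A i = \<pi>B i \<cdot> F" and D: "distinguished C SA SB SK F G H"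
  shows "\<exists>\<kappa>. is_product C I K SK \<kappa> \<and> (\<forall>i \<in> I. g i \<cdot> \<pi>B i = \<kappa> i \<cdot> G)"
proof -
  note a = is_productD[OF A] and b = is_productD[OF B]
  note dD = distD[OF d, unfolded Hom_iff] and DD = distD[OF D, unfolded Hom_iff]
  have A1: "is_product C I (\<lambda>i. ShO C 1 (A i)) (ShO C 1 SA) (\<lambda>i. ShM C 1 (\<pi>A i))"
    by (rule product_shift[OF A distD(4)[OF d]])
  have B1: "is_product C I (\<lambda>i. ShO C 1 (B i)) (ShO C 1 SB) (\<lambda>i. ShM C 1 (\<pi>B i))"
    by (rule product_shift[OF B distD(5)[OF d]])
  note a1 = is_productD[OF A1]
  have "\<forall>i \<in> I. \<exists>c. c \<in> Hom C SK (K i) \<and> g i \<cdot> \<pi>B i = c \<cdot> G \<and> h i \<cdot> c = ShM C 1 (\<pi>A i) \<cdot> H"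
    using TR3[OF D d a(2) b(2) F] by blast
  then obtain \<kappa> where \<kappa>: "\<And>i. i \<in> I \<Longrightarrow> \<kappa> i \<in> Hom C SK (K i)"
    "\<And>i. i \<in> I \<Longrightarrow> g i \<cdot> \<pi>B i = \<kappa> i \<cdot> G" "\<And>i. i \<in> I \<Longrightarrow> h i \<cdot> \<kappa> i = ShM C 1 (\<pi>A i) \<cdot> H" by metis
  note k = \<kappa>(1)[unfolded Hom_iff] and ai = a(2)[unfolded Hom_iff] and bi = b(2)[unfolded Hom_iff]
  have zero: "w = Zero C Y SK" if w: "w \<in> Hom C Y SK" "\<And>i. i \<in> I \<Longrightarrow> \<kappa> i \<cdot> w = Zero C Y (K i)" for w Y
  proof -
    have Y: "Y \<in> Obj C" using HomD(4)[OF w(1)] .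
    note w' = w(1)[unfolded Hom_iff]
    have "H \<cdot> w = Zero C Y (ShO C 1 SA)"
    proof (rule product_eqI[OF A1])
      fix i assume i: "i \<in> I"
      have "ShM C 1 (\<pi>A i) \<cdot> (H \<cdot> w) = (h i \<cdot> \<kappa> i) \<cdot> w" unfolding \<kappa>(3)[OF i]
        using w' DD ai[OF i] by (simp add: assoc)
      also have "\<dots> = h i \<cdot> (\<kappa> i \<cdot> w)" using w' k[OF i] dD[OF i] by (simp add: assoc)
      also have "\<dots> = ShM C 1 (\<pi>A i) \<cdot> Zero C Y (ShO C 1 SA)"
        unfolding w(2)[OF i] using dD[OF i] ai[OF i] Y by simp
      finally show "ShM C 1 (\<pi>A i) \<cdot> (H \<cdot> w) = ShM C 1 (\<pi>A i) \<cdot> Zero C Y (ShO C 1 SA)" .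
    qed (use w' DD Y in \<open>auto simp: Hom_iff\<close>)
    from lift_along_g[OF D w(1) this] obtain v where v: "v \<in> Hom C Y SB" "w = G \<cdot> v" by blast
    note v' = v(1)[unfolded Hom_iff]
    have "\<forall>i \<in> I. \<exists>m. m \<in> Hom C Y (A i) \<and> \<pi>B i \<cdot> v = f i \<cdot> m"
    proof
      fix i assume i: "i \<in> I"
      have "g i \<cdot> (\<pi>B i \<cdot> v) = (\<kappa> i \<cdot> G) \<cdot> v" unfolding \<kappa>(2)[OF i, symmetric]
        using v' bi[OF i] dD[OF i] by (simp add: assoc)
      also have "\<dots> = \<kappa> i \<cdot> w" unfolding v(2) using v' k[OF i] DD by (simp add: assoc)
      finally have 1: "g i \<cdot> (\<pi>B i \<cdot> v) = Zero C Y (K i)" using w(2)[OF i] by simp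
      have 2: "\<pi>B i \<cdot> v \<in> Hom C Y (B i)" using v' bi[OF i] by (simp add: Hom_iff)
      from lift_along_f[OF d[OF i] 2 1]
      show "\<exists>m. m \<in> Hom C Y (A i) \<and> \<pi>B i \<cdot> v = f i \<cdot> m" by blast
    qed
    then obtain m where m: "\<And>i. i \<in> I \<Longrightarrow> m i \<in> Hom C Y (A i)"
      "\<And>i. i \<in> I \<Longrightarrow> \<pi>B i \<cdot> v = f i \<cdot> m i" by metis
    obtain M where M: "M \<in> Hom C Y SA" "\<And>i. i \<in> I \<Longrightarrow> \<pi>A i \<cdot> M = m i"
      using a(3)[OF Y m(1)] by blast
    note M' = M(1)[unfolded Hom_iff]
    have "v = F \<cdot> M"
    proof (rule product_eqI[OF B v(1)])
      show "F \<cdot> M \<in> Hom C Y SB" using M' DD by (simp add: Hom_iff)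
      fix i assume i: "i \<in> I"
      have "\<pi>B i \<cdot> (F \<cdot> M) = (f i \<cdot> \<pi>A i) \<cdot> M" unfolding F[OF i]
        using M' DD bi[OF i] by (simp add: assoc)
      also have "\<dots> = \<pi>B i \<cdot> v" unfolding m(2)[OF i] M(2)[OF i, symmetric]
        using M' dD[OF i] ai[OF i] by (simp add: assoc)
      finally show "\<pi>B i \<cdot> v = \<pi>B i \<cdot> (F \<cdot> M)" ..
    qed
    then have "w = (G \<cdot> F) \<cdot> M" unfolding v(2) using M' DD by (simp add: assoc)
    then show ?thesis unfolding dist_comp_zero[OF D] using M' DD Y by simp
  qed
  have "is_product C I K SK \<kappa>"
  proof (rule is_productI)
    show "SK \<in> Obj C" using DD by simp
    show "\<kappa> i \<in> Hom C SK (K i)" if "i \<in> I" for i using \<kappa>(1)[OF that] .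
    fix Y assume Y: "Y \<in> Obj C"
    show "w = w'" if w: "w \<in> Hom C Y SK" "w' \<in> Hom C Y SK" and eq: "\<And>i. i \<in> I \<Longrightarrow> \<kappa> i \<cdot> w = \<kappa> i \<cdot> w'" for w w'
    proof -
      have "sub w w' = Zero C Y SK"
      proof (rule zero)
        show "sub w w' \<in> Hom C Y SK" using w by (simp add: Hom_iff)
        fix i assume i: "i \<in> I"
        then have "\<kappa> i \<cdot> sub w w' = sub (\<kappa> i \<cdot> w') (\<kappa> i \<cdot> w')"
          using w k[OF i] eq[OF i] by (simp add: Hom_iff comp_sub)
        then show "\<kappa> i \<cdot> sub w w' = Zero C Y (K i)" using w k[OF i] by (simp add: Hom_iff)
      qed
      then show ?thesis using w by (subst (asm) sub_zero_iff) (auto simp: Hom_iff)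
    qed
    show "\<exists>w\<in>Hom C Y SK. \<forall>i\<in>I. \<kappa> i \<cdot> w = y i" if y: "\<And>i. i \<in> I \<Longrightarrow> y i \<in> Hom C Y (K i)" for y
    proof -
      note y' = y[unfolded Hom_iff]
      have "h i \<cdot> y i \<in> Hom C Y (ShO C 1 (A i))" if "i \<in> I" for i
        using y'[OF that] dD[OF that] by (simp add: Hom_iff)
      from a1(3)[OF Y this] obtain u where u: "u \<in> Hom C Y (ShO C 1 SA)"
        "\<And>i. i \<in> I \<Longrightarrow> ShM C 1 (\<pi>A i) \<cdot> u = h i \<cdot> y i" by blast
      note u' = u(1)[unfolded Hom_iff]
      have "ShM C 1 F \<cdot> u = Zero C Y (ShO C 1 SB)"
      proof (rule product_eqI[OF B1])
        fix i assume i: "i \<in> I"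
        have "ShM C 1 (\<pi>B i) \<cdot> (ShM C 1 F \<cdot> u) = ShM C 1 (\<pi>B i \<cdot> F) \<cdot> u"
          using u' DD bi[OF i] by (simp add: sh_comp assoc)
        also have "\<dots> = ShM C 1 (f i) \<cdot> (ShM C 1 (\<pi>A i) \<cdot> u)"
          unfolding F[OF i, symmetric] using u' dD[OF i] ai[OF i] by (simp add: sh_comp assoc)
        also have "\<dots> = (ShM C 1 (f i) \<cdot> h i) \<cdot> y i" unfolding u(2)[OF i] using y'[OF i] dD[OF i] by (simp add: assoc)
        also have "\<dots> = ShM C 1 (\<pi>B i) \<cdot> Zero C Y (ShO C 1 SB)"
          unfolding dist_comp_zero3[OF d[OF i]] using y'[OF i] dD[OF i] bi[OF i] Y by simp
        finally show "ShM C 1 (\<pi>B i) \<cdot> (ShM C 1 F \<cdot> u) = ShM C 1 (\<pi>B i) \<cdot> Zero C Y (ShO C 1 SB)" .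
      qed (use u' DD Y in \<open>auto simp: Hom_iff\<close>)
      then have "Neg C (ShM C 1 F) \<cdot> u = Zero C Y (ShO C 1 SB)" using u' DD Y by (simp add: neg_comp)
      from lift_along_f[OF rotate[OF rotate[OF D]] u(1) this]
      obtain w0 where w0: "w0 \<in> Hom C Y SK" "u = H \<cdot> w0" by blast
      note w0' = w0(1)[unfolded Hom_iff]
      have "\<forall>i \<in> I. \<exists>v. v \<in> Hom C Y (B i) \<and> sub (\<kappa> i \<cdot> w0) (y i) = g i \<cdot> v"
      proof
        fix i assume i: "i \<in> I"
        have "h i \<cdot> (\<kappa> i \<cdot> w0) = (ShM C 1 (\<pi>A i) \<cdot> H) \<cdot> w0" unfolding \<kappa>(3)[OF i, symmetric]
          using w0' k[OF i] dD[OF i] by (simp add: assoc)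
        also have "\<dots> = h i \<cdot> y i" unfolding u(2)[OF i, symmetric] w0(2) using w0' DD ai[OF i] by (simp add: assoc)
        finally have "h i \<cdot> sub (\<kappa> i \<cdot> w0) (y i) = Zero C Y (ShO C 1 (A i))"
          using w0' k[OF i] dD[OF i] y'[OF i] by (simp add: comp_sub)
        moreover have "sub (\<kappa> i \<cdot> w0) (y i) \<in> Hom C Y (K i)"
          using w0' k[OF i] y'[OF i] by (simp add: Hom_iff)
        ultimately show "\<exists>v. v \<in> Hom C Y (B i) \<and> sub (\<kappa> i \<cdot> w0) (y i) = g i \<cdot> v"
          using lift_along_g[OF d[OF i]] by blast
      qed
      then obtain v where v: "\<And>i. i \<in> I \<Longrightarrow> v i \<in> Hom C Y (B i)"
        "\<And>i. i \<in> I \<Longrightarrow> sub (\<kappa> i \<cdot> w0) (y i) = g i \<cdot> v i" by metis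
      from b(3)[OF Y v(1)] obtain V where V: "V \<in> Hom C Y SB"
        "\<And>i. i \<in> I \<Longrightarrow> \<pi>B i \<cdot> V = v i" by blast
      note V' = V(1)[unfolded Hom_iff]
      have "\<kappa> i \<cdot> sub w0 (G \<cdot> V) = y i" if i: "i \<in> I" for i
      proof -
        have "\<kappa> i \<cdot> (G \<cdot> V) = (g i \<cdot> \<pi>B i) \<cdot> V"
          unfolding \<kappa>(2)[OF i] using V' DD k[OF i] by (simp add: assoc)
        also have "\<dots> = g i \<cdot> v i" unfolding V(2)[OF i, symmetric]
          using V' bi[OF i] dD[OF i] by (simp add: assoc)
        finally have VH: "\<kappa> i \<cdot> (G \<cdot> V) = sub (\<kappa> i \<cdot> w0) (y i)" unfolding v(2)[OF i] .
        have "\<kappa> i \<cdot> sub w0 (G \<cdot> V) = sub (\<kappa> i \<cdot> w0) (sub (\<kappa> i \<cdot> w0) (y i))"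
          unfolding VH[symmetric] using w0' V' DD k[OF i] by (simp add: comp_sub)
        also have "\<dots> = y i" using w0' k[OF i] y'[OF i] by (intro sub_sub) simp_all
        finally show ?thesis .
      qed
      moreover have "sub w0 (G \<cdot> V) \<in> Hom C Y SK" using w0' V' DD by (simp add: Hom_iff)
      ultimately show ?thesis by blast
    qed
  qed
  then show ?thesis using \<kappa>(2) by blast
qed

end

context category
begin

section \<open>Idempotents split in the presence of countable coproducts\<close>

lemma countable_coproduct_exists:
  assumes "smashing TYPE('u) C" "small TYPE('u) (UNIV :: nat set)" "X \<in> Obj C"
  shows "\<exists>S \<kappa>. is_coproduct C (UNIV :: nat set) (\<lambda>_. X) S \<kappa>"
proof -
  obtain \<phi> :: "nat \<Rightarrow> 'u" where \<phi>: "inj \<phi>"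
    using assms(2) lesspoll_imp_lepoll unfolding small_def lepoll_def by blast
  have "small TYPE('u) (range \<phi>)"
    using assms(2) \<phi> unfolding small_def
    by (metis eqpoll_sym inj_on_image_eqpoll_self lesspoll_eq_trans lepoll_trans1 eq_lesspoll_trans)
  then obtain S \<iota> where S: "is_coproduct C (range \<phi>) (\<lambda>_. X) S \<iota>"
    using assms(1,3) unfolding smashing_def by (metis (no_types))
  have "is_coproduct C (UNIV :: nat set) (\<lambda>_. X) S (\<iota> \<circ> \<phi>)"
    unfolding is_coproduct_def
  proof (intro conjI ballI allI impI)
    show "S \<in> Obj C" using S by (simp add: is_coproduct_def)
    show "(\<iota> \<circ> \<phi>) i \<in> Hom C X S" for i using S by (simp add: is_coproduct_def)
    fix Y f assume Y: "Y \<in> Obj C" and f: "\<forall>i\<in>(UNIV::nat set). f i \<in> Hom C X Y"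
    have "\<forall>i\<in>range \<phi>. (f \<circ> inv_into UNIV \<phi>) i \<in> Hom C X Y" using f by simp
    then have "\<exists>!g. g \<in> Hom C S Y \<and> (\<forall>i\<in>range \<phi>. g \<cdot> \<iota> i = (f \<circ> inv_into UNIV \<phi>) i)"
      using S Y unfolding is_coproduct_def by blast
    moreover have "(\<forall>i\<in>range \<phi>. g \<cdot> \<iota> i = (f \<circ> inv_into UNIV \<phi>) i) \<longleftrightarrow>
        (\<forall>i\<in>UNIV. g \<cdot> (\<iota> \<circ> \<phi>) i = f i)" for g
      using \<phi> by simp
    ultimately show "\<exists>!g. g \<in> Hom C S Y \<and> (\<forall>i\<in>UNIV. g \<cdot> (\<iota> \<circ> \<phi>) i = f i)" by simp
  qed
  then show ?thesis by blast
qed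

end

context triangulated_category
begin

text \<open>Write \<open>d = 1 - e\<close>. On the countable coproduct \<open>S\<close> of copies of \<open>X\<close>, let \<open>s\<close> keep the \<open>d\<close>-part of each
  summand and push its \<open>e\<close>-part to the next summand. In an idempotent completion, where
  \<open>X = dX \<oplus> eX\<close>, this is a split monomorphism whose complement is the copy of \<open>eX\<close> in the summand
  number \<open>0\<close>. But \<open>s\<close> and its retraction \<open>r\<close> exist in the category itself, and split monomorphisms have
  complements there, so the complement is an object splitting \<open>e\<close>.\<close>

lemma idempotent_splits:
  assumes "is_coproduct C (UNIV :: nat set) (\<lambda>_. X) S \<kappa>" "e \<in> Hom C X X" "e \<cdot> e = e"
  shows "\<exists>Y. \<exists>a \<in> Hom C X Y. \<exists>b \<in> Hom C Y X. a \<cdot> b = Ident C Y \<and> b \<cdot> a = e"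
proof -
  note S = is_coproductD[OF assms(1)]
  note k = S(2)[OF UNIV_I, unfolded Hom_iff]
  have X: "X \<in> Obj C" using HomD[OF assms(2)] by simp
  note e = assms(2)[unfolded Hom_iff]
  define d where "d = sub (Ident C X) e"
  have d: "d \<in> Arr C" "Dom C d = X" "Cod C d = X" unfolding d_def using e X by simp_all
  have dd: "d \<cdot> d = d" and de: "d \<cdot> e = Zero C X X" and ed: "e \<cdot> d = Zero C X X"
    unfolding d_def using e X assms(3) by (simp_all add: comp_sub sub_comp)
  have one: "Add C d e = Ident C X" unfolding d_def using e X by (intro sub_add_cancel) simp_all
  have kde: "Add C (\<kappa> n \<cdot> d) (\<kappa> n \<cdot> e) = \<kappa> n" for n
    using k[of n] d e one comp_add[of "\<kappa> n" d e] by simp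
  have "\<exists>s \<in> Hom C S S. \<forall>n \<in> UNIV. s \<cdot> \<kappa> n = Add C (\<kappa> n \<cdot> d) (\<kappa> (Suc n) \<cdot> e)"
    by (rule S(3)[OF S(1)]) (use k d e in \<open>simp add: Hom_iff\<close>)
  then obtain s where s: "s \<in> Hom C S S" "\<And>n. s \<cdot> \<kappa> n = Add C (\<kappa> n \<cdot> d) (\<kappa> (Suc n) \<cdot> e)" by auto
  have "\<exists>r \<in> Hom C S S. \<forall>n \<in> UNIV. r \<cdot> \<kappa> n =
      (case n of 0 \<Rightarrow> \<kappa> 0 \<cdot> d | Suc m \<Rightarrow> Add C (\<kappa> n \<cdot> d) (\<kappa> m \<cdot> e))"
    by (rule S(3)[OF S(1)]) (use k d e in \<open>auto simp add: Hom_iff split: nat.split\<close>)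
  then obtain r where r: "r \<in> Hom C S S" and r': "\<And>n. r \<cdot> \<kappa> n =
      (case n of 0 \<Rightarrow> \<kappa> 0 \<cdot> d | Suc m \<Rightarrow> Add C (\<kappa> n \<cdot> d) (\<kappa> m \<cdot> e))" by blast
  have r0: "r \<cdot> \<kappa> 0 = \<kappa> 0 \<cdot> d" and rS: "r \<cdot> \<kappa> (Suc n) = Add C (\<kappa> (Suc n) \<cdot> d) (\<kappa> n \<cdot> e)" for n
    using r'[of 0] r'[of "Suc n"] by simp_all
  have "\<exists>b \<in> Hom C S X. \<forall>n \<in> UNIV. b \<cdot> \<kappa> n = (case n of 0 \<Rightarrow> e | Suc m \<Rightarrow> Zero C X X)"
    by (rule S(3)[OF X]) (use k d e X in \<open>auto simp add: Hom_iff split: nat.split\<close>)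
  then obtain b where b: "b \<in> Hom C S X" and b': "\<And>n. b \<cdot> \<kappa> n = (case n of 0 \<Rightarrow> e | Suc m \<Rightarrow> Zero C X X)"
    by blast
  have b0: "b \<cdot> \<kappa> 0 = e" and bS: "b \<cdot> \<kappa> (Suc n) = Zero C X X" for n
    using b'[of 0] b'[of "Suc n"] by simp_all
  note hh = s(1)[unfolded Hom_iff] r[unfolded Hom_iff] b[unfolded Hom_iff] d e X S(1)
  have rd: "(r \<cdot> \<kappa> n) \<cdot> d = \<kappa> n \<cdot> d" and re: "(r \<cdot> \<kappa> (Suc n)) \<cdot> e = \<kappa> n \<cdot> e" for n
  proof -
    show "(r \<cdot> \<kappa> n) \<cdot> d = \<kappa> n \<cdot> d"
      by (cases n) (use hh k in \<open>simp_all add: r0 rS add_comp assoc dd ed\<close>)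
    show "(r \<cdot> \<kappa> (Suc n)) \<cdot> e = \<kappa> n \<cdot> e"
      unfolding rS using hh k by (simp add: add_comp assoc de assms(3))
  qed
  have rs: "r \<cdot> s = Ident C S"
  proof (rule coproduct_eqI[OF assms(1)])
    fix n :: nat
    have "(r \<cdot> s) \<cdot> \<kappa> n = r \<cdot> Add C (\<kappa> n \<cdot> d) (\<kappa> (Suc n) \<cdot> e)"
      unfolding s(2)[symmetric] using hh k by (simp add: assoc)
    also have "\<dots> = Add C ((r \<cdot> \<kappa> n) \<cdot> d) ((r \<cdot> \<kappa> (Suc n)) \<cdot> e)"
      using hh k by (simp add: comp_add assoc)
    also have "\<dots> = Ident C S \<cdot> \<kappa> n" unfolding rd re kde using k by simp
    finally show "(r \<cdot> s) \<cdot> \<kappa> n = Ident C S \<cdot> \<kappa> n" .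
  qed (use hh in \<open>auto simp: Hom_iff\<close>)
  have sd: "(s \<cdot> \<kappa> n) \<cdot> d = \<kappa> n \<cdot> d" and se: "(s \<cdot> \<kappa> n) \<cdot> e = \<kappa> (Suc n) \<cdot> e" for n
    unfolding s(2) using hh k by (simp_all add: add_comp assoc de ed dd assms(3))
  obtain Z p j where Z: "p \<in> Hom C S Z" "j \<in> Hom C Z S" "p \<cdot> j = Ident C Z" "j \<cdot> p = sub (Ident C S) (s \<cdot> r)"
    using split_mono_complement[OF s(1) r rs] by blast
  define a where "a = \<kappa> 0 \<cdot> e"
  have a: "a \<in> Arr C" "Dom C a = X" "Cod C a = S" unfolding a_def using hh k by simp_all
  note hh = hh a Z(1,2)[unfolded Hom_iff]
  have q: "j \<cdot> p = a \<cdot> b"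
  proof (rule coproduct_eqI[OF assms(1)])
    fix n :: nat
    have "(j \<cdot> p) \<cdot> \<kappa> n = sub (\<kappa> n) (s \<cdot> (r \<cdot> \<kappa> n))"
      unfolding Z(4) using hh k by (simp add: sub_comp assoc)
    also have "\<dots> = a \<cdot> (b \<cdot> \<kappa> n)"
    proof (cases n)
      case 0
      have "s \<cdot> (r \<cdot> \<kappa> 0) = (s \<cdot> \<kappa> 0) \<cdot> d" unfolding r0 using hh k by (simp add: assoc)
      then have "s \<cdot> (r \<cdot> \<kappa> 0) = \<kappa> 0 \<cdot> d" unfolding sd .
      moreover have "sub (Add C (\<kappa> 0 \<cdot> d) (\<kappa> 0 \<cdot> e)) (\<kappa> 0 \<cdot> d) = \<kappa> 0 \<cdot> e"
        using hh k by (intro sub_eq_of_add) simp_all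
      ultimately have "sub (\<kappa> 0) (s \<cdot> (r \<cdot> \<kappa> 0)) = \<kappa> 0 \<cdot> e" unfolding kde by simp
      also have "\<dots> = a \<cdot> (b \<cdot> \<kappa> 0)" unfolding b0 a_def using hh k by (simp add: assoc assms(3))
      finally show ?thesis using 0 by simp
    next
      case (Suc m)
      have "s \<cdot> (r \<cdot> \<kappa> (Suc m)) = Add C ((s \<cdot> \<kappa> (Suc m)) \<cdot> d) ((s \<cdot> \<kappa> m) \<cdot> e)"
        unfolding rS using hh k by (simp add: comp_add assoc)
      also have "\<dots> = \<kappa> (Suc m)" unfolding sd se kde ..
      finally show ?thesis unfolding Suc bS using hh k by simp
    qed
    also have "\<dots> = (a \<cdot> b) \<cdot> \<kappa> n" using hh k by (simp add: assoc)
    finally show "(j \<cdot> p) \<cdot> \<kappa> n = (a \<cdot> b) \<cdot> \<kappa> n" .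
  qed (use hh in \<open>auto simp: Hom_iff\<close>)
  have ba: "b \<cdot> a = e"
  proof -
    have "b \<cdot> a = (b \<cdot> \<kappa> 0) \<cdot> e" unfolding a_def using hh k by (simp add: assoc)
    then show ?thesis unfolding b0 assms(3) .
  qed
  have "(b \<cdot> j) \<cdot> (p \<cdot> a) = b \<cdot> ((j \<cdot> p) \<cdot> a)" using hh by (simp add: assoc)
  also have "\<dots> = (b \<cdot> a) \<cdot> (b \<cdot> a)" unfolding q using hh by (simp add: assoc)
  finally have 1: "(b \<cdot> j) \<cdot> (p \<cdot> a) = e" unfolding ba assms(3) .
  have "(p \<cdot> a) \<cdot> (b \<cdot> j) = p \<cdot> ((a \<cdot> b) \<cdot> j)" using hh by (simp add: assoc)
  also have "\<dots> = (p \<cdot> j) \<cdot> (p \<cdot> j)" unfolding q[symmetric] using hh by (simp add: assoc)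
  finally have 2: "(p \<cdot> a) \<cdot> (b \<cdot> j) = Ident C Z" unfolding Z(3) using HomD(5)[OF Z(1)] by simp
  have "p \<cdot> a \<in> Hom C X Z" "b \<cdot> j \<in> Hom C Z X" using hh by (simp_all add: Hom_iff)
  then show ?thesis using 1 2 by blast
qed

lemma triangle_of_iso:
  assumes "isomorphic C X Y" shows "\<exists>N. zero_object C N \<and> triangle X Y N"
proof -
  obtain f where f: "is_iso C X Y f" using assms by (auto simp: isomorphic_def)
  obtain N where N: "zero_object C N" using zero_object_exists by blast
  have O: "X \<in> Obj C" "Y \<in> Obj C" "N \<in> Obj C" and fH: "f \<in> Hom C X Y"
    using f N by (auto simp: is_iso_def zero_object_def)
  have "distinguished C X Y N f (Zero C Y N) (Zero C N (ShO C 1 X))"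
    by (rule TR1_iso[OF TR1_ident[OF O(1) N] fH zero_in[OF O(2,3)] zero_in is_iso_ident f is_iso_ident])
      (use O fH in \<open>simp_all add: Hom_iff\<close>)
  then show ?thesis using N triangleI by blast
qed

section \<open>The localizing subcategory generated by an aisle\<close>

lemma localizing_subcategory_props:
  assumes "P \<subseteq> Obj C"
  defines "L \<equiv> localizing_subcategory TYPE('u) C P"
  shows "triangulated_subcategory C L" "P \<subseteq> L" "coproduct_closed TYPE('u) C L"
    "triangulated_subcategory C D \<Longrightarrow> P \<subseteq> D \<Longrightarrow> coproduct_closed TYPE('u) C D \<Longrightarrow> L \<subseteq> D"
proof -
  let ?F = "{D. triangulated_subcategory C D \<and> P \<subseteq> D \<and> coproduct_closed TYPE('u) C D}"
  obtain N where N: "zero_object C N" using zero_object_exists by blast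
  have "triangulated_subcategory C (Obj C)"
    unfolding triangulated_subcategory_def iso_closed_def isomorphic_def is_iso_def
    using N by (auto dest: distD simp: zero_object_def)
  moreover have "coproduct_closed TYPE('u) C (Obj C)" by (simp add: coproduct_closed_def is_coproduct_def)
  ultimately have O: "Obj C \<in> ?F" using assms(1) by simp
  have LF: "L = \<Inter> ?F" by (simp add: L_def localizing_subcategory_def)
  show "P \<subseteq> L" unfolding LF by blast
  show "coproduct_closed TYPE('u) C L"     unfolding coproduct_closed_def
  proof (intro allI impI)
    fix I :: "'u set" and X S \<iota>
    assume I: "small TYPE('u) I" and X: "\<forall>i\<in>I. X i \<in> L" and S: "is_coproduct C I X S \<iota>"
    have "S \<in> D" if D: "D \<in> ?F" for D
    proof -
      have "\<forall>i\<in>I. X i \<in> D" using X D unfolding LF by blast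
      then show ?thesis using D I S unfolding coproduct_closed_def by blast
    qed
    then show "S \<in> L" unfolding LF by blast
  qed
  show "L \<subseteq> D" if "triangulated_subcategory C D" "P \<subseteq> D" "coproduct_closed TYPE('u) C D" for D
    unfolding LF using that by blast
  have ND: "N \<in> D" if D: "D \<in> ?F" for D
  proof -
    obtain N' where N': "N' \<in> D" "zero_object C N'" using D by (auto simp: triangulated_subcategory_def)
    have "N \<in> Obj C" "N' \<in> Obj C" using N N' by (simp_all add: zero_object_def)
    then have "is_iso C N' N (Zero C N' N)"
      using N N' zero_in[of N' N] zero_in[of N N']
      by (auto simp: is_iso_def zero_object_iff intro!: bexI[of _ "Zero C N N'"])
    then show ?thesis using D N'(1) by (auto simp: triangulated_subcategory_def iso_closed_def isomorphic_def)
  qed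
  show "triangulated_subcategory C L"
    unfolding triangulated_subcategory_def
  proof (intro conjI allI ballI impI)
    show "L \<subseteq> Obj C" using O LF by blast
    show "iso_closed C L" unfolding LF iso_closed_def
      by (auto simp: triangulated_subcategory_def iso_closed_def)
    show "\<exists>N\<in>L. zero_object C N" using N ND LF by blast
    show "ShO C n X \<in> L" if "X \<in> L" for X n using that unfolding LF by (auto simp: triangulated_subcategory_def)
    show "Z \<in> L" if "distinguished C X Y Z f g h" "X \<in> L" "Y \<in> L" for X Y Z f g h
      using that triangulated_subcategory_two_of_three(1)[OF _ triangleI[OF that(1)]] unfolding LF by blast
  qed
qed

end

context t_structure
begin

text \<open>Let \<open>K\<close> be the cone of the coproduct of the \<open>L i \<rightarrow> X i\<close>. It lies in \<open>C\<^bsub>t\<ge>1\<^esub>\<close>: for \<open>Y \<in> C\<^bsub>t\<le>0\<^esub>\<close> the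
  map \<open>C(X i, Y) \<rightarrow> C(L i, Y)\<close> is injective and \<open>C(X i, Y[-1]) \<rightarrow> C(L i, Y[-1])\<close> is surjective, as both
  \<open>R i\<close> and \<open>R i[-1]\<close> have no maps to the respective targets, and these properties pass to
  coproducts.\<close>

lemma weight_decomposable_coproduct:
  fixes I :: "'u set"
  assumes sm: "smashing TYPE('u) C" "small TYPE('u) I" and S: "is_coproduct C I X S \<iota>"
    and X: "\<And>i. i \<in> I \<Longrightarrow> weight_decomposable (X i)"
  shows "weight_decomposable S"
proof -
  have "\<forall>i \<in> I. \<exists>L R f g h. L \<in> weight_le \<and> R \<in> GE C t 1 \<and> distinguished C L (X i) R f g h"
    using X unfolding weight_decomposable_def triangle_def by blast
  then obtain L R f g h where LR: "\<And>i. i \<in> I \<Longrightarrow> L i \<in> weight_le" "\<And>i. i \<in> I \<Longrightarrow> R i \<in> GE C t 1"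
    "\<And>i. i \<in> I \<Longrightarrow> distinguished C (L i) (X i) (R i) (f i) (g i) (h i)" by metis
  note d = distD[OF LR(3)]
  obtain SL \<iota>L where SL: "is_coproduct C I L SL \<iota>L"
    using sm d(4) unfolding smashing_def by blast
  have SO: "S \<in> Obj C" using is_coproductD(1)[OF S] .
  have "\<iota> i \<cdot> f i \<in> Hom C (L i) S" if "i \<in> I" for i
    using comp_in[OF d(1)[OF that] is_coproductD(2)[OF S that]] .
  from is_coproductD(3)[OF SL SO this]
  obtain F where F: "F \<in> Hom C SL S" "\<And>i. i \<in> I \<Longrightarrow> F \<cdot> \<iota>L i = \<iota> i \<cdot> f i" by blast
  obtain K G H where D: "distinguished C SL S K F G H" using TR1_cone[OF F(1)] by blast
  note DD = distD[OF D, unfolded Hom_iff]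
  have "perp C K Y" if Y: "Y \<in> LE0 t" for Y
  proof (subst perp_iff)
    show YO: "Y \<in> Obj C" using Y t_le_obj by blast
    show "\<forall>w\<in>Hom C K Y. w = Zero C K Y"
    proof
      fix w assume w: "w \<in> Hom C K Y"
      note w' = w[unfolded Hom_iff]
      have "w \<cdot> G = Zero C S Y"
      proof (rule coproduct_eqI[OF S])
        fix i assume i: "i \<in> I"
        note hh = d(1)[OF i, unfolded Hom_iff] is_coproductD(2)[OF S i, unfolded Hom_iff]
          is_coproductD(2)[OF SL i, unfolded Hom_iff]
        have wG: "(w \<cdot> G) \<cdot> \<iota> i \<in> Hom C (X i) Y" using w' DD hh by (simp add: Hom_iff)
        have "((w \<cdot> G) \<cdot> \<iota> i) \<cdot> f i = w \<cdot> (G \<cdot> (\<iota> i \<cdot> f i))" using w' DD hh by (simp add: assoc)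
        also have "\<dots> = w \<cdot> ((G \<cdot> F) \<cdot> \<iota>L i)" unfolding F(2)[OF i, symmetric] using DD hh by (simp add: assoc)
        also have "\<dots> = Zero C (L i) Y" unfolding dist_comp_zero[OF D] using w' DD hh YO d(4)[OF i] by simp
        finally have "((w \<cdot> G) \<cdot> \<iota> i) \<cdot> f i = Zero C (L i) Y" .
        from extend_along_g[OF LR(3)[OF i] wG this]
        obtain v where v: "v \<in> Hom C (R i) Y" "(w \<cdot> G) \<cdot> \<iota> i = v \<cdot> g i" by blast
        have "perp C (R i) Y" using t_perp[OF LR(2)[OF i], of Y 0] Y by simp
        from perpD[OF this v(1)] show "(w \<cdot> G) \<cdot> \<iota> i = Zero C S Y \<cdot> \<iota> i"
          using v(2) d(2)[OF i] hh YO by (simp add: Hom_iff)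
      qed (use w' DD YO in \<open>auto simp: Hom_iff\<close>)
      from extend_along_h[OF D w this] obtain v where v: "v \<in> Hom C (ShO C 1 SL) Y" "w = v \<cdot> H" by blast
      let ?Y = "ShO C (-1) Y" and ?v = "ShM C (-1) v"
      have v1: "?v \<in> Hom C SL ?Y" using sh_in[OF v(1), of "-1"] DD by simp
      have "\<exists>m. m \<in> Hom C (X i) ?Y \<and> ?v \<cdot> \<iota>L i = m \<cdot> f i" if i: "i \<in> I" for i
      proof -
        have u: "?v \<cdot> \<iota>L i \<in> Hom C (L i) ?Y" by (rule comp_in[OF is_coproductD(2)[OF SL i] v1])
        have "?Y \<in> LE C t (-1)" using Y YO by (simp add: LE_shift_iff)
        moreover have "ShO C (-1) (R i) \<in> GE C t 0" using LR(2)[OF i] by (simp add: GE_iff)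
        ultimately have p: "perp C (ShO C (-1) (R i)) ?Y" by (intro t_perp[of _ 0 _ "-1"]) simp_all
        have "(?v \<cdot> \<iota>L i) \<cdot> Neg C (ShM C (-1) (h i)) \<in> Hom C (ShO C (-1) (R i)) ?Y"
          using u d(3,4)[OF i] by (simp add: Hom_iff)
        from extend_along_f[OF LR(3)[OF i] u perpD[OF p this]] show ?thesis by blast
      qed
      then obtain m where m: "\<And>i. i \<in> I \<Longrightarrow> m i \<in> Hom C (X i) ?Y"
        "\<And>i. i \<in> I \<Longrightarrow> ?v \<cdot> \<iota>L i = m i \<cdot> f i" by metis
      obtain M where M: "M \<in> Hom C S ?Y" "\<And>i. i \<in> I \<Longrightarrow> M \<cdot> \<iota> i = m i"
        using is_coproductD(3)[OF S, of ?Y m, OF _ m(1)] YO by auto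
      have "?v = M \<cdot> F"
      proof (rule coproduct_eqI[OF SL v1 comp_in[OF F(1) M(1)]])
        fix i assume i: "i \<in> I"
        show "?v \<cdot> \<iota>L i = (M \<cdot> F) \<cdot> \<iota>L i"
          using m(2)[OF i] comp_assoc[OF d(1)[OF i] is_coproductD(2)[OF S i] M(1)] M(2)[OF i]
            comp_assoc[OF is_coproductD(2)[OF SL i] F(1) M(1)] F(2)[OF i] by simp
      qed
      then have "ShM C 1 ?v = ShM C 1 M \<cdot> ShM C 1 F" using M(1) DD by (simp add: Hom_iff sh_comp)
      then have "v = ShM C 1 M \<cdot> ShM C 1 F" using v(1) by (simp add: Hom_iff)
      then have "w = ShM C 1 M \<cdot> (ShM C 1 F \<cdot> H)" using v(2) M(1) DD YO by (simp add: Hom_iff assoc)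
      then show "w = Zero C K Y" unfolding dist_comp_zero3[OF D] using M(1) DD YO by (simp add: Hom_iff)
    qed
  qed (use DD in simp)
  then have "K \<in> GE C t 1" using DD by (simp add: GE_iff_perp)
  moreover have "SL \<in> weight_le"
    unfolding weight_le_iff
  proof (intro conjI ballI)
    show "perp C SL Y" if Y: "Y \<in> GE C t 1" for Y
      by (rule perp_coproduct[OF SL _ GE_obj[OF Y]]) (use LR(1) Y in \<open>auto simp: weight_le_iff\<close>)
  qed (use distD[OF D] in simp)
  ultimately show ?thesis using triangleI[OF D] by (auto simp: weight_decomposable_def)
qed

lemma weight_decomposable_isomorphic:
  assumes "weight_decomposable X" "isomorphic C X Y" shows "weight_decomposable Y"
proof -
  obtain N where N: "zero_object C N" "triangle X Y N" using triangle_of_iso[OF assms(2)] by blast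
  then have "weight_decomposable N" using weight_decomposable_GE zero_in_GE by blast
  then show ?thesis using weight_decomposable_extension[OF N(2) assms(1)] by blast
qed

text \<open>The objects all of whose shifts are decomposable are closed under shifts by definition, so closure
  under extensions makes them a triangulated subcategory.\<close>

lemma weight_decomposable_localizing:
  assumes "enough_projectives heart" "enough_lifted_projectives" and sm: "smashing TYPE('u) C"
    and M: "M \<in> localizing_subcategory TYPE('u) C (GE0 t)"
  shows "weight_decomposable M"
proof -
  define D where "D = {M \<in> Obj C. \<forall>n. weight_decomposable (ShO C n M)}"
  note wb = weight_decomposable_bounded_below[OF assms(1,2)]
  have "triangulated_subcategory C D"
    unfolding triangulated_subcategory_def
  proof (intro conjI allI ballI impI)
    show "D \<subseteq> Obj C" by (auto simp: D_def)
    show "iso_closed C D" unfolding iso_closed_def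
    proof (intro ballI allI impI)
      fix X Y assume X: "X \<in> D" and XY: "isomorphic C X Y"
      have "weight_decomposable (ShO C n Y)" for n
        using weight_decomposable_isomorphic[OF _ isomorphic_shift[OF XY]] X by (simp add: D_def)
      moreover have "Y \<in> Obj C" using XY by (auto simp: isomorphic_def is_iso_def)
      ultimately show "Y \<in> D" by (simp add: D_def)
    qed
    obtain N where N: "zero_object C N" using zero_object_exists by blast
    then have "N \<in> D" using weight_decomposable_GE[OF zero_in_GE[OF zero_object_shift[OF N]]]
      by (simp add: D_def zero_object_def)
    then show "\<exists>N\<in>D. zero_object C N" using N by blast
    show "ShO C n X \<in> D" if "X \<in> D" for X n using that by (auto simp: D_def)
    show "Z \<in> D" if t: "distinguished C X Y Z f g h" and XY: "X \<in> D" "Y \<in> D" for X Y Z f g h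
      unfolding D_def
    proof (intro CollectI conjI allI)
      show "Z \<in> Obj C" using distD[OF t] by simp
      fix n
      have "triangle (ShO C n Y) (ShO C n Z) (ShO C (n + 1) X)"
        using triangle_shift[OF triangle_rotate[OF triangleI[OF t]], of n] distD[OF t] by simp
      then show "weight_decomposable (ShO C n Z)" by (rule weight_decomposable_extension) (use XY in \<open>auto simp: D_def\<close>)
    qed
  qed
  moreover have "GE0 t \<subseteq> D"
  proof
    fix X assume X: "X \<in> GE0 t"
    then have "ShO C n X \<in> GE C t n" for n by (auto simp: GE_def)
    then show "X \<in> D" using X t_ge_obj wb by (auto simp: D_def)
  qed
  moreover have "coproduct_closed TYPE('u) C D"
    unfolding coproduct_closed_def
  proof (intro allI impI)
    fix I :: "'u set" and X S \<iota>
    assume I: "small TYPE('u) I" and X: "\<forall>i\<in>I. X i \<in> D" and S: "is_coproduct C I X S \<iota>"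
    have "weight_decomposable (ShO C n S)" for n
      by (rule weight_decomposable_coproduct[OF sm I coproduct_shift[OF S]]) (use X in \<open>auto simp: D_def\<close>)
    then show "S \<in> D" using is_coproductD(1)[OF S] by (simp add: D_def)
  qed
  ultimately have "localizing_subcategory TYPE('u) C (GE0 t) \<subseteq> D"
    by (rule localizing_subcategory_props(4)[OF t_ge_obj])
  then have "weight_decomposable (ShO C 0 M)" "M \<in> Obj C" using M unfolding D_def by blast+
  then show ?thesis by simp
qed

text \<open>Coproducts taken in the localizing subcategory agree with coproducts in \<open>C\<close> up to isomorphism,
  because the latter stay in the subcategory.\<close>

lemma localizing_weight_structure:
  assumes "enough_projectives heart" "enough_lifted_projectives" and sm: "smashing TYPE('u) C"
    and nat: "small TYPE('u) (UNIV :: nat set)"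
  shows "let D = full_subcat C (localizing_subcategory TYPE('u) C (GE0 t)) in
        \<exists>w. smashing_weight_structure TYPE('u) D w \<and> GE0 w = GE0 t \<and>
          equivalent_categories (pair_heart D w) (projective_subcat heart)"
proof -
  let ?L = "localizing_subcategory TYPE('u) C (GE0 t)"
  let ?E = "full_subcat C ?L"
  let ?w = "\<lparr>LE0 = weight_le \<inter> ?L, GE0 = GE0 t\<rparr>"
  note L = localizing_subcategory_props[OF t_ge_obj, where ?'u = 'u]
  have LO: "X \<in> Obj C" if "X \<in> ?L" for X using L(1) that by (auto simp: triangulated_subcategory_def)
  have W: "weight_structure ?E ?w"
    by (rule weight_structure_of_decompositions[OF L(1,2) weight_decomposable_localizing[OF assms(1,2) sm]])
  interpret E: category ?E by (rule category_full_subcat)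
  have coprod: "is_coproduct ?E I X S \<iota>" if "is_coproduct C I X S \<iota>" "S \<in> ?L" "\<forall>i\<in>I. X i \<in> ?L"
    for I :: "'u set" and X S \<iota>
    using that unfolding is_coproduct_def by simp
  have ex: "\<exists>S \<iota>. is_coproduct C I X S \<iota> \<and> S \<in> ?L \<and> is_coproduct ?E I X S \<iota>"
    if I: "small TYPE('u) I" and X: "\<forall>i\<in>I. X i \<in> ?L" for I :: "'u set" and X
  proof -
    obtain S \<iota> where S: "is_coproduct C I X S \<iota>" using sm I X LO unfolding smashing_def by blast
    have "S \<in> ?L" using L(3) I X S unfolding coproduct_closed_def by blast
    then show ?thesis using coprod[OF S _ X] S by blast
  qed
  have "smashing TYPE('u) ?E" unfolding smashing_def using ex by simp blast
  moreover have "coproduct_closed TYPE('u) ?E (GE0 t)"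
    unfolding coproduct_closed_def
  proof (intro allI impI)
    fix I :: "'u set" and X S \<iota>
    assume I: "small TYPE('u) I" and X: "\<forall>i\<in>I. X i \<in> GE0 t" and S: "is_coproduct ?E I X S \<iota>"
    have "\<forall>i\<in>I. X i \<in> ?L" using X L(2) by blast
    from ex[OF I this] obtain S' \<iota>' where S': "is_coproduct C I X S' \<iota>'" "is_coproduct ?E I X S' \<iota>'" by blast
    have "S' \<in> GE C t 0"
      unfolding GE_iff_perp
    proof (intro conjI ballI)
      show "perp C S' Y" if Y: "Y \<in> LE C t (0 - 1)" for Y
        by (rule perp_coproduct[OF S'(1) _ LE_obj[OF Y]]) (use X Y in \<open>auto intro: t_perp[of _ 0 _ "-1"]\<close>)
    qed (rule is_coproductD(1)[OF S'(1)])
    moreover have "isomorphic C S' S"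
      using E.coproducts_isomorphic[OF S'(2) S] by (auto simp: isomorphic_def is_iso_full_subcat)
    ultimately show "S \<in> GE0 t" using GE_isomorphic[of S' 0 S] by simp
  qed
  ultimately have "smashing_weight_structure TYPE('u) ?E ?w"
    using W by (simp add: smashing_weight_structure_def)
  moreover have "equivalent_categories (pair_heart ?E ?w) (projective_subcat heart)"
  proof (rule heart_equivalence[OF L(1,2)])
    fix P assume P: "projective heart P"
    show "\<exists>X\<in>P_t C t. isomorphic heart (H0_t C t X) P"
    proof (rule lift_projective[OF _ assms(2) P])
      fix X e assume e: "e \<in> Hom C X X" "e \<cdot> e = e"
      obtain S \<kappa> where "is_coproduct C (UNIV :: nat set) (\<lambda>_. X) S \<kappa>"
        using countable_coproduct_exists[OF sm nat HomD(4)[OF e(1)]] by blast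
      from idempotent_splits[OF this e]
      show "\<exists>Y. \<exists>a\<in>Hom C X Y. \<exists>b\<in>Hom C Y X. a \<cdot> b = Ident C Y \<and> b \<cdot> a = e" .
    qed
  qed simp_all
  ultimately show ?thesis unfolding Let_def by (intro exI[of _ ?w]) simp
qed

end

section \<open>Dual Brown representability\<close>

text \<open>Dual Brown representability concerns functors whose values are groups on subsets of the universe
  \<open>'u\<close>. Small groups of any other type are transported along an injection into it.\<close>

definition transport_group :: "('a \<Rightarrow> 'u) \<Rightarrow> 'a monoid \<Rightarrow> 'u monoid"
  where "transport_group e G = \<lparr>carrier = e ` carrier G,
    monoid.mult = (\<lambda>u v. e (inv_into (carrier G) e u \<otimes>\<^bsub>G\<^esub> inv_into (carrier G) e v)), one = e \<one>\<^bsub>G\<^esub>\<rparr>"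

lemma transport_group_simps [simp]:
  "carrier (transport_group e G) = e ` carrier G"
  "one (transport_group e G) = e \<one>\<^bsub>G\<^esub>"
  by (simp_all add: transport_group_def)

lemma transport_group_mult [simp]:
  assumes "inj_on e (carrier G)" "x \<in> carrier G" "y \<in> carrier G"
  shows "e x \<otimes>\<^bsub>transport_group e G\<^esub> e y = e (x \<otimes>\<^bsub>G\<^esub> y)"
  using assms by (simp add: transport_group_def)

lemma comm_group_transport:
  assumes "comm_group G" "inj_on e (carrier G)"
  shows "comm_group (transport_group e G)"
proof -
  interpret G: comm_group G by fact
  show ?thesis
  proof (rule comm_groupI)
    fix x assume "x \<in> carrier (transport_group e G)"
    then obtain a where a: "a \<in> carrier G" "x = e a" by auto
    have "e (inv\<^bsub>G\<^esub> a) \<otimes>\<^bsub>transport_group e G\<^esub> x = \<one>\<^bsub>transport_group e G\<^esub>"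
      using a assms(2) by simp
    then show "\<exists>y\<in>carrier (transport_group e G). y \<otimes>\<^bsub>transport_group e G\<^esub> x = \<one>\<^bsub>transport_group e G\<^esub>"
      using a by (intro bexI[of _ "e (inv\<^bsub>G\<^esub> a)"]) auto
  qed (use assms(2) in \<open>auto simp: G.m_ac\<close>)
qed

context triangulated_category
begin

lemma dual_Brown_corepresents:
  fixes GO :: "'o \<Rightarrow> 'a monoid" and GM :: "'m \<Rightarrow> 'a \<Rightarrow> 'a"
  assumes dB: "dual_Brown_representability TYPE('u) C"
    and grp: "\<And>X. X \<in> Obj C \<Longrightarrow> comm_group (GO X)"
    and sm: "\<And>X. X \<in> Obj C \<Longrightarrow> small TYPE('u) (carrier (GO X))"
    and map: "\<And>f X Y. f \<in> Hom C X Y \<Longrightarrow> GM f \<in> hom (GO X) (GO Y)"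
    and ident: "\<And>X x. X \<in> Obj C \<Longrightarrow> x \<in> carrier (GO X) \<Longrightarrow> GM (Ident C X) x = x"
    and comp: "\<And>f g X Y Z x. f \<in> Hom C X Y \<Longrightarrow> g \<in> Hom C Y Z \<Longrightarrow> x \<in> carrier (GO X) \<Longrightarrow>
      GM (g \<cdot> f) x = GM g (GM f x)"
    and add: "\<And>f g X Y x. f \<in> Hom C X Y \<Longrightarrow> g \<in> Hom C X Y \<Longrightarrow> x \<in> carrier (GO X) \<Longrightarrow>
      GM (Add C f g) x = GM f x \<otimes>\<^bsub>GO Y\<^esub> GM g x"
    and exact: "\<And>X Y Z f g h. distinguished C X Y Z f g h \<Longrightarrow>
      GM f ` carrier (GO X) = kernel (GO Y) (GO Z) (GM g)"
    and products: "\<And>(I :: 'u set) X S \<pi>. small TYPE('u) I \<Longrightarrow> (\<And>i. i \<in> I \<Longrightarrow> X i \<in> Obj C) \<Longrightarrow>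
      is_product C I X S \<pi> \<Longrightarrow>
      bij_betw (\<lambda>x. \<lambda>i \<in> I. GM (\<pi> i) x) (carrier (GO S)) (\<Pi>\<^sub>E i \<in> I. carrier (GO (X i)))"
  shows "\<exists>A \<in> Obj C. \<exists>\<eta>. (\<forall>X \<in> Obj C. bij_betw (\<eta> X) (Hom C A X) (carrier (GO X))) \<and>
    (\<forall>X Y. \<forall>f \<in> Hom C X Y. \<forall>a \<in> Hom C A X. \<eta> Y (f \<cdot> a) = GM f (\<eta> X a))"
proof -
  have "\<forall>X \<in> Obj C. \<exists>e. inj_on e (carrier (GO X)) \<and> e ` carrier (GO X) \<subseteq> (UNIV :: 'u set)"
    using lesspoll_imp_lepoll[OF sm[unfolded small_def]] unfolding lepoll_def by blast
  then obtain enc where enc: "\<And>X. X \<in> Obj C \<Longrightarrow> inj_on (enc X :: 'a \<Rightarrow> 'u) (carrier (GO X))" by metis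
  define dec where "dec X = inv_into (carrier (GO X)) (enc X)" for X
  define HO where "HO X = transport_group (enc X) (GO X)" for X
  define HM where "HM f u = enc (Cod C f) (GM f (dec (Dom C f) u))" for f u
  have dec: "dec X (enc X x) = x" if "X \<in> Obj C" "x \<in> carrier (GO X)" for X x
    using enc that by (simp add: dec_def)
  have decc: "dec X u \<in> carrier (GO X)" "enc X (dec X u) = u" if "X \<in> Obj C" "u \<in> carrier (HO X)" for X u
    using that dec by (auto simp: HO_def)
  have HM: "HM f (enc X x) = enc Y (GM f x)" if "f \<in> Hom C X Y" "x \<in> carrier (GO X)" for f X Y x
    using that HomD[OF that(1)] dec by (simp add: HM_def)
  have HOc: "carrier (HO X) = enc X ` carrier (GO X)" for X by (simp add: HO_def)
  have mult: "enc X x \<otimes>\<^bsub>HO X\<^esub> enc X y = enc X (x \<otimes>\<^bsub>GO X\<^esub> y)"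
    if "X \<in> Obj C" "x \<in> carrier (GO X)" "y \<in> carrier (GO X)" for X x y
    using enc that by (simp add: HO_def)
  have mapc: "GM f x \<in> carrier (GO Y)" if "f \<in> Hom C X Y" "x \<in> carrier (GO X)" for f X Y x
    using hom_carrier[OF map[OF that(1)]] that(2) by blast
  have "homological_functor C HO HM"
    unfolding homological_functor_def
  proof (intro conjI ballI allI impI)
    fix X assume X: "X \<in> Obj C"
    show "comm_group (HO X)" unfolding HO_def by (rule comm_group_transport[OF grp[OF X] enc[OF X]])
    show "small TYPE('u) (carrier (HO X))"
      unfolding small_def HOc by (rule lesspoll_trans1[OF image_lepoll sm[OF X, unfolded small_def]])
    show "HM (Ident C X) u = u" if "u \<in> carrier (HO X)" for u
      using that HM[OF ident_in[OF X]] ident[OF X] by (auto simp: HOc)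
  next
    fix X Y f assume f: "f \<in> Hom C X Y"
    note O = HomD(4,5)[OF f]
    show "HM f \<in> hom (HO X) (HO Y)"
    proof (rule homI)
      fix u v assume "u \<in> carrier (HO X)" "v \<in> carrier (HO X)"
      then obtain x y where "x \<in> carrier (GO X)" "y \<in> carrier (GO X)" "u = enc X x" "v = enc X y"
        by (auto simp: HOc)
      moreover from this have "x \<otimes>\<^bsub>GO X\<^esub> y \<in> carrier (GO X)"
        using grp[OF O(1)] by (meson comm_group.axioms(2) group.is_monoid monoid.m_closed)
      ultimately show "HM f (u \<otimes>\<^bsub>HO X\<^esub> v) = HM f u \<otimes>\<^bsub>HO Y\<^esub> HM f v"
        using mapc[OF f] O HM[OF f] by (simp add: mult hom_mult[OF map[OF f]])
    qed (use HM[OF f] mapc[OF f] in \<open>auto simp: HOc\<close>)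
    show "HM (Add C f g) u = HM f u \<otimes>\<^bsub>HO Y\<^esub> HM g u" if g: "g \<in> Hom C X Y" and u: "u \<in> carrier (HO X)" for g u
    proof -
      obtain x where x: "x \<in> carrier (GO X)" "u = enc X x" using u by (auto simp: HOc)
      have "Add C f g \<in> Hom C X Y" using f g by (simp add: Hom_iff)
      then show ?thesis using HM x f g mapc O by (simp add: mult add[OF f g])
    qed
    show "HM (g \<cdot> f) u = HM g (HM f u)" if g: "g \<in> Hom C Y Z" and u: "u \<in> carrier (HO X)" for g Z u
      using HM[OF f] HM[OF g] HM[OF comp_in[OF f g]] mapc[OF f] comp[OF f g] u by (auto simp: HOc)
  next
    fix X Y Z f g h assume d: "distinguished C X Y Z f g h"
    note D = distD[OF d]
    interpret GZ: comm_group "GO Z" using grp D by simp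
    have "HM f ` carrier (HO X) = enc Y ` (GM f ` carrier (GO X))"
      using HM[OF D(1)] by (force simp: HOc)
    also have "\<dots> = kernel (HO Y) (HO Z) (HM g)"
      unfolding exact[OF d] kernel_def
      using HM[OF D(2)] mapc[OF D(2)] inj_onD[OF enc[OF D(6)]] GZ.one_closed
      by (auto simp: HOc HO_def)
    finally show "HM f ` carrier (HO X) = kernel (HO Y) (HO Z) (HM g)" .
  qed
  moreover have "respects_products C HO HM"
    unfolding respects_products_def
  proof (intro allI impI)
    fix I :: "'u set" and X S \<pi>
    assume I: "small TYPE('u) I" and X: "\<forall>i\<in>I. X i \<in> Obj C" and S: "is_product C I X S \<pi>"
    have SO: "S \<in> Obj C" and \<pi>: "\<And>i. i \<in> I \<Longrightarrow> \<pi> i \<in> Hom C S (X i)"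
      using S by (auto simp: is_product_def)
    have b1: "bij_betw (dec S) (carrier (HO S)) (carrier (GO S))"
      by (rule bij_betw_byWitness[where f' = "enc S"]) (use decc[OF SO] dec[OF SO] in \<open>auto simp: HOc\<close>)
    have b2: "bij_betw (\<lambda>x. \<lambda>i \<in> I. GM (\<pi> i) x) (carrier (GO S)) (\<Pi>\<^sub>E i \<in> I. carrier (GO (X i)))"
      by (rule products[OF I _ S]) (use X in blast)
    have b3: "bij_betw (\<lambda>y. \<lambda>i \<in> I. enc (X i) (y i)) (\<Pi>\<^sub>E i \<in> I. carrier (GO (X i))) (\<Pi>\<^sub>E i \<in> I. carrier (HO (X i)))"
    proof (rule bij_betw_byWitness[where f' = "\<lambda>y. \<lambda>i \<in> I. dec (X i) (y i)"])
      have m: "y \<in> (\<Pi>\<^sub>E i\<in>I. carrier (GO (X i))) \<Longrightarrow> i \<in> I \<Longrightarrow> y i \<in> carrier (GO (X i))"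
        "y' \<in> (\<Pi>\<^sub>E i\<in>I. carrier (HO (X i))) \<Longrightarrow> i \<in> I \<Longrightarrow> y' i \<in> carrier (HO (X i))" for y y' i
        by auto
      show "\<forall>y\<in>\<Pi>\<^sub>E i\<in>I. carrier (GO (X i)). (\<lambda>i\<in>I. dec (X i) ((\<lambda>i\<in>I. enc (X i) (y i)) i)) = y"
        using X dec by (auto intro!: PiE_ext[of _ I "\<lambda>i. carrier (GO (X i))"] simp: m)
      show "\<forall>y\<in>\<Pi>\<^sub>E i\<in>I. carrier (HO (X i)). (\<lambda>i\<in>I. enc (X i) ((\<lambda>i\<in>I. dec (X i) (y i)) i)) = y"
        using X decc by (auto intro!: PiE_ext[of _ I "\<lambda>i. carrier (HO (X i))"] simp: m)
      show "(\<lambda>y. \<lambda>i\<in>I. enc (X i) (y i)) ` (\<Pi>\<^sub>E i\<in>I. carrier (GO (X i))) \<subseteq> (\<Pi>\<^sub>E i\<in>I. carrier (HO (X i)))"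
        by (auto simp: HOc m)
      show "(\<lambda>y. \<lambda>i\<in>I. dec (X i) (y i)) ` (\<Pi>\<^sub>E i\<in>I. carrier (HO (X i))) \<subseteq> (\<Pi>\<^sub>E i\<in>I. carrier (GO (X i)))"
        using X decc by (auto simp: m)
    qed
    have b: "bij_betw ((\<lambda>y. \<lambda>i \<in> I. enc (X i) (y i)) \<circ> ((\<lambda>x. \<lambda>i \<in> I. GM (\<pi> i) x) \<circ> dec S))
        (carrier (HO S)) (\<Pi>\<^sub>E i \<in> I. carrier (HO (X i)))"
      by (intro bij_betw_trans[OF bij_betw_trans[OF b1 b2] b3])
    show "bij_betw (\<lambda>x. \<lambda>i \<in> I. HM (\<pi> i) x) (carrier (HO S)) (\<Pi>\<^sub>E i \<in> I. carrier (HO (X i)))"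
    proof (rule bij_betw_cong[THEN iffD1, OF _ b])
      fix u assume "u \<in> carrier (HO S)"
      show "((\<lambda>y. \<lambda>i \<in> I. enc (X i) (y i)) \<circ> ((\<lambda>x. \<lambda>i \<in> I. GM (\<pi> i) x) \<circ> dec S)) u = (\<lambda>i \<in> I. HM (\<pi> i) u)"
        using HomD[OF \<pi>] by (auto simp: HM_def intro!: restrict_ext)
    qed
  qed
  ultimately have "corepresentable C HO HM"
    using dB by (auto simp: dual_Brown_representability_def)
  then obtain A \<eta> where A: "A \<in> Obj C" and iso: "\<And>X. X \<in> Obj C \<Longrightarrow> \<eta> X \<in> iso (hom_group C A X) (HO X)"
    and nat: "\<And>X Y f a. f \<in> Hom C X Y \<Longrightarrow> a \<in> Hom C A X \<Longrightarrow> \<eta> Y (f \<cdot> a) = HM f (\<eta> X a)"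
    unfolding corepresentable_def by metis
  have bij: "bij_betw (\<eta> X) (Hom C A X) (carrier (HO X))" if "X \<in> Obj C" for X
    using iso[OF that] by (simp add: iso_def)
  have "bij_betw (dec X \<circ> \<eta> X) (Hom C A X) (carrier (GO X))" if X: "X \<in> Obj C" for X
    by (rule bij_betw_trans[OF bij[OF X]], rule bij_betw_byWitness[where f' = "enc X"])
      (use decc[OF X] dec[OF X] in \<open>auto simp: HOc\<close>)
  moreover have "(dec Y \<circ> \<eta> Y) (f \<cdot> a) = GM f ((dec X \<circ> \<eta> X) a)"
    if f: "f \<in> Hom C X Y" and a: "a \<in> Hom C A X" for X Y f a
  proof -
    note O = HomD[OF f]
    have "\<eta> X a \<in> carrier (HO X)" using bij[OF O(4)] a by (auto simp: bij_betw_def)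
    from decc(1)[OF O(4) this] show ?thesis
      using nat[OF f a] O dec[OF O(5) mapc[OF f]] by (simp add: HM_def)
  qed
  ultimately show ?thesis using A by (intro bexI[of _ A] exI[of _ "\<lambda>X. dec X \<circ> \<eta> X"]) auto
qed

text \<open>The families embed into a single small hom-set: with \<open>Z\<close> the product of the \<open>X i\<close> and \<open>W\<close> the
  \<open>I\<close>-fold power of \<open>Y\<close>, a family \<open>f i : X i \<rightarrow> Y\<close> is encoded by the map \<open>Z \<rightarrow> W\<close> with components
  \<open>f i \<pi> i\<close>. It can be recovered because each \<open>\<pi> i\<close> is a split epimorphism.\<close>

lemma small_hom_product:
  fixes I :: "'u set"
  assumes ls: "locally_small TYPE('u) C" and cs: "cosmashing TYPE('u) C" and I: "small TYPE('u) I"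
    and X: "\<And>i. i \<in> I \<Longrightarrow> X i \<in> Obj C" and Y: "Y \<in> Obj C"
  shows "small TYPE('u) (\<Pi>\<^sub>E i\<in>I. Hom C (X i) Y)"
proof -
  obtain Z \<pi> where Z: "is_product C I X Z \<pi>" using cs I X unfolding cosmashing_def by blast
  obtain W \<rho> where W: "is_product C I (\<lambda>_. Y) W \<rho>" using cs I Y unfolding cosmashing_def by (metis (no_types))
  note z = is_productD[OF Z] and w = is_productD[OF W]
  have "\<exists>\<sigma>. \<sigma> \<in> Hom C (X i) Z \<and> \<pi> i \<cdot> \<sigma> = Ident C (X i)" if i: "i \<in> I" for i
  proof -
    have "(if j = i then Ident C (X i) else Zero C (X i) (X j)) \<in> Hom C (X i) (X j)" if "j \<in> I" for j
      using X[OF i] X[OF that] by (simp add: Hom_iff)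
    from z(3)[OF X[OF i] this] obtain \<sigma> where "\<sigma> \<in> Hom C (X i) Z"
      "\<forall>j\<in>I. \<pi> j \<cdot> \<sigma> = (if j = i then Ident C (X i) else Zero C (X i) (X j))" by blast
    then show ?thesis using i by auto
  qed
  then obtain \<sigma> where \<sigma>: "\<And>i. i \<in> I \<Longrightarrow> \<sigma> i \<in> Hom C (X i) Z" "\<And>i. i \<in> I \<Longrightarrow> \<pi> i \<cdot> \<sigma> i = Ident C (X i)" by metis
  have "\<forall>f \<in> (\<Pi>\<^sub>E i\<in>I. Hom C (X i) Y). \<exists>g. g \<in> Hom C Z W \<and> (\<forall>i \<in> I. \<rho> i \<cdot> g = f i \<cdot> \<pi> i)"
  proof
    fix f assume f: "f \<in> (\<Pi>\<^sub>E i\<in>I. Hom C (X i) Y)"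
    have "f i \<cdot> \<pi> i \<in> Hom C Z Y" if "i \<in> I" for i using comp_in[OF z(2)[OF that]] f that by auto
    from w(3)[OF z(1), of "\<lambda>i. f i \<cdot> \<pi> i", OF this] show "\<exists>g. g \<in> Hom C Z W \<and> (\<forall>i \<in> I. \<rho> i \<cdot> g = f i \<cdot> \<pi> i)" by blast
  qed
  then obtain m where m: "\<And>f. f \<in> (\<Pi>\<^sub>E i\<in>I. Hom C (X i) Y) \<Longrightarrow> m f \<in> Hom C Z W"
    "\<And>f i. f \<in> (\<Pi>\<^sub>E i\<in>I. Hom C (X i) Y) \<Longrightarrow> i \<in> I \<Longrightarrow> \<rho> i \<cdot> m f = f i \<cdot> \<pi> i" by metis
  have rec: "f i = (\<rho> i \<cdot> m f) \<cdot> \<sigma> i" if f: "f \<in> (\<Pi>\<^sub>E i\<in>I. Hom C (X i) Y)" and i: "i \<in> I" for f i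
  proof -
    have fi: "f i \<in> Hom C (X i) Y" using f i by auto
    have "(f i \<cdot> \<pi> i) \<cdot> \<sigma> i = f i \<cdot> (\<pi> i \<cdot> \<sigma> i)" by (rule comp_assoc[OF \<sigma>(1)[OF i] z(2)[OF i] fi])
    then show ?thesis unfolding m(2)[OF f i] \<sigma>(2)[OF i] using comp_ident_right[OF fi] by simp
  qed
  have "inj_on m (\<Pi>\<^sub>E i\<in>I. Hom C (X i) Y)"
  proof (rule inj_onI)
    fix f g assume f: "f \<in> (\<Pi>\<^sub>E i\<in>I. Hom C (X i) Y)" and g: "g \<in> (\<Pi>\<^sub>E i\<in>I. Hom C (X i) Y)" and eq: "m f = m g"
    show "f = g"
    proof (rule PiE_ext[OF f g])
      fix i assume i: "i \<in> I"
      show "f i = g i" unfolding rec[OF f i] rec[OF g i] eq ..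
    qed
  qed
  then have "(\<Pi>\<^sub>E i\<in>I. Hom C (X i) Y) \<lesssim> Hom C Z W" using m(1) unfolding lepoll_def by blast
  moreover have "Hom C Z W \<prec> (UNIV :: 'u set)" using ls z(1) w(1) by (simp add: locally_small_def small_def)
  ultimately show ?thesis unfolding small_def by (rule lesspoll_trans1)
qed

text \<open>The coproduct of the \<open>X i\<close> corepresents \<open>Y \<mapsto> \<Prod>\<^sub>i C(X i, Y)\<close>; its structure maps are the image of
  the identity.\<close>

lemma smashing_of_dual_Brown:
  assumes ls: "locally_small TYPE('u) C" and dB: "dual_Brown_representability TYPE('u) C"
  shows "smashing TYPE('u) C"
  unfolding smashing_def
proof (intro allI impI)
  fix I :: "'u set" and X assume I: "small TYPE('u) I" and X': "\<forall>i\<in>I. X i \<in> Obj C"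
  then have X: "\<And>i. i \<in> I \<Longrightarrow> X i \<in> Obj C" by blast
  have cs: "cosmashing TYPE('u) C" using dB by (simp add: dual_Brown_representability_def)
  define GO where "GO Y = product_group I (\<lambda>i. hom_group C (X i) Y)" for Y
  define GM where "GM f x = (\<lambda>i\<in>I. f \<cdot> x i)" for f and x :: "'u \<Rightarrow> 'm"
  have car: "carrier (GO Y) = (\<Pi>\<^sub>E i\<in>I. Hom C (X i) Y)" for Y by (simp add: GO_def)
  have mult: "x \<otimes>\<^bsub>GO Y\<^esub> y = (\<lambda>i\<in>I. Add C (x i) (y i))" for x y Y by (simp add: GO_def)
  have one: "\<one>\<^bsub>GO Y\<^esub> = (\<lambda>i\<in>I. Zero C (X i) Y)" for Y by (simp add: GO_def)
  have mem: "x i \<in> Hom C (X i) Y" if "x \<in> carrier (GO Y)" "i \<in> I" for x Y i using that by (auto simp: car)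
  have GMc: "GM f x \<in> carrier (GO Z)" if "f \<in> Hom C Y Z" "x \<in> carrier (GO Y)" for f x Y Z
    using comp_in[OF mem[OF that(2)] that(1)] by (simp add: GM_def car)
  have ext: "x = y" if "x \<in> carrier (GO Y)" "y \<in> carrier (GO Y)" "\<And>i. i \<in> I \<Longrightarrow> x i = y i" for x y Y
    using that unfolding car by (rule PiE_ext)
  have "\<exists>A \<in> Obj C. \<exists>\<eta>. (\<forall>Y \<in> Obj C. bij_betw (\<eta> Y) (Hom C A Y) (carrier (GO Y))) \<and>
    (\<forall>Y Z. \<forall>f \<in> Hom C Y Z. \<forall>a \<in> Hom C A Y. \<eta> Z (f \<cdot> a) = GM f (\<eta> Y a))"
  proof (rule dual_Brown_corepresents[OF dB])
    fix Y assume Y: "Y \<in> Obj C"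
    have "group (hom_group C (X i) Y)" if "i \<in> I" for i
      using hom_comm_group[OF X[OF that] Y] by (rule comm_group.axioms(2))
    then interpret G: group "GO Y" unfolding GO_def by simp
    show "comm_group (GO Y)"
    proof (rule G.group_comm_groupI)
      fix x y assume "x \<in> carrier (GO Y)" "y \<in> carrier (GO Y)"
      then show "x \<otimes>\<^bsub>GO Y\<^esub> y = y \<otimes>\<^bsub>GO Y\<^esub> x"
        using mem by (auto simp: mult Hom_iff intro!: restrict_ext add_comm)
    qed
    show "small TYPE('u) (carrier (GO Y))" unfolding car by (rule small_hom_product[OF ls cs I X Y])
    show "GM (Ident C Y) x = x" if "x \<in> carrier (GO Y)" for x
      by (rule ext[OF GMc[OF ident_in[OF Y] that] that]) (use mem[OF that] in \<open>simp add: GM_def Hom_iff\<close>)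
  next
    fix f Y Z assume f: "f \<in> Hom C Y Z"
    show "GM f \<in> hom (GO Y) (GO Z)"
    proof (rule homI)
      show "GM f x \<in> carrier (GO Z)" if "x \<in> carrier (GO Y)" for x using GMc[OF f that] .
      fix x y assume "x \<in> carrier (GO Y)" "y \<in> carrier (GO Y)"
      then show "GM f (x \<otimes>\<^bsub>GO Y\<^esub> y) = GM f x \<otimes>\<^bsub>GO Z\<^esub> GM f y"
        using mem f by (auto simp: mult GM_def Hom_iff comp_add intro!: restrict_ext)
    qed
    show "GM (Add C f g) x = GM f x \<otimes>\<^bsub>GO Z\<^esub> GM g x" if "g \<in> Hom C Y Z" "x \<in> carrier (GO Y)" for g x
      using mem[OF that(2)] f that(1) by (auto simp: mult GM_def Hom_iff add_comp intro!: restrict_ext)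
    show "GM (g \<cdot> f) x = GM g (GM f x)" if "g \<in> Hom C Z W" "x \<in> carrier (GO Y)" for g x W
      using mem[OF that(2)] f that(1) by (auto simp: GM_def Hom_iff assoc intro!: restrict_ext)
  next
    fix Y Z W f g h assume d: "distinguished C Y Z W f g h"
    note D = distD[OF d]
    show "GM f ` carrier (GO Y) = kernel (GO Z) (GO W) (GM g)"
    proof (intro subset_antisym subsetI)
      fix z assume "z \<in> GM f ` carrier (GO Y)"
      then obtain x where x: "x \<in> carrier (GO Y)" "z = GM f x" by blast
      have "GM g (GM f x) = (\<lambda>i\<in>I. Zero C (X i) W)"
        unfolding GM_def
      proof (rule restrict_ext)
        fix i assume i: "i \<in> I"
        note xi = mem[OF x(1) i, unfolded Hom_iff]
        have "g \<cdot> (f \<cdot> x i) = (g \<cdot> f) \<cdot> x i" using xi D by (simp add: Hom_iff assoc)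
        then show "g \<cdot> (\<lambda>i\<in>I. f \<cdot> x i) i = Zero C (X i) W"
          unfolding dist_comp_zero[OF d] using xi D i by (simp add: Hom_iff)
      qed
      then show "z \<in> kernel (GO Z) (GO W) (GM g)" using x GMc[OF D(1)] by (simp add: kernel_def one)
    next
      fix z assume z: "z \<in> kernel (GO Z) (GO W) (GM g)"
      then have zc: "z \<in> carrier (GO Z)" and z0: "GM g z = (\<lambda>i\<in>I. Zero C (X i) W)" by (simp_all add: kernel_def one)
      have "\<exists>x. x \<in> Hom C (X i) Y \<and> z i = f \<cdot> x" if i: "i \<in> I" for i
      proof -
        have "g \<cdot> z i = Zero C (X i) W" using fun_cong[OF z0, of i] i by (simp add: GM_def)
        from lift_along_f[OF d mem[OF zc i] this] show ?thesis by blast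
      qed
      then obtain x where x: "\<And>i. i \<in> I \<Longrightarrow> x i \<in> Hom C (X i) Y" "\<And>i. i \<in> I \<Longrightarrow> z i = f \<cdot> x i" by metis
      define x' where "x' = (\<lambda>i\<in>I. x i)"
      have x': "x' \<in> carrier (GO Y)" using x(1) by (simp add: x'_def car)
      have "z = GM f x'" by (rule ext[OF zc GMc[OF D(1) x']]) (simp add: GM_def x'_def x(2))
      then show "z \<in> GM f ` carrier (GO Y)" using x' by blast
    qed
  next
    fix J :: "'u set" and Y S \<pi> assume Y: "\<And>j. j \<in> J \<Longrightarrow> Y j \<in> Obj C" and S: "is_product C J Y S \<pi>"
    note s = is_productD[OF S]
    show "bij_betw (\<lambda>x. \<lambda>j\<in>J. GM (\<pi> j) x) (carrier (GO S)) (\<Pi>\<^sub>E j\<in>J. carrier (GO (Y j)))"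
      unfolding bij_betw_def
    proof (intro conjI inj_onI subset_antisym subsetI)
      fix x y assume x: "x \<in> carrier (GO S)" and y: "y \<in> carrier (GO S)"
        and eq: "(\<lambda>j\<in>J. GM (\<pi> j) x) = (\<lambda>j\<in>J. GM (\<pi> j) y)"
      show "x = y"
      proof (rule ext[OF x y])
        fix i assume i: "i \<in> I"
        show "x i = y i"
        proof (rule product_eqI[OF S mem[OF x i] mem[OF y i]])
          fix j assume j: "j \<in> J"
          have "GM (\<pi> j) x = GM (\<pi> j) y" using fun_cong[OF eq, of j] j by simp
          from fun_cong[OF this, of i] show "\<pi> j \<cdot> x i = \<pi> j \<cdot> y i" using i by (simp add: GM_def)
        qed
      qed
    next
      fix z assume "z \<in> (\<lambda>x. \<lambda>j\<in>J. GM (\<pi> j) x) ` carrier (GO S)"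
      then show "z \<in> (\<Pi>\<^sub>E j\<in>J. carrier (GO (Y j)))" using GMc[OF s(2)] by auto
    next
      fix z assume z: "z \<in> (\<Pi>\<^sub>E j\<in>J. carrier (GO (Y j)))"
      have zj: "z j i \<in> Hom C (X i) (Y j)" if "i \<in> I" "j \<in> J" for i j
        using mem[OF _ that(1), of "z j" "Y j"] z that(2) by auto
      have "\<exists>x. x \<in> Hom C (X i) S \<and> (\<forall>j\<in>J. \<pi> j \<cdot> x = z j i)" if i: "i \<in> I" for i
        using s(3)[OF X[OF i] zj[OF i]] by blast
      then obtain x where x: "\<And>i. i \<in> I \<Longrightarrow> x i \<in> Hom C (X i) S"
        "\<And>i j. i \<in> I \<Longrightarrow> j \<in> J \<Longrightarrow> \<pi> j \<cdot> x i = z j i" by metis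
      define x' where "x' = (\<lambda>i\<in>I. x i)"
      have x': "x' \<in> carrier (GO S)" using x(1) by (simp add: x'_def car)
      have "(\<lambda>j\<in>J. GM (\<pi> j) x') = z"
      proof (rule PiE_ext[OF _ z])
        show "(\<lambda>j\<in>J. GM (\<pi> j) x') \<in> (\<Pi>\<^sub>E j\<in>J. carrier (GO (Y j)))" using GMc[OF s(2) x'] by auto
        fix j assume j: "j \<in> J"
        have "GM (\<pi> j) x' = z j"
          by (rule ext[OF GMc[OF s(2)[OF j] x']]) (use z j x(2) in \<open>auto simp: GM_def x'_def\<close>)
        then show "(\<lambda>j\<in>J. GM (\<pi> j) x') j = z j" using j by simp
      qed
      then show "z \<in> (\<lambda>x. \<lambda>j\<in>J. GM (\<pi> j) x) ` carrier (GO S)" using x' by blast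
    qed
  qed
  then obtain A \<eta> where A: "A \<in> Obj C" and bij: "\<And>Y. Y \<in> Obj C \<Longrightarrow> bij_betw (\<eta> Y) (Hom C A Y) (carrier (GO Y))"
    and nat: "\<And>Y Z f a. f \<in> Hom C Y Z \<Longrightarrow> a \<in> Hom C A Y \<Longrightarrow> \<eta> Z (f \<cdot> a) = GM f (\<eta> Y a)" by metis
  define \<iota> where "\<iota> = \<eta> A (Ident C A)"
  have \<iota>c: "\<iota> \<in> carrier (GO A)" unfolding \<iota>_def using bij[OF A] ident_in[OF A] by (auto simp: bij_betw_def)
  have \<eta>: "\<eta> Y g = (\<lambda>i\<in>I. g \<cdot> \<iota> i)" if g: "g \<in> Hom C A Y" for g Y
    using nat[OF g ident_in[OF A]] comp_ident_right[OF g] unfolding \<iota>_def GM_def by simp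
  have "is_coproduct C I X A \<iota>"
  proof (rule is_coproductI[OF A mem[OF \<iota>c]])
    fix Y assume Y: "Y \<in> Obj C"
    show "\<exists>g\<in>Hom C A Y. \<forall>i\<in>I. g \<cdot> \<iota> i = f i" if f: "\<And>i. i \<in> I \<Longrightarrow> f i \<in> Hom C (X i) Y" for f
    proof -
      have "(\<lambda>i\<in>I. f i) \<in> carrier (GO Y)" using f by (simp add: car)
      then obtain g where g: "g \<in> Hom C A Y" "\<eta> Y g = (\<lambda>i\<in>I. f i)"
        using bij[OF Y] unfolding bij_betw_def by (metis imageE)
      have "g \<cdot> \<iota> i = f i" if i: "i \<in> I" for i
        using fun_cong[OF g(2)[unfolded \<eta>[OF g(1)]], of i] i by simp
      then show ?thesis using g(1) by blast
    qed
    show "g = g'" if g: "g \<in> Hom C A Y" "g' \<in> Hom C A Y" "\<And>i. i \<in> I \<Longrightarrow> g \<cdot> \<iota> i = g' \<cdot> \<iota> i" for g g'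
    proof -
      have "\<eta> Y g = \<eta> Y g'" unfolding \<eta>[OF g(1)] \<eta>[OF g(2)] using g(3) by (rule restrict_ext)
      then show ?thesis using bij[OF Y] g(1,2) by (auto simp: bij_betw_def dest: inj_onD)
    qed
  qed
  then show "\<exists>S \<iota>. is_coproduct C I X S \<iota>" by blast
qed

end

section \<open>Lifting projectives by dual Brown representability\<close>

context triangulated_category
begin

lemma is_product_iso:
  assumes S: "is_product C I X S \<pi>" and c: "c \<in> Hom C S' S" "c' \<in> Hom C S S'"
    "c \<cdot> c' = Ident C S" "c' \<cdot> c = Ident C S'"
  shows "is_product C I X S' (\<lambda>i. \<pi> i \<cdot> c)"
proof (rule is_productI)
  note s = is_productD[OF S]
  note cc = c(1,2)[unfolded Hom_iff]
  show "S' \<in> Obj C" using HomD[OF c(1)] by simp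
  show "\<pi> i \<cdot> c \<in> Hom C S' (X i)" if "i \<in> I" for i using comp_in[OF c(1) s(2)[OF that]] .
  fix Y assume Y: "Y \<in> Obj C"
  show "\<exists>g\<in>Hom C Y S'. \<forall>i\<in>I. (\<pi> i \<cdot> c) \<cdot> g = f i" if f: "\<And>i. i \<in> I \<Longrightarrow> f i \<in> Hom C Y (X i)" for f
  proof -
    obtain g where g: "g \<in> Hom C Y S" "\<And>i. i \<in> I \<Longrightarrow> \<pi> i \<cdot> g = f i" using s(3)[OF Y f] by blast
    have "(\<pi> i \<cdot> c) \<cdot> (c' \<cdot> g) = f i" if i: "i \<in> I" for i
    proof -
      note h = cc g(1)[unfolded Hom_iff] s(2)[OF i, unfolded Hom_iff]
      have "(\<pi> i \<cdot> c) \<cdot> (c' \<cdot> g) = \<pi> i \<cdot> ((c \<cdot> c') \<cdot> g)" using h by (simp add: assoc)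
      then show ?thesis unfolding c(3) using h g(2)[OF i] by simp
    qed
    then show ?thesis using comp_in[OF g(1) c(2)] by blast
  qed
  show "g = g'" if g: "g \<in> Hom C Y S'" "g' \<in> Hom C Y S'"
    and eq: "\<And>i. i \<in> I \<Longrightarrow> (\<pi> i \<cdot> c) \<cdot> g = (\<pi> i \<cdot> c) \<cdot> g'" for g g'
  proof -
    have "c \<cdot> g = c \<cdot> g'"
    proof (rule product_eqI[OF S comp_in[OF g(1) c(1)] comp_in[OF g(2) c(1)]])
      fix i assume i: "i \<in> I"
      show "\<pi> i \<cdot> (c \<cdot> g) = \<pi> i \<cdot> (c \<cdot> g')"
        using eq[OF i] cc g[unfolded Hom_iff] s(2)[OF i, unfolded Hom_iff] by (simp add: assoc)
    qed
    then have "c' \<cdot> (c \<cdot> g) = c' \<cdot> (c \<cdot> g')" by simp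
    then have "(c' \<cdot> c) \<cdot> g = (c' \<cdot> c) \<cdot> g'" using cc g[unfolded Hom_iff] by (simp add: assoc)
    then show ?thesis unfolding c(4) using g[unfolded Hom_iff] by simp
  qed
qed

end

context t_structure
begin

text \<open>A map \<open>u : P \<rightarrow> B[1]\<close> classifies an extension \<open>B \<rightarrow> E \<rightarrow> P\<close> inside the heart. The map \<open>E \<rightarrow> P\<close> is an
  epimorphism of the heart, hence splits, so \<open>u = 0\<close>.\<close>

lemma projective_perp_shifted_heart:
  assumes P: "projective heart P" and B: "B \<in> LE0 t" "B \<in> GE0 t"
  shows "perp C P (ShO C 1 B)"
proof -
  have P': "P \<in> LE0 t" "P \<in> GE0 t" using P by (simp_all add: projective_def)
  have O: "P \<in> Obj C" "B \<in> Obj C" using P' B t_le_obj by auto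
  show ?thesis
  proof (subst perp_iff)
    show "\<forall>u\<in>Hom C P (ShO C 1 B). u = Zero C P (ShO C 1 B)"
    proof
      fix u assume u: "u \<in> Hom C P (ShO C 1 B)"
      obtain Q v w where Q: "distinguished C P (ShO C 1 B) Q u v w" using TR1_cone[OF u] by blast
      define E where "E = ShO C (-1) Q"
      define k where "k = Neg C (ShM C (-1) w)"
      have d: "distinguished C E P (ShO C 1 B) k u v" using rotate_back[OF Q] by (simp add: E_def k_def)
      have t: "triangle B E P" using triangle_rotate_back[OF triangleI[OF d]] O by simp
      have EH: "E \<in> LE0 t" "E \<in> GE0 t"
        using LE_extension[OF t, of 0] GE_extension[OF t, of 0] P' B by simp_all
      note dD = distD[OF d]
      have k: "k \<in> Hom heart E P" using dD EH P' by simp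
      have "epimorphism heart k"
        unfolding epimorphism_def
      proof (intro conjI allI ballI impI)
        show "k \<in> Arr heart" using k by (simp add: Hom_def)
        fix Z f g assume fg: "f \<in> Hom heart (Cod heart k) Z"
          "g \<in> Hom heart (Cod heart k) Z"
          and eq: "f \<cdot>\<^bsub>heart\<^esub> k = g \<cdot>\<^bsub>heart\<^esub> k"
        have "Cod heart k = P" using dD by (simp add: Hom_iff)
        then have f: "f \<in> Hom C P Z" "g \<in> Hom C P Z" "Z \<in> LE0 t" using fg Hom_heartD by metis+
        note h = f(1,2)[unfolded Hom_iff] dD[unfolded Hom_iff]
        have "sub f g \<in> Hom C P Z" using h by (simp add: Hom_iff)
        moreover have "sub f g \<cdot> k = Zero C E Z" using h eq HomD(5)[OF f(1)] by (simp add: sub_comp)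
        ultimately obtain m where m: "m \<in> Hom C (ShO C 1 B) Z" "sub f g = m \<cdot> u" using extend_along_g[OF d] by blast
        have "ShO C 1 B \<in> GE C t 1" using B by (auto simp: GE_def)
        then have "perp C (ShO C 1 B) Z" using t_perp[of _ 1 Z 0] f(3) by simp
        then have "sub f g = Zero C P Z" using perpD[OF _ m(1)] m(2) h HomD(5)[OF f(1)] by simp
        then show "f = g" using h by (subst (asm) sub_zero_iff) simp_all
      qed
      moreover have "Ident C P \<in> Hom heart P P" using ident_in[OF O(1)] P' by simp
      ultimately have "\<exists>s \<in> Hom heart P E. k \<cdot>\<^bsub>heart\<^esub> s = Ident C P"
        using P k unfolding projective_def by blast
      then obtain s where s: "s \<in> Hom C P E" "k \<cdot> s = Ident C P" by (auto dest: Hom_heartD)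
      note h = s(1)[unfolded Hom_iff] dD[unfolded Hom_iff]
      have "u = u \<cdot> (k \<cdot> s)" unfolding s(2) using h by simp
      also have "\<dots> = (u \<cdot> k) \<cdot> s" using h by (simp add: assoc)
      finally show "u = Zero C P (ShO C 1 B)" unfolding dist_comp_zero[OF d] using h by simp
    qed
  qed (use O in auto)
qed

lemma GE_product:
  assumes cs: "product_closed TYPE('u) C (GE0 t)" and I: "small TYPE('u) (I :: 'u set)"
    and X: "\<And>i. i \<in> I \<Longrightarrow> X i \<in> GE C t n" and S: "is_product C I X S \<pi>"
  shows "S \<in> GE C t n"
proof -
  have "is_product C I (\<lambda>i. ShO C (-n) (X i)) (ShO C (-n) S) (\<lambda>i. ShM C (-n) (\<pi> i))"
    by (rule product_shift[OF S GE_obj[OF X]])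
  moreover have "\<forall>i\<in>I. ShO C (-n) (X i) \<in> GE0 t" using X by (simp add: GE_iff)
  moreover have closed: "Z \<in> GE0 t" if "is_product C I Y Z \<rho>" "\<forall>i\<in>I. Y i \<in> GE0 t" for Y Z \<rho>
    using cs I that unfolding product_closed_def by blast
  ultimately have "ShO C (-n) S \<in> GE0 t" by (intro closed)
  then show ?thesis using is_productD(1)[OF S] by (simp add: GE_iff)
qed

text \<open>The product of the truncation triangles is a triangle whose first term is in \<open>C\<^bsub>t\<ge>1\<^esub>\<close>, by the
  closure assumption, and whose last term is in \<open>C\<^bsub>t\<le>0\<^esub>\<close>, which as a right orthogonal is closed under
  products. So it is the truncation triangle of the product.\<close>

lemma le_trunc_product:
  assumes cs: "cosmashing TYPE('u) C" "product_closed TYPE('u) C (GE0 t)"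
    and I: "small TYPE('u) (I :: 'u set)" and S: "is_product C I Y S \<pi>"
    and y: "\<And>i. i \<in> I \<Longrightarrow> le_trunc (Y i) (Z i) (y i)" and s: "le_trunc S U s"
    and q: "\<And>i. i \<in> I \<Longrightarrow> q i \<in> Hom C U (Z i)" "\<And>i. i \<in> I \<Longrightarrow> q i \<cdot> s = y i \<cdot> \<pi> i"
  shows "is_product C I Z U q"
proof -
  note yD = le_truncD[OF y]
  note sD = is_productD[OF S]
  have "\<forall>i \<in> I. \<exists>T u h. T \<in> GE C t 1 \<and> distinguished C T (Y i) (Z i) u (y i) h"
    using y unfolding le_trunc_def by blast
  then obtain T u h where T: "\<And>i. i \<in> I \<Longrightarrow> T i \<in> GE C t 1"
    "\<And>i. i \<in> I \<Longrightarrow> distinguished C (T i) (Y i) (Z i) (u i) (y i) (h i)" by metis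
  obtain P \<rho> where P: "is_product C I T P \<rho>" using cs(1) I GE_obj[OF T(1)] unfolding cosmashing_def by blast
  note pD = is_productD[OF P]
  have "u i \<cdot> \<rho> i \<in> Hom C P (Y i)" if "i \<in> I" for i using comp_in[OF pD(2) distD(1)[OF T(2)]] that by blast
  from sD(3)[OF pD(1), of "\<lambda>i. u i \<cdot> \<rho> i", OF this]
  obtain F where F: "F \<in> Hom C P S" "\<And>i. i \<in> I \<Longrightarrow> \<pi> i \<cdot> F = u i \<cdot> \<rho> i" by blast
  obtain V v l where V: "distinguished C P S V F v l" using TR1_cone[OF F(1)] by blast
  obtain \<kappa> where \<kappa>: "is_product C I Z V \<kappa>" "\<And>i. i \<in> I \<Longrightarrow> y i \<cdot> \<pi> i = \<kappa> i \<cdot> v"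
    using product_cone[OF P S T(2) F(2)[symmetric] V] by blast
  note kD = is_productD[OF \<kappa>(1)]
  have "V \<in> LE C t 0"
    unfolding LE_iff_perp
  proof (intro conjI ballI)
    show "perp C X V" if X: "X \<in> GE C t (0 + 1)" for X
      by (rule perp_product[OF \<kappa>(1) _ GE_obj[OF X]]) (use yD(4) X in \<open>auto intro: t_perp[of _ 1 _ 0]\<close>)
  qed (rule kD(1))
  moreover have "P \<in> GE C t 1" by (rule GE_product[OF cs(2) I T(1) P])
  ultimately have vt: "le_trunc S V v" using V by (auto simp: le_trunc_def)
  obtain c c' where c: "c \<in> Hom C U V" "c' \<in> Hom C V U" "c \<cdot> s = v" "c' \<cdot> c = Ident C U" "c \<cdot> c' = Ident C V"
    using le_trunc_unique[OF s vt] by blast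
  have eq: "\<kappa> i \<cdot> c = q i" if i: "i \<in> I" for i
  proof (rule le_trunc_cancel[OF s yD(4)[OF i] comp_in[OF c(1) kD(2)[OF i]] q(1)[OF i]])
    show "(\<kappa> i \<cdot> c) \<cdot> s = q i \<cdot> s"
      using comp_assoc[OF le_truncD(1)[OF s] c(1) kD(2)[OF i]] c(3) \<kappa>(2)[OF i] q(2)[OF i] by simp
  qed
  have "is_product C I Z U (\<lambda>i. \<kappa> i \<cdot> c)" by (rule is_product_iso[OF \<kappa>(1) c(1,2,5,4)])
  then show ?thesis unfolding is_product_def using eq by simp
qed

text \<open>Let \<open>W\<close> be the cone of \<open>f0\<close>. Completing the morphism of triangles gives \<open>\<phi> : Z \<rightarrow> W\<close> over the
  truncations, so the composite of \<open>a\<close> with \<open>Y0 \<rightarrow> W \<rightarrow> t\<^bsub>\<le>0\<^esub>W\<close> factors through \<open>g0 a = 0\<close>. Therefore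
  \<open>p a : P \<rightarrow> W\<close> comes from \<open>t\<^bsub>\<ge>1\<^esub>W\<close>. As \<open>W \<in> C\<^bsub>t\<le>1\<^esub>\<close>, this is the shift by one of an object of the heart,
  to which \<open>P\<close> has no maps; so \<open>p a = 0\<close> and \<open>a\<close> lifts to \<open>X0\<close>.\<close>

lemma projective_exact_on_truncations:
  assumes P: "projective heart P" and d: "distinguished C X Y Z f g h"
    and x: "le_trunc X X0 x" and y: "le_trunc Y Y0 y" and z: "le_trunc Z Z0 z"
    and f0: "f0 \<in> Hom C X0 Y0" "f0 \<cdot> x = y \<cdot> f" and g0: "g0 \<in> Hom C Y0 Z0" "g0 \<cdot> y = z \<cdot> g"
    and a: "a \<in> Hom C P Y0" "g0 \<cdot> a = Zero C P Z0"
  shows "\<exists>b \<in> Hom C P X0. a = f0 \<cdot> b"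
proof -
  note xD = le_truncD[OF x] and yD = le_truncD[OF y] and zD = le_truncD[OF z]
  obtain W p q where W: "distinguished C X0 Y0 W f0 p q" using TR1_cone[OF f0(1)] by blast
  note wD = distD[OF W]
  obtain \<phi> where \<phi>: "\<phi> \<in> Hom C Z W" "p \<cdot> y = \<phi> \<cdot> g"
    using TR3[OF d W xD(1) yD(1) f0(2)] by blast
  obtain W0 w where w: "le_trunc W W0 w" using le_trunc_exists[OF wD(6)] by blast
  note wwD = le_truncD[OF w]
  obtain c where c: "c \<in> Hom C Z0 W0" "w \<cdot> \<phi> = c \<cdot> z"
    using le_trunc_factor[OF z wwD(4) comp_in[OF \<phi>(1) wwD(1)]] by blast
  note h = distD(1,2)[OF d, unfolded Hom_iff] xD(1)[unfolded Hom_iff] yD(1)[unfolded Hom_iff]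
    zD(1)[unfolded Hom_iff] wD(1,2)[unfolded Hom_iff] \<phi>(1)[unfolded Hom_iff] wwD(1)[unfolded Hom_iff]
    c(1)[unfolded Hom_iff] g0(1)[unfolded Hom_iff] a(1)[unfolded Hom_iff] HomD(4)[OF a(1)] wwD(3)
  have "(w \<cdot> p) \<cdot> y = (w \<cdot> \<phi>) \<cdot> g" using \<phi>(2) h by (simp add: assoc)
  also have "\<dots> = c \<cdot> (z \<cdot> g)" unfolding c(2) using h by (simp add: assoc)
  also have "\<dots> = (c \<cdot> g0) \<cdot> y" unfolding g0(2)[symmetric] using h by (simp add: assoc)
  finally have wp: "w \<cdot> p = c \<cdot> g0"
    by (rule le_trunc_cancel[OF y wwD(4) comp_in[OF wD(2) wwD(1)] comp_in[OF g0(1) c(1)]])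
  have "w \<cdot> (p \<cdot> a) = (w \<cdot> p) \<cdot> a" using h by (simp add: assoc)
  also have "\<dots> = c \<cdot> (g0 \<cdot> a)" unfolding wp using h by (simp add: assoc)
  finally have wpa: "w \<cdot> (p \<cdot> a) = Zero C P W0" unfolding a(2) using h by simp
  obtain T u v where T: "T \<in> GE C t 1" and dT: "distinguished C T W W0 u w v" using w by (auto simp: le_trunc_def)
  note tD = distD[OF dT]
  obtain m where m: "m \<in> Hom C P T" "p \<cdot> a = u \<cdot> m"
    using lift_along_f[OF dT comp_in[OF a(1) wD(2)] wpa] by blast
  have "W \<in> LE C t 1"
  proof (rule LE_extension[OF triangle_rotate[OF triangleI[OF W]]])
    show "Y0 \<in> LE C t 1" using yD(4) LE_mono[of 0 1] by auto
    show "ShO C 1 X0 \<in> LE C t 1" using xD(4) by (auto simp: LE_def)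
  qed
  moreover have "W0 \<in> LE C t (1 + 1)" using wwD(4) LE_mono[of 0 "1 + 1"] by auto
  ultimately have "T \<in> LE C t 1" by (rule LE_fibre[OF triangleI[OF dT]])
  then have "ShO C (-1) T \<in> LE0 t" by (simp add: LE_iff)
  moreover have "ShO C (-1) T \<in> GE0 t" using T by (simp add: GE_iff)
  ultimately have "perp C P (ShO C 1 (ShO C (-1) T))" by (rule projective_perp_shifted_heart[OF P])
  then have "perp C P T" using tD by simp
  from perpD[OF this m(1)] have "p \<cdot> a = Zero C P W" using m(2) tD h by (simp add: Hom_iff)
  from lift_along_f[OF W a(1) this] show ?thesis by blast
qed

text \<open>Let \<open>A\<close> corepresent \<open>Y \<mapsto> C(P, t\<^bsub>\<le>0\<^esub>Y)\<close>. This functor vanishes on \<open>C\<^bsub>t\<le>-1\<^esub>\<close> and on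
  \<open>C\<^bsub>t\<ge>1\<^esub>\<close>, so \<open>A \<in> P\<^sub>t\<close>. Restricted to the heart it is \<open>C(P, -)\<close>, while \<open>C(A, -)\<close> is there
  \<open>C(t\<^bsub>\<le>0\<^esub>A, -)\<close>; the Yoneda argument, carried out with the universal element \<open>\<alpha>\<close>, shows
  \<open>t\<^bsub>\<le>0\<^esub>A \<cong> P\<close>.\<close>

lemma projective_lifts_of_dual_Brown:
  assumes ls: "locally_small TYPE('u) C" and dB: "dual_Brown_representability TYPE('u) C"
    and ct: "cosmashing_t_structure TYPE('u) C t" and P: "projective heart P"
  shows "\<exists>A \<in> P_t C t. isomorphic heart (H0_t C t A) P"
proof -
  have P': "P \<in> LE0 t" "P \<in> GE0 t" using P by (simp_all add: projective_def)
  have PO: "P \<in> Obj C" using P' t_le_obj by auto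
  have cs: "cosmashing TYPE('u) C" "product_closed TYPE('u) C (GE0 t)"
    using ct by (simp_all add: cosmashing_t_structure_def)
  note y = le_trunc_trunc and yD = truncD and FM = trunc_map
  define GO where "GO Y = hom_group C P (trunc Y)" for Y
  define GM where "GM f a = trunc_map f \<cdot> a" for f a
  have car: "carrier (GO Y) = Hom C P (trunc Y)" and mult: "monoid.mult (GO Y) = Add C"
    and one: "\<one>\<^bsub>GO Y\<^esub> = Zero C P (trunc Y)" for Y by (simp_all add: GO_def)
  have GMc: "GM f a \<in> Hom C P (trunc Y)" if "f \<in> Hom C X Y" "a \<in> Hom C P (trunc X)" for f a X Y
    unfolding GM_def using comp_in[OF that(2) FM(1)[OF that(1)]] .
  have "\<exists>A \<in> Obj C. \<exists>\<eta>. (\<forall>Y \<in> Obj C. bij_betw (\<eta> Y) (Hom C A Y) (carrier (GO Y))) \<and>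
    (\<forall>Y Z. \<forall>f \<in> Hom C Y Z. \<forall>a \<in> Hom C A Y. \<eta> Z (f \<cdot> a) = GM f (\<eta> Y a))"
  proof (rule dual_Brown_corepresents[OF dB])
    fix X assume X: "X \<in> Obj C"
    show "comm_group (GO X)" unfolding GO_def by (rule hom_comm_group[OF PO truncD(3)[OF X]])
    show "small TYPE('u) (carrier (GO X))" using ls PO truncD(3)[OF X] by (simp add: car locally_small_def)
    show "GM (Ident C X) a = a" if "a \<in> carrier (GO X)" for a
      using that by (simp add: car GM_def trunc_map_ident[OF X] Hom_iff)
  next
    fix f X Y assume f: "f \<in> Hom C X Y"
    note Ff = FM(1)[OF f, unfolded Hom_iff]
    show "GM f \<in> hom (GO X) (GO Y)"
      using GMc[OF f] Ff by (intro homI) (auto simp: car mult GM_def Hom_iff comp_add)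
    show "GM (g \<cdot> f) a = GM g (GM f a)" if "g \<in> Hom C Y Z" "a \<in> carrier (GO X)" for g Z a
      using that Ff FM(1)[OF that(1)] by (simp add: GM_def trunc_map_comp[OF f that(1)] car Hom_iff assoc)
    show "GM (Add C f g) a = GM f a \<otimes>\<^bsub>GO Y\<^esub> GM g a" if "g \<in> Hom C X Y" "a \<in> carrier (GO X)" for g a
      using that Ff FM(1)[OF that(1)] by (simp add: GM_def trunc_map_add[OF f that(1)] car mult Hom_iff add_comp)
  next
    fix X Y Z f g h assume d: "distinguished C X Y Z f g h"
    note D = distD[OF d]
    show "GM f ` carrier (GO X) = kernel (GO Y) (GO Z) (GM g)"
    proof (intro subset_antisym subsetI)
      fix b assume "b \<in> GM f ` carrier (GO X)"
      then obtain a where a: "a \<in> Hom C P (trunc X)" "b = GM f a" by (auto simp: car)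
      note hh = FM(1)[OF D(1), unfolded Hom_iff] FM(1)[OF D(2), unfolded Hom_iff] a(1)[unfolded Hom_iff]
      have "GM g b = (trunc_map g \<cdot> trunc_map f) \<cdot> a" using hh a(2) by (simp add: GM_def assoc)
      also have "\<dots> = Zero C P (trunc Z)"
        unfolding trunc_map_comp[OF D(1,2), symmetric] dist_comp_zero[OF d] trunc_map_zero[OF D(4,6)]
        using hh truncD(3)[OF D(6)] by simp
      finally show "b \<in> kernel (GO Y) (GO Z) (GM g)" using GMc[OF D(1) a(1)] a(2) by (simp add: kernel_def car one)
    next
      fix b assume "b \<in> kernel (GO Y) (GO Z) (GM g)"
      then have b: "b \<in> Hom C P (trunc Y)" "trunc_map g \<cdot> b = Zero C P (trunc Z)" by (simp_all add: kernel_def car one GM_def)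
      from projective_exact_on_truncations[OF P d y[OF D(4)] y[OF D(5)] y[OF D(6)] FM[OF D(1)] FM[OF D(2)] b]
      show "b \<in> GM f ` carrier (GO X)" by (auto simp: car GM_def)
    qed
  next
    fix I :: "'u set" and X S \<pi>
    assume I: "small TYPE('u) I" and X: "\<And>i. i \<in> I \<Longrightarrow> X i \<in> Obj C" and S: "is_product C I X S \<pi>"
    note s = is_productD[OF S]
    have T: "is_product C I (\<lambda>i. trunc (X i)) (trunc S) (\<lambda>i. trunc_map (\<pi> i))"
      by (rule le_trunc_product[OF cs I S y[OF X] y[OF s(1)] FM[OF s(2)]])
    note tD = is_productD[OF T]
    show "bij_betw (\<lambda>a. \<lambda>i\<in>I. GM (\<pi> i) a) (carrier (GO S)) (\<Pi>\<^sub>E i\<in>I. carrier (GO (X i)))"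
      unfolding bij_betw_def car
    proof (intro conjI inj_onI subset_antisym subsetI)
      fix a b assume a: "a \<in> Hom C P (trunc S)" "b \<in> Hom C P (trunc S)"
        and eq: "(\<lambda>i\<in>I. GM (\<pi> i) a) = (\<lambda>i\<in>I. GM (\<pi> i) b)"
      show "a = b"
      proof (rule product_eqI[OF T a])
        fix i assume "i \<in> I"
        then show "trunc_map (\<pi> i) \<cdot> a = trunc_map (\<pi> i) \<cdot> b" using fun_cong[OF eq, of i] by (simp add: GM_def)
      qed
    next
      fix c assume "c \<in> (\<lambda>a. \<lambda>i\<in>I. GM (\<pi> i) a) ` Hom C P (trunc S)"
      then show "c \<in> (\<Pi>\<^sub>E i\<in>I. Hom C P (trunc (X i)))" using GMc[OF s(2)] by auto
    next
      fix c assume c: "c \<in> (\<Pi>\<^sub>E i\<in>I. Hom C P (trunc (X i)))"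
      then have "c i \<in> Hom C P (trunc (X i))" if "i \<in> I" for i using that by auto
      from tD(3)[OF PO, of c, OF this] obtain a where a: "a \<in> Hom C P (trunc S)" "\<And>i. i \<in> I \<Longrightarrow> trunc_map (\<pi> i) \<cdot> a = c i" by blast
      have "(\<lambda>i\<in>I. GM (\<pi> i) a) = c"
        by (rule PiE_ext[OF _ c]) (use GMc[OF s(2) a(1)] a(2) in \<open>auto simp: GM_def\<close>)
      then show "c \<in> (\<lambda>a. \<lambda>i\<in>I. GM (\<pi> i) a) ` Hom C P (trunc S)" using a(1) by blast
    qed
  qed
  then obtain A \<eta> where A: "A \<in> Obj C"
    and bij: "\<And>Y. Y \<in> Obj C \<Longrightarrow> bij_betw (\<eta> Y) (Hom C A Y) (carrier (GO Y))"
    and nat: "\<And>Y Z f a. f \<in> Hom C Y Z \<Longrightarrow> a \<in> Hom C A Y \<Longrightarrow> \<eta> Z (f \<cdot> a) = GM f (\<eta> Y a)" by metis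
  have \<eta>c: "\<eta> Y f \<in> Hom C P (trunc Y)" if "f \<in> Hom C A Y" for f Y
    using bij[OF HomD(5)[OF that]] that by (auto simp: bij_betw_def car)
  have inj: "f = g" if "f \<in> Hom C A Y" "g \<in> Hom C A Y" "\<eta> Y f = \<eta> Y g" for f g Y
    using bij[OF HomD(5)[OF that(1)]] that by (auto simp: bij_betw_def dest: inj_onD)
  have perpA: "perp C A Y" if Y: "Y \<in> Obj C" and p: "perp C P (trunc Y)" for Y
  proof (subst perp_iff[OF A Y], rule ballI)
    fix f assume f: "f \<in> Hom C A Y"
    have "\<eta> Y f = \<eta> Y (Zero C A Y)"
      using perpD[OF p \<eta>c[OF f]] perpD[OF p \<eta>c[OF zero_in[OF A Y]]] by simp
    then show "f = Zero C A Y" by (rule inj[OF f zero_in[OF A Y]])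
  qed
  have "A \<in> P_t C t"
    unfolding P_t_def left_perp_def
  proof (intro CollectI conjI ballI A)
    fix Y assume "Y \<in> LE C t (-1) \<union> GE C t 1"
    then show "perp C A Y"
    proof
      assume Y: "Y \<in> LE C t (-1)"
      have YO: "Y \<in> Obj C" using LE_obj[OF Y] .
      obtain T u h where T: "T \<in> GE C t 1" and d: "distinguished C T Y (trunc Y) u (trunc_unit Y) h"
        using y[OF YO] by (auto simp: le_trunc_def)
      have "trunc Y \<in> LE C t (0 + 1)" "Y \<in> LE C t 0" using yD(4)[OF YO] Y LE_mono[of 0 1] LE_mono[of "-1" 0] by auto
      then have "T \<in> LE C t 0" using LE_fibre[OF triangleI[OF d]] by blast
      then have "zero_object C (ShO C 1 T)" using GE_LE_zero[OF T, of 0] zero_object_shift by simp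
      from iso_of_zero_cone[OF rotate[OF d] this] have "trunc Y \<in> LE C t (-1)"
        using LE_isomorphic[OF Y] by (auto simp: isomorphic_def)
      then have "perp C P (trunc Y)" using t_perp[of P 0 _ "-1"] P' by simp
      then show ?thesis by (rule perpA[OF YO])
    next
      assume Y: "Y \<in> GE C t 1"
      have YO: "Y \<in> Obj C" using GE_obj[OF Y] .
      obtain T u h where T: "T \<in> GE C t 1" and d: "distinguished C T Y (trunc Y) u (trunc_unit Y) h"
        using y[OF YO] by (auto simp: le_trunc_def)
      have "T \<in> GE C t (1 - 1)" using T GE_antimono[of 0 1] by auto
      from GE_cone[OF triangleI[OF d] this Y] have "zero_object C (trunc Y)"
        using GE_LE_zero[of "trunc Y" 1 0] yD(4)[OF YO] by simp
      then show ?thesis using perp_zero PO by (intro perpA[OF YO]) auto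
    qed
  qed
  have AG: "A \<in> GE0 t" using \<open>A \<in> P_t C t\<close> by (simp add: P_t_iff)
  let ?H = "trunc A"
  have HO: "?H \<in> Obj C" using truncD(3)[OF A] .
  note yA = yD(1)[OF A, unfolded Hom_iff]
  define \<alpha> where "\<alpha> = \<eta> A (Ident C A)"
  have \<alpha>: "\<alpha> \<in> Hom C P ?H" unfolding \<alpha>_def by (rule \<eta>c[OF ident_in[OF A]])
  have \<eta>: "\<eta> Y f = trunc_map f \<cdot> \<alpha>" if f: "f \<in> Hom C A Y" for f Y
    using nat[OF f ident_in[OF A]] comp_ident_right[OF f] by (simp add: \<alpha>_def GM_def)
  have tP: "le_trunc P P (Ident C P)"
  proof -
    obtain M where M: "zero_object C M" using zero_object_exists by blast
    have d: "distinguished C P P M (Ident C P) (Zero C P M) (Zero C M (ShO C 1 P))"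
      by (rule TR1_ident[OF PO M])
    have "ShO C (-1) M \<in> GE C t 1" using zero_in_GE[OF zero_object_shift[OF M]] .
    then show ?thesis using rotate_back[OF d] P' by (auto simp: le_trunc_def)
  qed
  obtain c0 c1 where cP: "c0 \<in> Hom C (trunc P) P" "c1 \<in> Hom C P (trunc P)" "c0 \<cdot> trunc_unit P = Ident C P"
    "c1 \<cdot> c0 = Ident C (trunc P)" "c0 \<cdot> c1 = Ident C P" "c1 \<cdot> Ident C P = trunc_unit P"
    using le_trunc_unique[OF y[OF PO] tP] by blast
  have c1: "c1 = trunc_unit P" using cP(6) cP(2) by (simp add: Hom_iff)
  \<comment> \<open>The inverse of \<open>\<alpha>\<close> is the map corresponding to the identity of \<open>P\<close>.\<close>
  obtain u where u: "u \<in> Hom C A P" "\<eta> P u = trunc_unit P"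
    using bij[OF PO] yD(1)[OF PO] unfolding bij_betw_def car by (metis imageE)
  define c where "c = c0 \<cdot> trunc_map u"
  have c: "c \<in> Hom C ?H P" unfolding c_def by (rule comp_in[OF FM(1)[OF u(1)] cP(1)])
  note h = yA \<alpha>[unfolded Hom_iff] c[unfolded Hom_iff] cP(1)[unfolded Hom_iff] FM(1)[OF u(1), unfolded Hom_iff] PO A HO
  have "c \<cdot> \<alpha> = c0 \<cdot> (trunc_map u \<cdot> \<alpha>)" unfolding c_def using h by (simp add: assoc)
  also have "\<dots> = Ident C P" using u(2) cP(3) by (simp add: \<eta>[OF u(1)])
  finally have c\<alpha>: "c \<cdot> \<alpha> = Ident C P" .
  have FMy: "trunc_map (v \<cdot> trunc_unit A) = trunc_unit ?H \<cdot> v" if v: "v \<in> Hom C ?H ?H" for v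
  proof (rule trunc_map_unique[OF comp_in[OF yD(1)[OF A] v] comp_in[OF v yD(1)[OF HO]]])
    show "(trunc_unit ?H \<cdot> v) \<cdot> trunc_unit A = trunc_unit ?H \<cdot> (v \<cdot> trunc_unit A)"
      using v yA yD(1)[OF HO] by (simp add: Hom_iff assoc)
  qed
  have ac: "\<alpha> \<cdot> c \<in> Hom C ?H ?H" by (rule comp_in[OF c \<alpha>])
  note yH = yD(1)[OF HO, unfolded Hom_iff]
  have "\<eta> ?H ((\<alpha> \<cdot> c) \<cdot> trunc_unit A) = (trunc_unit ?H \<cdot> (\<alpha> \<cdot> c)) \<cdot> \<alpha>"
    unfolding \<eta>[OF comp_in[OF yD(1)[OF A] ac]] FMy[OF ac] ..
  also have "\<dots> = trunc_unit ?H \<cdot> (\<alpha> \<cdot> (c \<cdot> \<alpha>))" using h yH by (simp add: assoc)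
  also have "\<dots> = (trunc_unit ?H \<cdot> Ident C ?H) \<cdot> \<alpha>" unfolding c\<alpha> using h yH by simp
  also have "\<dots> = \<eta> ?H (Ident C ?H \<cdot> trunc_unit A)"
    unfolding \<eta>[OF comp_in[OF yD(1)[OF A] ident_in[OF HO]]] FMy[OF ident_in[OF HO]] ..
  finally have "(\<alpha> \<cdot> c) \<cdot> trunc_unit A = Ident C ?H \<cdot> trunc_unit A"
    by (rule inj[OF comp_in[OF yD(1)[OF A] ac] comp_in[OF yD(1)[OF A] ident_in[OF HO]]])
  then have \<alpha>c: "\<alpha> \<cdot> c = Ident C ?H"
    by (rule le_trunc_cancel[OF y[OF A] yD(4)[OF A] ac ident_in[OF HO]])
  obtain p where p: "le_trunc A (H0_t C t A) p" using H0_trunc[OF AG] by blast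
  obtain e e' where e: "e \<in> Hom C (H0_t C t A) ?H" "e' \<in> Hom C ?H (H0_t C t A)"
    "e' \<cdot> e = Ident C (H0_t C t A)" "e \<cdot> e' = Ident C ?H"
    using le_trunc_unique[OF p y[OF A]] by blast
  note h = h e(1,2)[unfolded Hom_iff] le_truncD(3)[OF p]
  have "(e' \<cdot> \<alpha>) \<cdot> (c \<cdot> e) = e' \<cdot> ((\<alpha> \<cdot> c) \<cdot> e)" using h by (simp add: assoc)
  also have "\<dots> = Ident C (H0_t C t A)" unfolding \<alpha>c using h e(3) by simp
  finally have 1: "(e' \<cdot> \<alpha>) \<cdot> (c \<cdot> e) = Ident C (H0_t C t A)" .
  have "(c \<cdot> e) \<cdot> (e' \<cdot> \<alpha>) = c \<cdot> ((e \<cdot> e') \<cdot> \<alpha>)" using h by (simp add: assoc)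
  also have "\<dots> = Ident C P" unfolding e(4) using h c\<alpha> by simp
  finally have 2: "(c \<cdot> e) \<cdot> (e' \<cdot> \<alpha>) = Ident C P" .
  have "is_iso C (H0_t C t A) P (c \<cdot> e)"
    unfolding is_iso_def using 1 2 h comp_in[OF e(1) c] comp_in[OF \<alpha> e(2)] by blast
  then have "isomorphic heart (H0_t C t A) P"
    using P' le_truncD(4)[OF p] le_trunc_GE0[OF p AG] by (auto simp: isomorphic_def is_iso_heart)
  then show ?thesis using \<open>A \<in> P_t C t\<close> by blast
qed

lemma enough_lifted_projectives_of_isomorphic:
  assumes "\<And>P. projective heart P \<Longrightarrow> \<exists>A \<in> P_t C t. isomorphic heart (H0_t C t A) P"
  shows enough_lifted_projectives
  unfolding enough_lifted_projectives_def
proof (intro allI impI)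
  fix P assume "projective heart P"
  from assms[OF this] obtain A e where A: "A \<in> P_t C t" "is_iso heart (H0_t C t A) P e"
    by (auto simp: isomorphic_def)
  interpret H: category heart by (rule category_heart)
  let ?H = heart
  obtain d where e: "e \<in> Hom ?H (H0_t C t A) P" and d: "d \<in> Hom ?H P (H0_t C t A)" "e \<cdot>\<^bsub>?H\<^esub> d = Ident ?H P"
    using A(2) unfolding is_iso_def by blast
  have *: "f = (f \<cdot>\<^bsub>?H\<^esub> e) \<cdot>\<^bsub>?H\<^esub> d" if "f \<in> Hom ?H P Z" for f Z
    using H.comp_assoc[OF d(1) e that] d(2) H.comp_ident_right[OF that] by simp
  have "epimorphism ?H e"
    unfolding epimorphism_def
  proof (intro conjI allI ballI impI)
    show "e \<in> Arr ?H" using e by (simp add: Hom_def)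
    have cod: "Cod ?H e = P" using e by (simp add: Hom_def)
    show "f = g" if "f \<in> Hom ?H (Cod ?H e) Z" "g \<in> Hom ?H (Cod ?H e) Z" "f \<cdot>\<^bsub>?H\<^esub> e = g \<cdot>\<^bsub>?H\<^esub> e" for f g Z
      using *[of f Z] *[of g Z] that unfolding cod by metis
  qed
  then show "\<exists>A\<in>P_t C t. \<exists>e\<in>Hom ?H (H0_t C t A) P. epimorphism ?H e" using A(1) e by blast
qed

end

theorem theorem5p2p2:
  fixes C :: "('o, 'm) tri_data" and t :: "'o class_pair"
  assumes "triangulated_category C"
    and "t_structure C t"
    and "enough_projectives (pair_heart C t)"
    and countable_sets_small: "small TYPE('u) (UNIV :: nat set)"
  shows
    "((\<forall>P. projective (pair_heart C t) P \<longrightarrow>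
        (\<exists>P' \<in> P_t C t. \<exists>e \<in> Hom (pair_heart C t) (H0_t C t P') P. epimorphism (pair_heart C t) e)) \<longrightarrow>
      triangulated_subcategory C (bounded_below_objects C t) \<and>
      (\<exists>w_plus. weight_structure (full_subcat C (bounded_below_objects C t)) w_plus \<and>
        GE0 w_plus = GE0 t \<and> minus_orthogonal C t w_plus) \<and>
      (bounded_below_objects C t = Obj C \<or> (\<exists>n. class_perp C (LE0 t) (GE C t n)) \<longrightarrow>
        (\<forall>w_plus. weight_structure (full_subcat C (bounded_below_objects C t)) w_plus \<and>
            GE0 w_plus = GE0 t \<longrightarrow>
          (\<exists>w. weight_structure C w \<and>
            extends_weight_structure C (bounded_below_objects C t) w w_plus \<and>
            left_adjacent w t))) \<and>
      (smashing TYPE('u) C \<longrightarrow>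
        (let C_tilde = full_subcat C (localizing_subcategory TYPE('u) C (GE0 t)) in
          \<exists>w. smashing_weight_structure TYPE('u) C_tilde w \<and> GE0 w = GE0 t \<and>
            equivalent_categories (pair_heart C_tilde w) (projective_subcat (pair_heart C t)))))
    \<and>
     (locally_small TYPE('u) C \<and> dual_Brown_representability TYPE('u) C \<and>
        cosmashing_t_structure TYPE('u) C t \<longrightarrow>
      smashing TYPE('u) C \<and>
      (\<forall>P. projective (pair_heart C t) P \<longrightarrow>
        (\<exists>P' \<in> P_t C t. isomorphic (pair_heart C t) (H0_t C t P') P)) \<and>
      (let C_tilde = full_subcat C (localizing_subcategory TYPE('u) C (GE0 t)) in
        \<exists>w. smashing_weight_structure TYPE('u) C_tilde w \<and> GE0 w = GE0 t \<and>
          equivalent_categories (pair_heart C_tilde w) (projective_subcat (pair_heart C t))))"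
proof -
  interpret t_structure C t by fact
  let ?B = "bounded_below_objects C t"
  have GB: "GE0 t \<subseteq> ?B" using GE_0 by (auto simp: bounded_below_eq simp del: GE_0)
  show ?thesis
  proof (intro conjI impI)
    assume lift: "\<forall>P. projective (pair_heart C t) P \<longrightarrow>
        (\<exists>P' \<in> P_t C t. \<exists>e \<in> Hom (pair_heart C t) (H0_t C t P') P. epimorphism (pair_heart C t) e)"
    have lifted: enough_lifted_projectives using lift by (simp add: enough_lifted_projectives_def)
    have wb: "weight_decomposable M" if "M \<in> ?B" for M
      using weight_decomposable_bounded_below[OF assms(3) lifted] that by (auto simp: bounded_below_eq)
    show "triangulated_subcategory C ?B" by (rule triangulated_bounded_below)
    show "\<exists>w_plus. weight_structure (full_subcat C ?B) w_plus \<and> GE0 w_plus = GE0 t \<and> minus_orthogonal C t w_plus"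
      using weight_structure_of_decompositions[OF triangulated_bounded_below GB wb]
      by (intro exI[of _ "\<lparr>LE0 = weight_le \<inter> ?B, GE0 = GE0 t\<rparr>"]) (simp add: minus_orthogonal_of_same_GE0)
    show "\<forall>w_plus. weight_structure (full_subcat C ?B) w_plus \<and> GE0 w_plus = GE0 t \<longrightarrow>
          (\<exists>w. weight_structure C w \<and> extends_weight_structure C ?B w w_plus \<and> left_adjacent w t)"
      if "?B = Obj C \<or> (\<exists>n. class_perp C (LE0 t) (GE C t n))"
    proof (intro allI impI)
      fix v assume v: "weight_structure (full_subcat C ?B) v \<and> GE0 v = GE0 t"
      have "weight_decomposable M" if M: "M \<in> Obj C" for M
        using \<open>?B = Obj C \<or> (\<exists>n. class_perp C (LE0 t) (GE C t n))\<close> wb weight_decomposable_of_orthogonal_bound M by metis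
      then show "\<exists>w. weight_structure C w \<and> extends_weight_structure C ?B w v \<and> left_adjacent w t"
        using extend_weight_structure[OF _ _ triangulated_bounded_below GB] v by blast
    qed
    show "let C_tilde = full_subcat C (localizing_subcategory TYPE('u) C (GE0 t)) in
          \<exists>w. smashing_weight_structure TYPE('u) C_tilde w \<and> GE0 w = GE0 t \<and>
            equivalent_categories (pair_heart C_tilde w) (projective_subcat (pair_heart C t))"
      if "smashing TYPE('u) C"
      by (rule localizing_weight_structure[OF assms(3) lifted that countable_sets_small])
  next
    assume B: "locally_small TYPE('u) C \<and> dual_Brown_representability TYPE('u) C \<and>
        cosmashing_t_structure TYPE('u) C t"
    show sm: "smashing TYPE('u) C" using smashing_of_dual_Brown B by blast
    have pl: "\<exists>P' \<in> P_t C t. isomorphic (pair_heart C t) (H0_t C t P') P" if "projective (pair_heart C t) P" for P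
      using projective_lifts_of_dual_Brown that B by blast
    then show "\<forall>P. projective (pair_heart C t) P \<longrightarrow>
        (\<exists>P' \<in> P_t C t. isomorphic (pair_heart C t) (H0_t C t P') P)" by blast
    show "let C_tilde = full_subcat C (localizing_subcategory TYPE('u) C (GE0 t)) in
        \<exists>w. smashing_weight_structure TYPE('u) C_tilde w \<and> GE0 w = GE0 t \<and>
          equivalent_categories (pair_heart C_tilde w) (projective_subcat (pair_heart C t))"
      by (rule localizing_weight_structure[OF assms(3) enough_lifted_projectives_of_isomorphic[OF pl] sm countable_sets_small])
  qed
qed

end
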